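(* Let $\mathcal{A}$, $c$, $\gamma$, the problem (P) and the sequence $\{\omega_k\}$ be as in the context. Suppose that $\{\omega_k\}$ converges to a local maximizer $\omega_\ast$ of (P), that $\lambda_\ast := \lambda_{\min}(\mathcal{A}(\omega_\ast))$ is simple, and that $\nabla\lambda_\ast := \nabla\lambda_{\min}(\mathcal{A}(\omega_\ast)) \neq 0$. Write $\nabla^2\lambda_\ast := \nabla^2\lambda_{\min}(\mathcal{A}(\omega_\ast))$ and $u := \nabla\lambda_\ast/\|\nabla\lambda_\ast\|$; let $V\in\mathbb{R}^{d\times(d-1)}$ have columns forming an orthonormal basis of the subspace orthogonal to $\nabla\lambda_\ast$, and let $\mathcal{H}_V := V^T\,\nabla^2\lambda_\ast\, V$. Then one of the following two holds: (1) If $$\lim_{k\to\infty}\left[I - \frac{1}{\gamma}\nabla^2\lambda_\ast\right]\frac{\omega_k-\omega_\ast}{\|\omega_k-\omega_\ast\|} \in \mathrm{span}\{u\},$$ then $$\lim_{k\to\infty}\frac{\|\omega_{k+1}-\omega_\ast\|}{\|\omega_k-\omega_\ast\|} = 0;$$ (2) Otherwise, $$\frac{1}{\gamma}\sigma_{\min}(\gamma I - \mathcal{H}_V) \;\le\; \lim_{k\to\infty}\frac{\|\omega_{k+1}-\omega_\ast\|}{\|\omega_k-\omega_\ast\|} \;\le\; \frac{1}{\gamma}\|\gamma I - \mathcal{H}_V\|.$$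
   Context: $\mathcal{A} : \mathbb{R}^d \to \mathbb{C}^{n\times n}$ is (real-)analytic and Hermitian-valued; $c \in \mathbb{R}^d$ with $c \neq 0$. $\lambda_{\min}(\cdot)$, $\lambda_{\max}(\cdot)$ denote the smallest and largest eigenvalue, $\sigma_{\min}(\cdot)$ the smallest singular value, and $\|\cdot\|$ the Euclidean norm of vectors and the spectral norm of matrices. The feasible set $\mathcal{F} := \{\omega\in\mathbb{R}^d : \lambda_{\min}(\mathcal{A}(\omega)) \le 0\}$ is assumed bounded. Problem (P): maximize $c^T\omega$ subject to $\omega \in \mathcal{F}$; $\omega_\ast\in\mathcal{F}$ is a local maximizer of (P) if there is $\delta>0$ with $c^T\omega_\ast \ge c^T\omega$ for all $\omega\in\mathcal{F}$ with $\|\omega-\omega_\ast\|\le\delta$. The constant $\gamma>0$ satisfies $\lambda_{\max}[\nabla^2\lambda_{\min}(\mathcal{A}(\omega))] \le \gamma$ for all $\omega\in\mathbb{R}^d$ at which $\lambda_{\min}(\mathcal{A}(\omega))$ is simple ($\lambda_{\min}(\mathcal{A}(\cdot))$ is twice continuously differentiable at such points). The sequence: $\omega_0\in\mathcal{F}$ is given, and for each $k\ge 0$, $\omega_{k+1}$ is the unique maximizer of $c^T\omega$ subject to $$q_k(\omega) := \lambda_k + \nabla\lambda_k^T(\omega-\omega_k) + \tfrac{\gamma}{2}\|\omega-\omega_k\|^2 \le 0,$$ where $\lambda_k := \lambda_{\min}(\mathcal{A}(\omega_k))$ and $\nabla\lambda_k := \nabla\lambda_{\min}(\mathcal{A}(\omega_k))$.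 It is assumed that $\lambda_{\min}(\mathcal{A}(\omega_k))$ is simple and $\nabla\lambda_k\ne0$ for each $k$. Equivalently, $\omega_{k+1} = \omega_k + \frac{1}{\gamma}\left[\frac{\sqrt{\|\nabla\lambda_k\|^2 - 2\gamma\lambda_k}}{\|c\|}\, c - \nabla\lambda_k\right]$. *)

theory Defs
  imports
    "HOL-Analysis.Analysis"
    "Jordan_Normal_Form.Char_Poly"
    "Jordan_Normal_Form.Schur_Decomposition"
begin

no_notation vec_index (infixl "$" 100)
no_notation scalar_prod (infix "\<bullet>" 70)

text \<open>
  Points of \<open>\<real>\<^sup>d\<close> and the Hessians acting on them have the types \<open>real ^ 'd\<close> and
  \<open>real ^ 'd ^ 'd\<close>. The matrices of size \<open>n\<close> and \<open>d - 1\<close> are matrices with explicit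
  dimensions, so that \<open>d = 1\<close> is not excluded.
\<close>

text \<open>
  Real analyticity in several variables: around every point, the function is the sum of an
  absolutely convergent power series. A function \<open>\<alpha> :: 'd \<Rightarrow> nat\<close> is a multi-index.
\<close>

definition real_analytic :: "(real ^ 'd \<Rightarrow> complex) \<Rightarrow> bool" where
  "real_analytic f \<longleftrightarrow>
     (\<forall>a. \<exists>(coef :: ('d \<Rightarrow> nat) \<Rightarrow> complex) r. r > 0 \<and>
        (\<forall>x\<in>ball a r.
           ((\<lambda>\<alpha>. coef \<alpha> * complex_of_real (\<Prod>i\<in>UNIV. (x $ i - a $ i) ^ \<alpha> i)) has_sum f x) UNIV))"

definition real_analytic_mat :: "nat \<Rightarrow> (real ^ 'd \<Rightarrow> complex mat) \<Rightarrow> bool" where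
  "real_analytic_mat n A \<longleftrightarrow>
     (\<forall>x. A x \<in> carrier_mat n n) \<and> (\<forall>i<n. \<forall>j<n. real_analytic (\<lambda>x. A x $$ (i, j)))"

text \<open>The eigenvalues of a Hermitian matrix are real, so the minimum may be taken in \<open>\<real>\<close>.\<close>

definition lambda_min :: "complex mat \<Rightarrow> real" where
  "lambda_min M = Min {\<mu>. eigenvalue M (complex_of_real \<mu>)}"

definition simple_lambda_min :: "complex mat \<Rightarrow> bool" where
  "simple_lambda_min M \<longleftrightarrow> Polynomial.order (complex_of_real (lambda_min M)) (char_poly M) = 1"

definition lambda_max_sym :: "real ^ 'd ^ 'd \<Rightarrow> real" where
  "lambda_max_sym H = Max {\<mu>. \<exists>v. v \<noteq> 0 \<and> H *v v = \<mu> *\<^sub>R v}"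

text \<open>
  Intended for square matrices; for the \<open>0 \<times> 0\<close> matrix there are no singular values, and
  \<open>sigma_min\<close> and \<open>spectral_norm\<close> are unspecified.
\<close>

definition singular_values :: "real mat \<Rightarrow> real set" where
  "singular_values B = sqrt ` {\<mu>. eigenvalue (transpose_mat B * B) \<mu>}"

definition sigma_min :: "real mat \<Rightarrow> real" where
  "sigma_min B = Min (singular_values B)"

definition spectral_norm :: "real mat \<Rightarrow> real" where
  "spectral_norm B = Max (singular_values B)"

definition grad :: "(real ^ 'd \<Rightarrow> real) \<Rightarrow> real ^ 'd \<Rightarrow> real ^ 'd" where
  "grad f x = (THE g. GDERIV f x :> g)"

definition hess :: "(real ^ 'd \<Rightarrow> real) \<Rightarrow> real ^ 'd \<Rightarrow> real ^ 'd ^ 'd" where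
  "hess f x = jacobian (grad f) (at x)"

definition feasible :: "(real ^ 'd \<Rightarrow> complex mat) \<Rightarrow> (real ^ 'd) set" where
  "feasible A = {x. lambda_min (A x) \<le> 0}"

definition local_maximizer :: "real ^ 'd \<Rightarrow> (real ^ 'd) set \<Rightarrow> real ^ 'd \<Rightarrow> bool" where
  "local_maximizer c F x \<longleftrightarrow>
     x \<in> F \<and> (\<exists>\<delta>>0. \<forall>y\<in>F. norm (y - x) \<le> \<delta> \<longrightarrow> c \<bullet> y \<le> c \<bullet> x)"

definition quad_model ::
    "(real ^ 'd \<Rightarrow> real) \<Rightarrow> real \<Rightarrow> real ^ 'd \<Rightarrow> real ^ 'd \<Rightarrow> real" where
  "quad_model f \<gamma> w x = f w + grad f w \<bullet> (x - w) + \<gamma> / 2 * (norm (x - w))\<^sup>2"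

definition orthonormal_basis_of :: "nat \<Rightarrow> (nat \<Rightarrow> real ^ 'd) \<Rightarrow> (real ^ 'd) set \<Rightarrow> bool" where
  "orthonormal_basis_of m v S \<longleftrightarrow>
     (\<forall>i<m. \<forall>j<m. v i \<bullet> v j = (if i = j then 1 else 0)) \<and> span (v ` {..<m}) = S"

text \<open>\<open>V\<^sup>T H V\<close>, where \<open>V\<close> is the matrix with the columns \<open>v 0, \<dots>, v (m - 1)\<close>.\<close>

definition compress :: "nat \<Rightarrow> (nat \<Rightarrow> real ^ 'd) \<Rightarrow> real ^ 'd ^ 'd \<Rightarrow> real mat" where
  "compress m v H = Matrix.mat m m (\<lambda>(i, j). v i \<bullet> (H *v v j))"

end

theory Submission
  imports Defs
begin

text \<open>
  Put \<open>e k = \<omega> k - \<omega>s\<close>, \<open>M = I - H / \<gamma>\<close> and let \<open>P\<close> be the orthogonal projection along \<open>u\<close>. Since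
  \<open>c\<close> is a positive multiple of the gradient at \<open>\<omega>s\<close>, differentiating the closed form of the update
  gives \<open>e (k + 1) = P M e k + o(e k)\<close>, where \<open>M\<close> is symmetric and, by the choice of \<open>\<gamma>\<close>,
  positive semidefinite. So \<open>P M\<close> is diagonalizable with nonnegative eigenvalues, one eigenspace
  eventually dominates \<open>e k\<close>, and the ratio of the norms converges to an eigenvalue \<open>\<rho>\<close> of \<open>P M\<close>.
  If \<open>\<rho>\<close> has an eigenvector orthogonal to \<open>u\<close>, then \<open>\<gamma> \<rho>\<close> is an eigenvalue of the positive
  semidefinite matrix \<open>\<gamma> I - HV\<close>, hence one of its singular values. Otherwise \<open>\<rho> = 0\<close> and the
  kernel of \<open>P M\<close> is a line; the iterates are eventually feasible, so \<open>u \<bullet> e k \<le> 0\<close>, which selects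
  one of the two directions of this line. Then the direction of \<open>e k\<close> converges, and this is case (1).

  The smallest eigenvalue is smooth where it is simple, being then a continuous simple root of the
  characteristic polynomial, whose coefficients are real analytic.
\<close>

text \<open>The error in the linearized recursion is only small relative to \<open>e k\<close>; no
  summability is available, so neither the direction of \<open>e k\<close> nor its position inside
  an eigenspace need converge. What survives is a rate, found by splitting the spectrum at each
  threshold \<open>t\<close>: either the part of \<open>e k\<close> above \<open>t\<close> or the
  rest becomes negligible. \<open>P M\<close> is not symmetric on the whole space, only on the
  orthogonal complement of \<open>u\<close>. Its diagonalizability rests on semidefiniteness: a unit
  vector \<open>v\<close> orthogonal to \<open>u\<close> with \<open>P M v = 0\<close> satisfies
  \<open>v \<bullet> M v = 0\<close>, hence \<open>M v = 0\<close>, which excludes a Jordan block at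
  0. The delicate situation is a limit 0 when \<open>P M\<close> is injective on the complement of
  \<open>u\<close>. There \<open>\<gamma> I - HV\<close> is nonsingular, so the lower bound of case
  (2) would fail if \<open>d > 1\<close>; it has to be shown that the hypothesis of case (1) then
  holds, and this needs convergence of the full direction, including its sign.\<close>

hide_const (open) VectorSpace.subspace Matrix.orthogonal
hide_fact (open) VectorSpace.subspace_def Matrix.orthogonal_def

section \<open>Power series in several variables\<close>

definition monomial :: "real ^ 'd \<Rightarrow> ('d \<Rightarrow> nat) \<Rightarrow> real ^ 'd \<Rightarrow> real" where
  "monomial a \<alpha> x = (\<Prod>i\<in>UNIV. (x $ i - a $ i) ^ \<alpha> i)"

text \<open>A box rather than a ball: \<open>s ^ sum \<alpha> UNIV\<close> is the largest absolute
  value of the monomial on it, so the first conjunct is a Weierstrass majorant at all points of the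
  closed box. Outside the box \<open>f\<close> is unconstrained.\<close>

definition box_series ::
    "real ^ 'd \<Rightarrow> real \<Rightarrow> (('d \<Rightarrow> nat) \<Rightarrow> complex) \<Rightarrow> (real ^ 'd \<Rightarrow> complex) \<Rightarrow> bool" where
  "box_series a s b f \<longleftrightarrow>
     (\<lambda>\<alpha>. norm (b \<alpha>) * s ^ sum \<alpha> UNIV) summable_on UNIV \<and>
     (\<forall>x. (\<forall>i. \<bar>x $ i - a $ i\<bar> \<le> s) \<longrightarrow>
        ((\<lambda>\<alpha>. b \<alpha> * of_real (monomial a \<alpha> x)) has_sum f x) UNIV)"

definition locally_series :: "(real ^ 'd \<Rightarrow> complex) \<Rightarrow> bool" where
  "locally_series f \<longleftrightarrow> (\<forall>a. \<exists>s>0. \<exists>b. box_series a s b f)"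

text \<open>Unconditional summability of complex numbers is absolute; used at one corner of the box,
  it already gives the majorant for the whole box.\<close>

lemma real_analytic_imp_locally_series:
  assumes "real_analytic f"
  shows "locally_series f"
  unfolding locally_series_def
proof
  fix a :: "real ^ 'a"
  obtain b r where r: "r > 0" and b: "\<And>x. x \<in> ball a r \<Longrightarrow>
      ((\<lambda>\<alpha>. b \<alpha> * complex_of_real (\<Prod>i\<in>UNIV. (x $ i - a $ i) ^ \<alpha> i)) has_sum f x) UNIV"
    using assms[unfolded real_analytic_def, rule_format, of a] by blast
  \<comment> \<open>The distance is at most the sum of the coordinate differences, so this width
    keeps the closed box within distance \<open>r / 2\<close> of \<open>a\<close>.\<close>
  define s where "s = r / (2 * real CARD('a))"
  have s: "s > 0" using r by (simp add: s_def)
  have in_ball: "x \<in> ball a r" if "\<And>i. \<bar>x $ i - a $ i\<bar> \<le> s" for x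
  proof -
    have "dist a x \<le> (\<Sum>i\<in>UNIV. \<bar>(a - x) $ i\<bar>)"
      unfolding dist_norm by (rule norm_le_l1_cart)
    also have "\<dots> \<le> (\<Sum>i\<in>(UNIV::'a set). s)"
      using that by (intro sum_mono) (simp add: abs_minus_commute)
    also have "\<dots> < r" using r by (simp add: s_def)
    finally show ?thesis by simp
  qed
  define x where "x = (\<chi> i. a $ i + s)"
  have "(\<lambda>\<alpha>. b \<alpha> * complex_of_real (\<Prod>i\<in>UNIV. (x $ i - a $ i) ^ \<alpha> i)) summable_on UNIV"
    using b[of x] in_ball[of x] s by (auto simp: x_def summable_on_def)
  then have "(\<lambda>\<alpha>. norm (b \<alpha> * complex_of_real (\<Prod>i\<in>UNIV. (x $ i - a $ i) ^ \<alpha> i))) summable_on UNIV"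
    by (simp only: summable_on_iff_abs_summable_on_complex)
  then have "(\<lambda>\<alpha>. norm (b \<alpha>) * s ^ sum \<alpha> UNIV) summable_on UNIV"
    using s by (simp add: x_def norm_mult power_sum abs_prod del: of_real_prod of_real_power)
  then have "box_series a s b f"
    unfolding box_series_def using b in_ball by (auto simp: monomial_def)
  then show "\<exists>s>0. \<exists>b. box_series a s b f" using s by blast
qed

lemma box_series_shrink:
  assumes "box_series a s b f" "0 < t" "t \<le> s"
    and "\<And>x. (\<And>i. \<bar>x $ i - a $ i\<bar> \<le> t) \<Longrightarrow> g x = f x"
  shows "box_series a t b g"
  unfolding box_series_def
proof (intro conjI allI impI)
  show "(\<lambda>\<alpha>. norm (b \<alpha>) * t ^ sum \<alpha> UNIV) summable_on UNIV"
  proof (rule summable_on_comparison_test)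
    show "(\<lambda>\<alpha>. norm (b \<alpha>) * s ^ sum \<alpha> UNIV) summable_on UNIV"
      using assms(1) by (simp add: box_series_def)
  qed (use assms in \<open>auto intro!: mult_left_mono power_mono\<close>)
  fix x assume x: "\<forall>i. \<bar>x $ i - a $ i\<bar> \<le> t"
  then have "\<forall>i. \<bar>x $ i - a $ i\<bar> \<le> s" using assms(3) order_trans by blast
  then show "((\<lambda>\<alpha>. b \<alpha> * of_real (monomial a \<alpha> x)) has_sum g x) UNIV"
    using assms(1) assms(4)[of x] x by (simp add: box_series_def)
qed

text \<open>Differentiation brings down a factor \<open>n\<close>. Since
  \<open>n \<le> 2 ^ n\<close>, halving the box absorbs it.\<close>

lemma nat_times_half_power_le:
  assumes "(s::real) > 0"
  shows "real n * (s / 2) ^ (n - 1) \<le> 2 / s * s ^ n"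
proof (cases n)
  case (Suc m)
  have "real (Suc m) \<le> 2 * 2 ^ m"
    using of_nat_less_two_power[of "Suc m", where 'a = real] by simp
  then have "real (Suc m) * s ^ m \<le> (2 * 2 ^ m) * s ^ m"
    using assms by (intro mult_right_mono) auto
  then show ?thesis using assms Suc by (simp add: power_divide field_simps)
qed (use assms in simp)

text \<open>The truncated subtraction in the exponent is harmless, because the factor
  \<open>real (\<alpha> i)\<close> vanishes when \<open>\<alpha> i = 0\<close>.\<close>

definition monomial_partial :: "real ^ 'd \<Rightarrow> 'd \<Rightarrow> ('d \<Rightarrow> nat) \<Rightarrow> real ^ 'd \<Rightarrow> real" where
  "monomial_partial a i \<alpha> x =
     real (\<alpha> i) * (x $ i - a $ i) ^ (\<alpha> i - 1) * (\<Prod>j\<in>UNIV - {i}. (x $ j - a $ j) ^ \<alpha> j)"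

lemma monomial_has_derivative:
  "(monomial a \<alpha> has_derivative (\<lambda>h. \<Sum>i\<in>UNIV. h $ i * monomial_partial a i \<alpha> x)) (at x within S)"
proof -
  have "((\<lambda>x. \<Prod>i\<in>UNIV. (x $ i - a $ i) ^ \<alpha> i) has_derivative
      (\<lambda>h. \<Sum>i\<in>UNIV. (real (\<alpha> i) * (h $ i) * (x $ i - a $ i) ^ (\<alpha> i - 1)) *
        (\<Prod>j\<in>UNIV - {i}. (x $ j - a $ j) ^ \<alpha> j))) (at x within S)"
  proof (rule has_derivative_prod)
    fix i :: 'a
    have "((\<lambda>x. x $ i - a $ i) has_derivative (\<lambda>h. h $ i)) (at x within S)"
      by (auto intro!: derivative_eq_intros bounded_linear_imp_has_derivative bounded_linear_vec_nth)
    from has_derivative_power[OF this, of "\<alpha> i"]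
    show "((\<lambda>x. (x $ i - a $ i) ^ \<alpha> i) has_derivative
        (\<lambda>h. real (\<alpha> i) * h $ i * (x $ i - a $ i) ^ (\<alpha> i - 1))) (at x within S)"
      by simp
  qed
  then show ?thesis
    by (simp add: monomial_def[abs_def] monomial_partial_def mult_ac)
qed

lemma abs_monomial_partial_le:
  assumes "\<And>i. \<bar>x $ i - a $ i\<bar> \<le> s"
  shows "\<bar>monomial_partial a i \<alpha> x\<bar> \<le> real (\<alpha> i) * s ^ (sum \<alpha> UNIV - 1)"
proof (cases "\<alpha> i")
  case 0
  then show ?thesis by (simp add: monomial_partial_def)
next
  case (Suc m)
  have s0: "s \<ge> 0" using assms[of i] by linarith
  have eq: "sum \<alpha> UNIV - 1 = m + sum \<alpha> (UNIV - {i})"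
    using Suc by (simp add: sum.remove[of UNIV i])
  have "\<bar>\<Prod>j\<in>UNIV - {i}. (x $ j - a $ j) ^ \<alpha> j\<bar> \<le> (\<Prod>j\<in>UNIV - {i}. s ^ \<alpha> j)"
    unfolding abs_prod power_abs by (intro prod_mono conjI power_mono assms) auto
  moreover have "\<bar>x $ i - a $ i\<bar> ^ m \<le> s ^ m"
    by (intro power_mono assms) auto
  ultimately have "\<bar>x $ i - a $ i\<bar> ^ m * \<bar>\<Prod>j\<in>UNIV - {i}. (x $ j - a $ j) ^ \<alpha> j\<bar>
      \<le> s ^ m * s ^ sum \<alpha> (UNIV - {i})"
    by (intro mult_mono) (use s0 in \<open>auto simp: power_sum\<close>)
  then show ?thesis
    using Suc unfolding eq monomial_partial_def abs_mult power_abs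
    by (simp add: power_add mult.assoc mult_left_mono)
qed

lemma monomial_partial_Suc:
  "monomial_partial a i (\<beta>(i := Suc (\<beta> i))) x = real (Suc (\<beta> i)) * monomial a \<beta> x"
proof -
  have "(\<Prod>j\<in>UNIV - {i}. (x $ j - a $ j) ^ (\<beta>(i := Suc (\<beta> i))) j) =
      (\<Prod>j\<in>UNIV - {i}. (x $ j - a $ j) ^ \<beta> j)"
    by (intro prod.cong) auto
  then show ?thesis
    by (simp add: monomial_partial_def monomial_def prod.remove[of UNIV i "\<lambda>j. (x $ j - a $ j) ^ \<beta> j"])
qed

lemma inj_Suc_at: "inj (\<lambda>\<beta>::'d \<Rightarrow> nat. \<beta>(i := Suc (\<beta> i)))"
proof (rule injI)
  fix \<beta> \<beta>' :: "'d \<Rightarrow> nat"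
  assume eq: "\<beta>(i := Suc (\<beta> i)) = \<beta>'(i := Suc (\<beta>' i))"
  show "\<beta> = \<beta>'"
  proof
    fix j show "\<beta> j = \<beta>' j" using fun_cong[OF eq, of j] by (cases "j = i") auto
  qed
qed

lemma range_Suc_at: "range (\<lambda>\<beta>::'d \<Rightarrow> nat. \<beta>(i := Suc (\<beta> i))) = {\<alpha>. \<alpha> i \<noteq> 0}"
proof (intro equalityI subsetI)
  fix \<alpha> :: "'d \<Rightarrow> nat" assume "\<alpha> \<in> {\<alpha>. \<alpha> i \<noteq> 0}"
  then have "\<alpha> = (\<lambda>\<beta>. \<beta>(i := Suc (\<beta> i))) (\<alpha>(i := \<alpha> i - 1))" by auto
  then show "\<alpha> \<in> range (\<lambda>\<beta>. \<beta>(i := Suc (\<beta> i)))" by blast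
qed auto

text \<open>Term-by-term differentiation. The differentiated series converges uniformly on the half
  box by the M-test; shifting the multi-indices by one at \<open>i\<close> makes it a power series
  again, so the step can be iterated.\<close>

lemma box_series_partial:
  assumes f: "box_series a s b f" and s: "s > 0"
  defines "G \<equiv> \<lambda>i x. \<Sum>\<^sub>\<infinity>\<alpha>. b \<alpha> * of_real (monomial_partial a i \<alpha> x)"
  shows "box_series a (s / 2) (\<lambda>\<beta>. of_nat (Suc (\<beta> i)) * b (\<beta>(i := Suc (\<beta> i)))) (G i)"
    and "\<And>x. (\<And>i. \<bar>x $ i - a $ i\<bar> < s / 2) \<Longrightarrow>
           (f has_derivative (\<lambda>h. \<Sum>i\<in>UNIV. of_real (h $ i) * G i x)) (at x)"
proof -
  \<comment> \<open>The total degree in place of \<open>\<alpha> i\<close> gives one majorant that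
    serves all partial derivatives.\<close>
  define M where "M = (\<lambda>\<alpha>. norm (b \<alpha>) * (real (sum \<alpha> UNIV) * (s / 2) ^ (sum \<alpha> UNIV - 1)))"
  have f_sum: "(\<lambda>\<alpha>. norm (b \<alpha>) * s ^ sum \<alpha> UNIV) summable_on UNIV"
    using f by (simp add: box_series_def)
  have M_sum: "M summable_on UNIV"
  proof (rule summable_on_comparison_test)
    show "(\<lambda>\<alpha>. 2 / s * (norm (b \<alpha>) * s ^ sum \<alpha> UNIV)) summable_on UNIV"
      by (intro summable_on_cmult_right f_sum)
    show "M \<alpha> \<le> 2 / s * (norm (b \<alpha>) * s ^ sum \<alpha> UNIV)" for \<alpha>
    proof -
      have "norm (b \<alpha>) * (real (sum \<alpha> UNIV) * (s / 2) ^ (sum \<alpha> UNIV - 1))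
          \<le> norm (b \<alpha>) * (2 / s * s ^ sum \<alpha> UNIV)"
        by (intro mult_left_mono nat_times_half_power_le s) auto
      then show ?thesis unfolding M_def by (simp add: mult_ac)
    qed
  qed (use s in \<open>auto simp: M_def sum_nonneg simp flip: of_nat_sum\<close>)
  have bound_i: "norm (b \<alpha> * of_real (monomial_partial a i \<alpha> x)) \<le>
      norm (b \<alpha>) * (real (\<alpha> i) * (s / 2) ^ (sum \<alpha> UNIV - 1))"
    if "\<And>i. \<bar>x $ i - a $ i\<bar> \<le> s / 2" for x i \<alpha>
    using abs_monomial_partial_le[OF that] by (simp add: norm_mult mult_left_mono)
  have le_M: "norm (b \<alpha>) * (real (\<alpha> i) * (s / 2) ^ (sum \<alpha> UNIV - 1)) \<le> M \<alpha>" for \<alpha> i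
    unfolding M_def using s by (intro mult_left_mono mult_right_mono) (auto simp: member_le_sum simp del: of_nat_sum)
  have G_sum: "((\<lambda>\<alpha>. b \<alpha> * of_real (monomial_partial a i \<alpha> x)) has_sum G i x) UNIV"
    if "\<And>i. \<bar>x $ i - a $ i\<bar> \<le> s / 2" for x i
  proof -
    have "(\<lambda>\<alpha>. norm (b \<alpha> * of_real (monomial_partial a i \<alpha> x))) summable_on UNIV"
      by (rule Infinite_Sum.abs_summable_on_comparison_test'[OF M_sum]) (rule order_trans[OF bound_i[OF that] le_M])
    then show ?thesis
      unfolding G_def by (rule has_sum_infsum[OF Infinite_Sum.abs_summable_summable])
  qed
  show "box_series a (s / 2) (\<lambda>\<beta>. of_nat (Suc (\<beta> i)) * b (\<beta>(i := Suc (\<beta> i)))) (G i)" for i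
    unfolding box_series_def
  proof (intro conjI allI impI)
    have "M summable_on range (\<lambda>\<beta>. \<beta>(i := Suc (\<beta> i)))"
      by (rule summable_on_subset_banach[OF M_sum]) auto
    then have "(\<lambda>\<beta>. M (\<beta>(i := Suc (\<beta> i)))) summable_on UNIV"
      by (subst (asm) summable_on_reindex[OF inj_Suc_at]) (simp add: o_def)
    then show "(\<lambda>\<beta>. norm (of_nat (Suc (\<beta> i)) * b (\<beta>(i := Suc (\<beta> i)))) * (s / 2) ^ sum \<beta> UNIV)
        summable_on UNIV"
    proof (rule summable_on_comparison_test)
      fix \<beta> :: "'a \<Rightarrow> nat"
      have "sum (\<beta>(i := Suc (\<beta> i))) (UNIV - {i}) = sum \<beta> (UNIV - {i})"
        by (intro sum.cong) auto
      then have "sum (\<beta>(i := Suc (\<beta> i))) UNIV - 1 = sum \<beta> UNIV"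
        by (simp add: sum.remove[of UNIV i])
      then show "norm (of_nat (Suc (\<beta> i)) * b (\<beta>(i := Suc (\<beta> i)))) * (s / 2) ^ sum \<beta> UNIV
          \<le> M (\<beta>(i := Suc (\<beta> i)))"
        using le_M[of "\<beta>(i := Suc (\<beta> i))" i]
        by (simp add: norm_mult mult_ac del: of_nat_Suc)
    qed (use s in auto)
    fix x assume x: "\<forall>i. \<bar>x $ i - a $ i\<bar> \<le> s / 2"
    \<comment> \<open>The terms with \<open>\<alpha> i = 0\<close> vanish; the other multi-indices
      are exactly the range of the shift.\<close>
    have "((\<lambda>\<alpha>. b \<alpha> * of_real (monomial_partial a i \<alpha> x)) has_sum G i x) {\<alpha>. \<alpha> i \<noteq> 0}"
      using G_sum[of x i] x
      by (subst has_sum_cong_neutral[where T = UNIV]) (auto simp: monomial_partial_def)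
    then have "((\<lambda>\<beta>. b (\<beta>(i := Suc (\<beta> i))) * of_real (monomial_partial a i (\<beta>(i := Suc (\<beta> i))) x))
        has_sum G i x) UNIV"
      unfolding range_Suc_at[symmetric]
      by (subst (asm) has_sum_reindex[OF inj_Suc_at]) (simp add: o_def)
    then show "((\<lambda>\<beta>. of_nat (Suc (\<beta> i)) * b (\<beta>(i := Suc (\<beta> i))) * of_real (monomial a \<beta> x))
        has_sum G i x) UNIV"
      by (simp add: monomial_partial_Suc mult_ac del: of_nat_Suc)
  qed
  fix x assume x: "\<And>i. \<bar>x $ i - a $ i\<bar> < s / 2"
  define S where "S = box (\<chi> i. a $ i - s / 2) (\<chi> i. a $ i + s / 2)"
  have mem_S: "y \<in> S \<longleftrightarrow> (\<forall>i. \<bar>y $ i - a $ i\<bar> < s / 2)" for y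
    unfolding S_def mem_box_cart vec_lambda_beta by (intro iff_allI) arith
  have le_S: "\<bar>y $ i - a $ i\<bar> \<le> s / 2" if "y \<in> S" for y i
    using that less_imp_le by (auto simp: mem_S)
  \<comment> \<open>Series are differentiated along a sequence of terms, so the countable set of
    multi-indices is enumerated; absolute summability makes the order immaterial.\<close>
  define N where "N = from_nat_into (UNIV :: ('a \<Rightarrow> nat) set)"
  have "infinite (UNIV :: ('a \<Rightarrow> nat) set)"
    using finite_fun_UNIVD2 infinite_UNIV_nat by blast
  then have N: "bij_betw N UNIV UNIV"
    unfolding N_def by (intro bij_betw_from_nat_into) auto
  have sums_N: "(\<lambda>k. F (N k)) sums l" if "(F has_sum l) UNIV" for l and F :: "_ \<Rightarrow> complex"
    using that has_sum_reindex_bij_betw[OF N, of F l] has_sum_imp_sums by blast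
  have "(\<lambda>k. M (N k)) summable_on UNIV"
    using M_sum summable_on_reindex_bij_betw[OF N, of M] by blast
  then have summable_M: "summable (\<lambda>k. M (N k))"
    by (rule summable_on_imp_summable)
  have unif: "uniform_limit S (\<lambda>n y. \<Sum>k<n. b (N k) * of_real (monomial_partial a i (N k) y)) (G i)
      sequentially" for i
  proof -
    have "uniform_limit S (\<lambda>n y. \<Sum>k<n. b (N k) * of_real (monomial_partial a i (N k) y))
        (\<lambda>y. \<Sum>k. b (N k) * of_real (monomial_partial a i (N k) y)) sequentially"
      by (rule Weierstrass_m_test[OF _ summable_M]) (rule order_trans[OF bound_i[OF le_S] le_M])
    moreover have "(\<Sum>k. b (N k) * of_real (monomial_partial a i (N k) y)) = G i y" if "y \<in> S" for y
      using sums_unique[OF sums_N[OF G_sum[OF le_S[OF that]]]] by simp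
    ultimately show ?thesis by (simp cong: uniform_limit_cong')
  qed
  have "\<exists>g. \<forall>y\<in>S. (\<lambda>k. b (N k) * of_real (monomial a (N k) y)) sums g y \<and>
      (g has_derivative (\<lambda>h. \<Sum>i\<in>UNIV. of_real (h $ i) * G i y)) (at y within S)"
  proof (rule has_derivative_series)
    show "convex S" by (simp add: S_def)
    show "((\<lambda>y. b (N k) * of_real (monomial a (N k) y)) has_derivative
        (\<lambda>h. b (N k) * of_real (\<Sum>i\<in>UNIV. h $ i * monomial_partial a i (N k) y))) (at y within S)" for k y
      by (intro has_derivative_mult_right has_derivative_of_real monomial_has_derivative)
    show "a \<in> S" using s by (simp add: mem_S)
    show "(\<lambda>k. b (N k) * of_real (monomial a (N k) a)) sums f a"
      using f s by (intro sums_N) (simp add: box_series_def)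
    fix e :: real assume e: "e > 0"
    \<comment> \<open>Each coordinate contributes an error of at most \<open>norm h * e'\<close>,
      and the errors of all coordinates add up.\<close>
    define e' where "e' = e / CARD('a)"
    have e': "e' > 0" using e by (simp add: e'_def)
    have "\<forall>\<^sub>F n in sequentially. \<forall>y\<in>S. dist (\<Sum>k<n. b (N k) * of_real (monomial_partial a i (N k) y)) (G i y) < e'" for i
      using uniform_limitD[OF unif e'] .
    then have "\<forall>\<^sub>F n in sequentially. \<forall>i\<in>UNIV. \<forall>y\<in>S.
        dist (\<Sum>k<n. b (N k) * of_real (monomial_partial a i (N k) y)) (G i y) < e'"
      by (subst eventually_ball_finite_distrib) auto
    then show "\<forall>\<^sub>F n in sequentially. \<forall>y\<in>S. \<forall>h.
        norm ((\<Sum>k<n. b (N k) * of_real (\<Sum>i\<in>UNIV. h $ i * monomial_partial a i (N k) y)) -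
          (\<Sum>i\<in>UNIV. of_real (h $ i) * G i y)) \<le> e * norm h"
    proof (rule eventually_mono, intro ballI allI)
      fix n y and h :: "real ^ 'a"
      assume n: "\<forall>i\<in>UNIV. \<forall>y\<in>S. dist (\<Sum>k<n. b (N k) * of_real (monomial_partial a i (N k) y)) (G i y) < e'"
        and y: "y \<in> S"
      have "(\<Sum>k<n. b (N k) * of_real (\<Sum>i\<in>UNIV. h $ i * monomial_partial a i (N k) y)) =
          (\<Sum>i\<in>UNIV. of_real (h $ i) * (\<Sum>k<n. b (N k) * of_real (monomial_partial a i (N k) y)))"
        unfolding of_real_sum of_real_mult sum_distrib_left
        by (subst sum.swap) (simp add: mult_ac)
      then have "norm ((\<Sum>k<n. b (N k) * of_real (\<Sum>i\<in>UNIV. h $ i * monomial_partial a i (N k) y)) -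
          (\<Sum>i\<in>UNIV. of_real (h $ i) * G i y)) =
          norm (\<Sum>i\<in>UNIV. of_real (h $ i) * ((\<Sum>k<n. b (N k) * of_real (monomial_partial a i (N k) y)) - G i y))"
        by (simp add: right_diff_distrib sum_subtractf)
      also have "\<dots> \<le> (\<Sum>i\<in>(UNIV :: 'a set). norm h * e')"
      proof (rule sum_norm_le)
        fix i :: 'a
        show "norm (of_real (h $ i) * ((\<Sum>k<n. b (N k) * of_real (monomial_partial a i (N k) y)) - G i y))
            \<le> norm h * e'"
          unfolding norm_mult norm_of_real
          by (intro mult_mono component_le_norm_cart) (use n y in \<open>auto simp: dist_norm less_imp_le\<close>)
      qed
      finally show "norm ((\<Sum>k<n. b (N k) * of_real (\<Sum>i\<in>UNIV. h $ i * monomial_partial a i (N k) y)) -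
          (\<Sum>i\<in>UNIV. of_real (h $ i) * G i y)) \<le> e * norm h"
        by (simp add: e'_def mult.commute)
    qed
  qed
  then obtain g where g: "\<And>y. y \<in> S \<Longrightarrow> (\<lambda>k. b (N k) * of_real (monomial a (N k) y)) sums g y"
      and g': "\<And>y. y \<in> S \<Longrightarrow>
        (g has_derivative (\<lambda>h. \<Sum>i\<in>UNIV. of_real (h $ i) * G i y)) (at y within S)"
    by blast
  have x_S: "x \<in> S" using x by (simp add: mem_S)
  have fg: "f y = g y" if "y \<in> S" for y
  proof -
    have "\<bar>y $ i - a $ i\<bar> \<le> s" for i using le_S[OF that, of i] s by linarith
    then have "(\<lambda>k. b (N k) * of_real (monomial a (N k) y)) sums f y"
      using f by (intro sums_N) (simp add: box_series_def)
    then show ?thesis using g[OF that] sums_unique2 by blast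
  qed
  have "(f has_derivative (\<lambda>h. \<Sum>i\<in>UNIV. of_real (h $ i) * G i x)) (at x within S)"
    by (rule has_derivative_transform[OF x_S fg g'[OF x_S]])
  moreover have "open S" by (simp add: S_def open_box)
  ultimately show "(f has_derivative (\<lambda>h. \<Sum>i\<in>UNIV. of_real (h $ i) * G i x)) (at x)"
    using at_within_open[OF x_S] by simp
qed

lemma locally_series_partial:
  assumes "locally_series f"
  shows "f differentiable (at x)"
    and "locally_series (\<lambda>x. frechet_derivative f (at x) (axis i 1))"
proof -
  have *: "f differentiable (at a) \<and> 
     (\<exists>s>0. \<exists>b. box_series a s b (\<lambda>x. frechet_derivative f (at x) (axis i 1)))" for a
  proof -
    obtain s b where s: "s > 0" and f: "box_series a s b f"
      using assms unfolding locally_series_def by blast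
    define G where "G = (\<lambda>i x. \<Sum>\<^sub>\<infinity>\<alpha>. b \<alpha> * of_real (monomial_partial a i \<alpha> x))"
    note G = box_series_partial[OF f s, folded G_def]
    \<comment> \<open>The derivative formula holds on the open box of half-width
      \<open>s / 2\<close>, whereas \<open>box_series\<close> requires a closed box; hence
      \<open>s / 4\<close>.\<close>
    have "frechet_derivative f (at x) (axis i 1) = G i x" if "\<And>i. \<bar>x $ i - a $ i\<bar> \<le> s / 4" for x
    proof -
      have "\<bar>x $ i - a $ i\<bar> < s / 2" for i using that[of i] s by linarith
      from fun_cong[OF frechet_derivative_at[OF G(2)[OF this]], of "axis i 1"]
      have "frechet_derivative f (at x) (axis i 1) = (\<Sum>j\<in>UNIV. of_real (axis i 1 $ j) * G j x)"
        unfolding G_def by (rule sym)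
      also have "\<dots> = (\<Sum>j\<in>UNIV. if j = i then G j x else 0)"
        by (intro sum.cong) (auto simp: axis_def)
      finally show ?thesis by simp
    qed
    then have "box_series a (s / 4) (\<lambda>\<beta>. of_nat (Suc (\<beta> i)) * b (\<beta>(i := Suc (\<beta> i))))
        (\<lambda>x. frechet_derivative f (at x) (axis i 1))"
      by (intro box_series_shrink[OF G(1)[of i]]) (use s in \<open>auto simp: G_def\<close>)
    moreover have "f differentiable (at a)"
      using G(2)[of a] s unfolding differentiable_def by auto
    ultimately show ?thesis using s by (intro conjI exI[of _ "s / 4"]) auto
  qed
  show "f differentiable (at x)" using * by blast
  show "locally_series (\<lambda>x. frechet_derivative f (at x) (axis i 1))"
    unfolding locally_series_def using * by blast
qed

section \<open>Repeated differentiability\<close>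

text \<open>Iterating partial derivatives keeps every stage a complex-valued function on the same
  space, so the recursion stays within one type. Complex values fit the coefficients of the
  characteristic polynomial.\<close>

fun times_differentiable_on :: "nat \<Rightarrow> (real ^ 'd) set \<Rightarrow> (real ^ 'd \<Rightarrow> complex) \<Rightarrow> bool" where
  "times_differentiable_on 0 S f = True"
| "times_differentiable_on (Suc k) S f =
     ((\<forall>x\<in>S. f differentiable (at x)) \<and>
      (\<forall>i. times_differentiable_on k S (\<lambda>x. frechet_derivative f (at x) (axis i 1))))"

lemma locally_series_times_differentiable:
  "locally_series f \<Longrightarrow> times_differentiable_on k S f"
  by (induction k arbitrary: f) (auto intro: locally_series_partial)

lemma times_differentiable_on_cong:
  assumes "open S" "\<And>x. x \<in> S \<Longrightarrow> f x = g x" "times_differentiable_on k S f"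
  shows "times_differentiable_on k S g"
  using assms(2,3)
proof (induction k arbitrary: f g)
  case (Suc k)
  have *: "(g has_derivative frechet_derivative f (at x)) (at x)" if "x \<in> S" for x
    using Suc.prems that assms(1)
    by (auto intro!: has_derivative_transform_within_open[of f _ x UNIV S g]
        simp: frechet_derivative_works)
  then have "frechet_derivative g (at x) = frechet_derivative f (at x)" if "x \<in> S" for x
    using that frechet_derivative_at by metis
  then show ?case
    using Suc.prems * Suc.IH[of "\<lambda>x. frechet_derivative f (at x) (axis i 1)"
        "\<lambda>x. frechet_derivative g (at x) (axis i 1)" for i]
    by (auto simp: differentiable_def)
qed simp

text \<open>The closure properties below are obtained through this rule: it asks for a derivative
  formula on \<open>S\<close> only, whose partial derivatives are then handled by the induction
  hypothesis.\<close>

lemma times_differentiable_on_SucI: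
  assumes "open S" "\<And>x. x \<in> S \<Longrightarrow> (f has_derivative f' x) (at x)"
    and "\<And>i. times_differentiable_on k S (\<lambda>x. f' x (axis i 1))"
  shows "times_differentiable_on (Suc k) S f"
proof -
  have "frechet_derivative f (at x) = f' x" if "x \<in> S" for x
    using frechet_derivative_at[OF assms(2)[OF that]] by simp
  then have "times_differentiable_on k S (\<lambda>x. frechet_derivative f (at x) (axis i 1))" for i
    by (intro times_differentiable_on_cong[OF assms(1) _ assms(3)[of i]]) simp
  then show ?thesis using assms(2) by (auto simp: differentiable_def)
qed

lemma times_differentiable_on_Suc_has_derivative:
  assumes "times_differentiable_on (Suc k) S f" "x \<in> S"
  shows "(f has_derivative frechet_derivative f (at x)) (at x)"
  using assms by (simp add: frechet_derivative_works)

lemma times_differentiable_on_lower: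
  "times_differentiable_on (Suc k) S f \<Longrightarrow> times_differentiable_on k S f"
  by (induction k arbitrary: f) auto

lemma times_differentiable_on_const:
  assumes "open S" shows "times_differentiable_on k S (\<lambda>x. c)"
proof (induction k arbitrary: c)
  case (Suc k)
  show ?case
    by (rule times_differentiable_on_SucI[OF assms, where f' = "\<lambda>_ _. 0"]) (auto intro: Suc)
qed simp

lemma times_differentiable_on_add:
  assumes "open S" "times_differentiable_on k S f" "times_differentiable_on k S g"
  shows "times_differentiable_on k S (\<lambda>x. f x + g x)"
  using assms(2,3)
proof (induction k arbitrary: f g)
  case (Suc k)
  show ?case
  proof (rule times_differentiable_on_SucI[OF assms(1)])
    show "((\<lambda>x. f x + g x) has_derivative
        (\<lambda>h. frechet_derivative f (at x) h + frechet_derivative g (at x) h)) (at x)" if "x \<in> S" for x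
      using Suc.prems that by (intro has_derivative_add times_differentiable_on_Suc_has_derivative)
  qed (use Suc in auto)
qed simp

lemma times_differentiable_on_mult:
  assumes "open S" "times_differentiable_on k S f" "times_differentiable_on k S g"
  shows "times_differentiable_on k S (\<lambda>x. f x * g x)"
  using assms(2,3)
proof (induction k arbitrary: f g)
  case (Suc k)
  show ?case
  proof (rule times_differentiable_on_SucI[OF assms(1)])
    show "((\<lambda>x. f x * g x) has_derivative
        (\<lambda>h. f x * frechet_derivative g (at x) h + frechet_derivative f (at x) h * g x)) (at x)"
      if "x \<in> S" for x
      using Suc.prems that by (intro has_derivative_mult times_differentiable_on_Suc_has_derivative)
    show "times_differentiable_on k S (\<lambda>x. f x * frechet_derivative g (at x) (axis i 1) +
        frechet_derivative f (at x) (axis i 1) * g x)" for i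
      using Suc.prems
      by (intro times_differentiable_on_add[OF assms(1)] Suc.IH) (auto intro: times_differentiable_on_lower)
  qed
qed simp

lemma times_differentiable_on_sum:
  assumes "open S" "\<And>j. j \<in> J \<Longrightarrow> times_differentiable_on k S (f j)"
  shows "times_differentiable_on k S (\<lambda>x. \<Sum>j\<in>J. f j x)"
  using assms(2)
  by (induction J rule: infinite_finite_induct)
    (auto intro: times_differentiable_on_add times_differentiable_on_const assms(1))

lemma times_differentiable_on_power:
  assumes "open S" "times_differentiable_on k S f"
  shows "times_differentiable_on k S (\<lambda>x. f x ^ m)"
  by (induction m)
    (auto intro: times_differentiable_on_mult times_differentiable_on_const assms)

text \<open>The derivative of \<open>1 / f\<close> is built from \<open>1 / f\<close> itself and the
  derivative of \<open>f\<close>, so the regularity of \<open>1 / f\<close> climbs one order at a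
  time.\<close>

lemma times_differentiable_on_inverse:
  assumes "open S" "\<And>x. x \<in> S \<Longrightarrow> f x \<noteq> 0" "times_differentiable_on k S f"
  shows "times_differentiable_on k S (\<lambda>x. inverse (f x))"
  using assms(3)
proof (induction k)
  case (Suc k)
  show ?case
  proof (rule times_differentiable_on_SucI[OF assms(1)])
    show "((\<lambda>x. inverse (f x)) has_derivative
        (\<lambda>h. (- 1) * (inverse (f x) * frechet_derivative f (at x) h * inverse (f x)))) (at x)"
      if "x \<in> S" for x
      using Deriv.has_derivative_inverse[OF assms(2)[OF that]
          times_differentiable_on_Suc_has_derivative[OF Suc.prems that]] by simp
    have IH: "times_differentiable_on k S (\<lambda>x. inverse (f x))"
      using Suc.IH times_differentiable_on_lower[OF Suc.prems] .
    show "times_differentiable_on k S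
        (\<lambda>x. (- 1) * (inverse (f x) * frechet_derivative f (at x) (axis i 1) * inverse (f x)))" for i
      using Suc.prems
      by (intro times_differentiable_on_mult[OF assms(1)] times_differentiable_on_const[OF assms(1)] IH) auto
  qed
qed simp

section \<open>Coefficients of the characteristic polynomial and a one-sided product rule\<close>

lemma coeff_prod_times_differentiable:
  fixes p :: "'i \<Rightarrow> real ^ 'd \<Rightarrow> complex poly"
  assumes "open S" "\<And>j m. j \<in> J \<Longrightarrow> times_differentiable_on k S (\<lambda>x. coeff (p j x) m)"
  shows "times_differentiable_on k S (\<lambda>x. coeff (\<Prod>j\<in>J. p j x) m)"
  using assms(2)
proof (induction J arbitrary: m rule: infinite_finite_induct)
  case (insert j J)
  then show ?case
    by (auto simp: coeff_mult intro!: times_differentiable_on_sum times_differentiable_on_mult assms(1))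
qed (auto intro: times_differentiable_on_const assms(1))

text \<open>By the Leibniz formula, the coefficients are polynomials in the matrix entries.\<close>

lemma char_poly_coeff_times_differentiable:
  assumes A: "\<And>x. A x \<in> carrier_mat n n" and S: "open S"
    and diff: "\<And>i j. i < n \<Longrightarrow> j < n \<Longrightarrow> times_differentiable_on k S (\<lambda>x. A x $$ (i, j))"
  shows "times_differentiable_on k S (\<lambda>x. coeff (char_poly (A x)) m)"
proof -
  have "coeff (char_poly (A x)) m = (\<Sum>q | q permutes {0..<n}. complex_of_int (sign q) *
      coeff (\<Prod>i = 0..<n. char_poly_matrix (A x) $$ (i, q i)) m)" for x
    unfolding char_poly_def
    by (subst det_def'[OF char_poly_matrix_closed[OF A]])
      (auto simp: coeff_sum of_int_poly intro!: sum.cong)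
  moreover have "times_differentiable_on k S (\<lambda>x. coeff (char_poly_matrix (A x) $$ (i, j)) l)"
    if "i < n" "j < n" for i j l
  proof -
    have "coeff (char_poly_matrix (A x) $$ (i, j)) l =
        (if i = j \<and> l = 1 then 1 else 0) + (if l = 0 then - 1 else 0) * A x $$ (i, j)" for x
      using A[of x] that unfolding char_poly_matrix_def
      by (auto simp: coeff_pCons split: nat.split)
    then show ?thesis
      by (simp only:) (intro times_differentiable_on_add times_differentiable_on_mult
          times_differentiable_on_const S diff that)
  qed
  ultimately show ?thesis
    by (auto intro!: times_differentiable_on_sum times_differentiable_on_mult S
        times_differentiable_on_const coeff_prod_times_differentiable dest: permutes_in_image)
qed

text \<open>Where one factor vanishes, mere continuity of the other is enough for the product rule.
  This allows the second factor to contain the smallest eigenvalue before its differentiability is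
  known.\<close>

lemma has_derivative_vanishing_mult:
  fixes u v :: "'a::real_normed_vector \<Rightarrow> 'b::real_normed_algebra"
  assumes u: "(u has_derivative u') (at x)" "u x = 0" and v: "isCont v x"
  shows "((\<lambda>y. u y * v y) has_derivative (\<lambda>h. u' h * v x)) (at x)"
proof -
  obtain K where K: "\<And>h. norm (u' h) \<le> norm h * K"
    using has_derivative_bounded_linear[OF u(1)] bounded_linear.bounded by blast
  have lin: "bounded_linear (\<lambda>h. u' h * v x)"
    using has_derivative_bounded_linear[OF u(1)] bounded_linear_compose bounded_linear_mult_left by blast
  have rem: "((\<lambda>y. norm (u y - u' (y - x)) / norm (y - x)) \<longlongrightarrow> 0) (at x)"
    using u by (simp add: has_derivative_iff_norm)
  have cont: "(v \<longlongrightarrow> v x) (at x)" using v by (simp add: isCont_def)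
  have "((\<lambda>y. norm (u y - u' (y - x)) / norm (y - x) * norm (v y) + K * norm (v y - v x))
      \<longlongrightarrow> 0 * norm (v x) + K * norm (v x - v x)) (at x)"
    by (intro tendsto_intros rem cont)
  then have lim: "((\<lambda>y. norm (u y - u' (y - x)) / norm (y - x) * norm (v y) + K * norm (v y - v x))
      \<longlongrightarrow> 0) (at x)" by simp
  have "((\<lambda>y. norm (u y * v y - u x * v x - u' (y - x) * v x) / norm (y - x)) \<longlongrightarrow> 0) (at x)"
  proof (rule Lim_null_comparison[OF _ lim], rule eventually_mono[OF eventually_neq_at_within[of x]])
    fix y assume y: "y \<noteq> x"
    have "u y * v y - u x * v x - u' (y - x) * v x = (u y - u' (y - x)) * v y + u' (y - x) * (v y - v x)"
      by (simp add: u(2) algebra_simps)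
    also have "norm \<dots> \<le> norm (u y - u' (y - x)) * norm (v y) + norm (y - x) * K * norm (v y - v x)"
      by (intro order_trans[OF norm_triangle_ineq] add_mono order_trans[OF norm_mult_ineq] mult_right_mono K)
        auto
    finally show "norm (norm (u y * v y - u x * v x - u' (y - x) * v x) / norm (y - x)) \<le>
        norm (u y - u' (y - x)) / norm (y - x) * norm (v y) + K * norm (v y - v x)"
      using y by (simp add: field_simps)
  qed
  then show ?thesis using lin by (simp add: has_derivative_iff_norm)
qed

section \<open>Regularity of a simple smallest eigenvalue\<close>

lemma isCont_imp_tendsto_nhds:
  "isCont f x \<Longrightarrow> (f \<longlongrightarrow> f x) (nhds x)"
  by (simp add: isCont_def tendsto_at_iff_tendsto_nhds)

lemma poly_eq_sum_atMost:
  fixes p :: "'a::comm_semiring_1 poly"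
  assumes "degree p \<le> n"
  shows "poly p x = (\<Sum>j\<le>n. coeff p j * x ^ j)"
  unfolding poly_altdef
  by (rule sum.mono_neutral_left) (use assms in \<open>auto simp: coeff_eq_0\<close>)

lemma order_eq_1_iff:
  fixes p :: "'a::field_char_0 poly"
  assumes "p \<noteq> 0"
  shows "Polynomial.order a p = 1 \<longleftrightarrow> poly p a = 0 \<and> poly (pderiv p) a \<noteq> 0"
proof (cases "poly p a = 0")
  case True
  have "pderiv p \<noteq> 0"
  proof
    assume "pderiv p = 0"
    then obtain c where "p = [:c:]" using pderiv_iszero by blast
    then show False using True assms by simp
  qed
  then show ?thesis
    using order_pderiv[OF assms True] True order_root[of "pderiv p" a] by auto
next
  case False
  then show ?thesis using order_root[of p a] by simp
qed

text \<open>For \<open>\<bar>t\<bar> > 1\<close>, the leading term can be balanced by the others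
  only if their coefficients are large. The bound depends continuously on the coefficients and so
  confines the roots of all nearby polynomials to one compact interval.\<close>

lemma monic_root_bound:
  fixes p :: "real poly"
  assumes "degree p = n" "coeff p n = 1" "poly p t = 0"
  shows "\<bar>t\<bar> \<le> 1 + (\<Sum>j<n. \<bar>coeff p j\<bar>)"
proof (cases "\<bar>t\<bar> \<le> 1")
  case True
  moreover have "0 \<le> (\<Sum>j<n. \<bar>coeff p j\<bar>)" by (simp add: sum_nonneg)
  ultimately show ?thesis by linarith
next
  case False
  have eq: "t ^ n = - (\<Sum>j<n. coeff p j * t ^ j)"
    using assms poly_eq_sum_atMost[of p n t] by (simp add: lessThan_Suc_atMost[symmetric])
  then obtain m where n: "n = Suc m" by (cases n) auto
  have "\<bar>t\<bar> ^ n \<le> (\<Sum>j<n. \<bar>coeff p j\<bar> * \<bar>t\<bar> ^ j)"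
    unfolding power_abs[symmetric] eq abs_minus_cancel
    by (rule order_trans[OF sum_abs]) (simp add: abs_mult power_abs)
  also have "\<dots> \<le> (\<Sum>j<n. \<bar>coeff p j\<bar> * \<bar>t\<bar> ^ m)"
    using False n by (intro sum_mono mult_left_mono power_increasing) auto
  finally have "\<bar>t\<bar> * \<bar>t\<bar> ^ m \<le> (\<Sum>j<n. \<bar>coeff p j\<bar>) * \<bar>t\<bar> ^ m"
    unfolding sum_distrib_right by (simp add: n)
  then have "\<bar>t\<bar> \<le> (\<Sum>j<n. \<bar>coeff p j\<bar>)"
    using False by (subst (asm) mult_le_cancel_right) (auto dest: power_less_zero_eq[THEN iffD1])
  then show ?thesis by simp
qed

text \<open>From above: a simple root is a sign change, which persists and yields a nearby root by
  the intermediate value theorem. From below: on the compact interval left of the root the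
  polynomial stays away from 0, and so do its small perturbations. The second conclusion matters
  because the minimum of an empty set is unspecified.\<close>

lemma min_root_continuous:
  fixes p :: "'a::t2_space \<Rightarrow> real poly"
  defines "\<mu> \<equiv> \<lambda>x. Min {t. poly (p x) t = 0}"
  assumes deg: "\<And>x. degree (p x) = n" and monic: "\<And>x. coeff (p x) n = 1"
    and cont: "\<And>j. isCont (\<lambda>x. coeff (p x) j) x0"
    and root: "poly (p x0) (\<mu> x0) = 0" and simple: "poly (pderiv (p x0)) (\<mu> x0) \<noteq> 0"
  shows "isCont \<mu> x0" and "\<forall>\<^sub>F x in nhds x0. poly (p x) (\<mu> x) = 0"
proof -
  define m where "m = \<mu> x0"
  have p_nz: "p x \<noteq> 0" for x using monic[of x] by auto
  have fin: "finite {t. poly (p x) t = 0}" for x using p_nz by (rule poly_roots_finite)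
  have below: "poly (p x0) t \<noteq> 0" if "t < m" for t
    using Min_le[OF fin, of t x0] that unfolding m_def \<mu>_def by force
  have coeff_lim: "((\<lambda>x. coeff (p x) j) \<longlongrightarrow> coeff (p x0) j) (nhds x0)" for j
    using isCont_imp_tendsto_nhds[OF cont] .
  have near: "\<forall>\<^sub>F x in nhds x0. poly (p x) (\<mu> x) = 0 \<and> \<bar>\<mu> x - m\<bar> < e" if e: "e > 0" for e
  proof -
    define f where "f = poly (p x0)"
    have f': "(f has_real_derivative poly (pderiv (p x0)) m) (at m)"
      unfolding f_def by (rule poly_DERIV)
    have fm: "f m = 0" using root by (simp add: f_def m_def)
    obtain d1 d2 where d: "d1 > 0" "d2 > 0"
      "(\<forall>h>0. h < d1 \<longrightarrow> f (m - h) < 0) \<and> (\<forall>h>0. h < d2 \<longrightarrow> f (m + h) > 0) \<or>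
       (\<forall>h>0. h < d1 \<longrightarrow> f (m - h) > 0) \<and> (\<forall>h>0. h < d2 \<longrightarrow> f (m + h) < 0)"
    proof (cases "poly (pderiv (p x0)) m > 0")
      case True
      then show ?thesis
        using DERIV_pos_inc_left[OF f'] DERIV_pos_inc_right[OF f'] fm that by metis
    next
      case False
      then have "poly (pderiv (p x0)) m < 0" using simple by (simp add: m_def)
      then show ?thesis
        using DERIV_neg_dec_left[OF f'] DERIV_neg_dec_right[OF f'] fm that by metis
    qed
    define h where "h = min e (min d1 d2) / 2"
    have h: "h > 0" "h < d1" "h < d2" "h < e" using d e by (auto simp: h_def)
    have "f (m - h) * f (m + h) < 0"
      using d(3) h by (auto intro: mult_neg_pos mult_pos_neg)
    moreover have "((\<lambda>x. poly (p x) t) \<longlongrightarrow> f t) (nhds x0)" for t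
      unfolding f_def poly_eq_sum_atMost[of "p _" n, OF eq_refl[OF deg]]
      by (intro tendsto_intros coeff_lim)
    then have "((\<lambda>x. poly (p x) (m - h) * poly (p x) (m + h)) \<longlongrightarrow> f (m - h) * f (m + h)) (nhds x0)"
      by (intro tendsto_mult)
    ultimately have ev1: "\<forall>\<^sub>F x in nhds x0. poly (p x) (m - h) * poly (p x) (m + h) < 0"
      by (simp add: order_tendsto_iff)
    \<comment> \<open>The slack over the root bound at \<open>x0\<close> makes \<open>R\<close> a
      root bound for all nearby \<open>x\<close>.\<close>
    define R where "R = 2 + (\<Sum>j<n. \<bar>coeff (p x0) j\<bar>) + \<bar>m\<bar>"
    have "((\<lambda>x. \<Sum>j<n. \<bar>coeff (p x) j\<bar>) \<longlongrightarrow> (\<Sum>j<n. \<bar>coeff (p x0) j\<bar>)) (nhds x0)"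
      by (intro tendsto_intros coeff_lim)
    then have ev2: "\<forall>\<^sub>F x in nhds x0. (\<Sum>j<n. \<bar>coeff (p x) j\<bar>) < R - 1"
      by (rule order_tendstoD) (simp add: R_def)
    have R: "R \<ge> 0" by (simp add: R_def sum_nonneg add_nonneg_nonneg)
    \<comment> \<open>\<open>c\<close> is the minimum of \<open>\<bar>f\<bar>\<close> on the
      interval, positive because \<open>f\<close> has no root below \<open>m\<close>; an empty
      interval admits any value, here 1.\<close>
    obtain c where c: "c > 0" "\<And>t. t \<in> {- R..m - e} \<Longrightarrow> c \<le> \<bar>f t\<bar>"
    proof (cases "{- R..m - e} = {}")
      case True
      then show ?thesis using that[of 1] by auto
    next
      case False
      have "continuous_on {- R..m - e} (\<lambda>t. \<bar>f t\<bar>)" unfolding f_def by (intro continuous_intros)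
      then obtain s where s: "s \<in> {- R..m - e}" "\<And>t. t \<in> {- R..m - e} \<Longrightarrow> \<bar>f s\<bar> \<le> \<bar>f t\<bar>"
        using continuous_attains_inf[OF compact_Icc False] by blast
      moreover have "f s \<noteq> 0" using below[of s] s(1) e by (auto simp: f_def)
      ultimately show ?thesis using that[of "\<bar>f s\<bar>"] by auto
    qed
    have "((\<lambda>x. \<Sum>j\<le>n. \<bar>coeff (p x) j - coeff (p x0) j\<bar> * R ^ j) \<longlongrightarrow>
        (\<Sum>j\<le>n. \<bar>coeff (p x0) j - coeff (p x0) j\<bar> * R ^ j)) (nhds x0)"
      by (intro tendsto_intros coeff_lim)
    then have ev3: "\<forall>\<^sub>F x in nhds x0. (\<Sum>j\<le>n. \<bar>coeff (p x) j - coeff (p x0) j\<bar> * R ^ j) < c"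
      by (rule order_tendstoD) (simp add: c)
    show ?thesis
      using ev1 ev2 ev3
    proof eventually_elim
      case (elim x)
      obtain t where t: "m - h < t" "t < m + h" "poly (p x) t = 0"
        using poly_IVT[OF _ elim(1)] h by auto
      have "\<mu> x \<in> {t. poly (p x) t = 0}"
        unfolding \<mu>_def by (rule Min_in[OF fin]) (use t in auto)
      then have root_x: "poly (p x) (\<mu> x) = 0" by simp
      have le: "\<mu> x \<le> t" unfolding \<mu>_def by (rule Min_le[OF fin]) (use t in auto)
      have abs_R: "\<bar>\<mu> x\<bar> \<le> R"
        using monic_root_bound[OF deg monic root_x] elim(2) by simp
      have "m - e < \<mu> x"
      proof (rule ccontr)
        assume "\<not> m - e < \<mu> x"
        then have "c \<le> \<bar>f (\<mu> x)\<bar>" using abs_R by (intro c(2)) auto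
        also have "\<dots> = \<bar>poly (p x) (\<mu> x) - f (\<mu> x)\<bar>" by (simp add: root_x)
        also have "\<dots> = \<bar>\<Sum>j\<le>n. (coeff (p x) j - coeff (p x0) j) * \<mu> x ^ j\<bar>"
          unfolding f_def poly_eq_sum_atMost[of "p _" n, OF eq_refl[OF deg]]
          by (simp add: sum_subtractf left_diff_distrib)
        also have "\<dots> \<le> (\<Sum>j\<le>n. \<bar>coeff (p x) j - coeff (p x0) j\<bar> * R ^ j)"
          by (rule order_trans[OF sum_abs], rule sum_mono)
            (auto simp: abs_mult power_abs intro!: mult_left_mono power_mono abs_R)
        finally show False using elim(3) by simp
      qed
      then show ?case using root_x le t h by auto
    qed
  qed
  show "\<forall>\<^sub>F x in nhds x0. poly (p x) (\<mu> x) = 0"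
    using near[of 1] by (auto elim: eventually_mono)
  have "(\<mu> \<longlongrightarrow> \<mu> x0) (nhds x0)"
    unfolding tendsto_iff dist_real_def m_def[symmetric]
    using near by (blast intro: eventually_mono)
  then show "isCont \<mu> x0" by (simp add: isCont_def tendsto_at_iff_tendsto_nhds)
qed

section \<open>Characteristic polynomials of Hermitian matrices\<close>

lemma cnj_comm_ring_hom: "comm_ring_hom cnj"
  by unfold_locales auto

text \<open>Conjugating a Hermitian matrix transposes it, and transposition preserves the
  characteristic polynomial, so conjugation fixes every coefficient.\<close>

lemma char_poly_hermitian_real:
  assumes A: "A \<in> carrier_mat n n" and herm: "mat_adjoint A = A"
  shows "char_poly A = map_poly of_real (map_poly Re (char_poly A))"
proof -
  have "map_mat cnj A = transpose_mat A"
  proof (rule eq_matI)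
    fix i j assume "i < dim_row (transpose_mat A)" "j < dim_col (transpose_mat A)"
    then have ij: "i < n" "j < n" using A by auto
    have "A $$ (j, i) = mat_adjoint A $$ (j, i)" by (simp add: herm)
    also have "\<dots> = cnj (A $$ (i, j))"
      using A ij by (simp add: mat_adjoint_def mat_of_rows_def)
    finally show "map_mat cnj A $$ (i, j) = transpose_mat A $$ (i, j)" using A ij by simp
  qed (use A in auto)
  then have "map_poly cnj (char_poly A) = char_poly A"
    using comm_ring_hom.char_poly_hom[OF cnj_comm_ring_hom A] A by simp
  then have "cnj (coeff (char_poly A) j) = coeff (char_poly A) j" for j
    by (metis coeff_map_poly complex_cnj_zero)
  then have "of_real (Re (coeff (char_poly A) j)) = coeff (char_poly A) j" for j
    by (metis Reals_cnj_iff of_real_Re)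
  then show ?thesis by (intro poly_eqI) (simp add: coeff_map_poly)
qed

lemma lambda_min_char_poly:
  assumes A: "A \<in> carrier_mat n n" and herm: "mat_adjoint A = A"
  defines "p \<equiv> map_poly Re (char_poly A)"
  shows "lambda_min A = Min {t. poly p t = 0}"
    and "simple_lambda_min A \<longleftrightarrow> poly p (lambda_min A) = 0 \<and> poly (pderiv p) (lambda_min A) \<noteq> 0"
    and "degree p = n" "coeff p n = 1"
proof -
  have eq: "char_poly A = map_poly of_real p"
    using char_poly_hermitian_real[OF A herm] by (simp add: p_def)
  have "degree (char_poly A) = n" "coeff (char_poly A) n = 1"
    using degree_monic_char_poly[OF A] by auto
  then show deg: "degree p = n" and monic: "coeff p n = 1"
    unfolding eq by (auto simp: coeff_map_poly)
  have "{\<mu>. eigenvalue A (complex_of_real \<mu>)} = {t. poly p t = 0}"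
    unfolding eigenvalue_root_char_poly[OF A] unfolding eq
    by simp
  then show "lambda_min A = Min {t. poly p t = 0}" unfolding lambda_min_def by simp
  have "char_poly A \<noteq> 0" using degree_monic_char_poly[OF A] by force
  then show "simple_lambda_min A \<longleftrightarrow> poly p (lambda_min A) = 0 \<and> poly (pderiv p) (lambda_min A) \<noteq> 0"
    unfolding simple_lambda_min_def using order_eq_1_iff[of "char_poly A"]
    unfolding eq of_real_hom.map_poly_pderiv[symmetric] by simp
qed

text \<open>\<open>U\<close> is open because both conditions for a simple smallest root, that the
  polynomial vanishes there and that its derivative does not, persist under small changes once
  \<open>lam\<close> is known to be continuous.\<close>

lemma
  fixes A :: "real ^ 'd \<Rightarrow> complex mat"
  assumes analytic: "real_analytic_mat n A" and herm: "\<And>x. mat_adjoint (A x) = A x"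
  defines "lam \<equiv> \<lambda>x. lambda_min (A x)" and "U \<equiv> {x. simple_lambda_min (A x)}"
  shows open_simple: "open U"
    and lambda_min_times_differentiable: "times_differentiable_on k U (\<lambda>x. complex_of_real (lam x))"
proof -
  have A: "A x \<in> carrier_mat n n" for x using analytic by (simp add: real_analytic_mat_def)
  define c where "c = (\<lambda>j x. coeff (char_poly (A x)) j)"
  have c_diff: "times_differentiable_on k S (c j)" if "open S" for k j S
    unfolding c_def using analytic
    by (intro char_poly_coeff_times_differentiable[OF A that] locally_series_times_differentiable
        real_analytic_imp_locally_series) (auto simp: real_analytic_mat_def)
  have c_deriv: "(c j has_derivative frechet_derivative (c j) (at x)) (at x)" for j x
    by (rule times_differentiable_on_Suc_has_derivative[OF c_diff[OF open_UNIV, of "Suc 0"]]) simp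
  have c_cont: "isCont (c j) x" for j x using c_deriv has_derivative_continuous by blast
  define p where "p = (\<lambda>x. map_poly Re (char_poly (A x)))"
  have p_coeff: "coeff (p x) j = Re (c j x)" for x j by (simp add: p_def c_def coeff_map_poly)
  have p_cont: "isCont (\<lambda>x. coeff (p x) j) x" for x j
    unfolding p_coeff using c_cont by (auto simp: isCont_def intro: tendsto_Re)
  have p_fold: "map_poly Re (char_poly (A x)) = p x" for x by (simp add: p_def)
  note lam_p = lambda_min_char_poly[OF A herm, unfolded p_fold]
  have lam_Min: "lam = (\<lambda>x. Min {t. poly (p x) t = 0})" by (simp add: lam_def lam_p(1))
  have deg_pderiv: "degree (pderiv (p x)) \<le> n" for x using degree_pderiv_le[of "p x"] lam_p(3)[of x] by simp
  have U_root: "poly (p x) (lam x) = 0" and U_pderiv: "poly (pderiv (p x)) (lam x) \<noteq> 0" if "x \<in> U" for x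
    using that lam_p(2)[of x] by (auto simp: U_def lam_def)
  have lam_cont: "isCont lam x" and ev_root: "\<forall>\<^sub>F y in nhds x. poly (p y) (lam y) = 0" if "x \<in> U" for x
    unfolding lam_Min
    by (rule min_root_continuous[OF lam_p(3,4) p_cont];
        use U_root[OF that] U_pderiv[OF that] in \<open>simp add: lam_Min\<close>)+
  show openU: "open U"
  proof (rule Topological_Spaces.openI)
    fix x assume x: "x \<in> U"
    have "isCont (\<lambda>y. poly (pderiv (p y)) (lam y)) x"
      unfolding poly_eq_sum_atMost[OF deg_pderiv] coeff_pderiv
      by (intro continuous_intros p_cont lam_cont x)
    then have "\<forall>\<^sub>F y in nhds x. poly (pderiv (p y)) (lam y) \<noteq> 0"
      using tendsto_imp_eventually_ne[OF isCont_imp_tendsto_nhds] U_pderiv[OF x] by blast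
    with ev_root[OF x] have "\<forall>\<^sub>F y in nhds x. y \<in> U"
      by eventually_elim (use lam_p(2) in \<open>auto simp: U_def lam_def\<close>)
    then show "\<exists>T. open T \<and> x \<in> T \<and> T \<subseteq> U" unfolding eventually_nhds by blast
  qed
  define L where "L = (\<lambda>x. complex_of_real (lam x))"
  \<comment> \<open>This is the derivative of the characteristic polynomial at \<open>lam x\<close>,
    written through \<open>c\<close> and \<open>L\<close> so that the closure properties apply to
    it.\<close>
  define E where "E = (\<lambda>x. \<Sum>j\<le>n. of_nat (Suc j) * c (Suc j) x * L x ^ j)"
  have char_p: "char_poly (A x) = map_poly of_real (p x)" for x
    unfolding p_def by (rule char_poly_hermitian_real[OF A herm])
  have c_p: "c j x = of_real (coeff (p x) j)" for j x
    by (simp add: c_def char_p coeff_map_poly)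
  have E: "E x = of_real (poly (pderiv (p x)) (lam x))" for x
    unfolding E_def poly_eq_sum_atMost[OF deg_pderiv] L_def c_p coeff_pderiv by simp
  have E_nz: "E x \<noteq> 0" if "x \<in> U" for x using U_pderiv[OF that] by (simp add: E)
  have L_deriv: "(L has_derivative
      (\<lambda>h. \<Sum>j\<le>n. frechet_derivative (c j) (at x) h * (- (L x ^ j) * inverse (E x)))) (at x)"
    if x: "x \<in> U" for x
  proof -
    \<comment> \<open>Dividing \<open>p y (lam y) = 0\<close> by \<open>q (lam y)\<close> expresses \<open>lam y - lam x\<close> exactly through the
      coefficient differences \<open>c j y - c j x\<close>, so no implicit function theorem is needed.\<close>
    obtain q where q: "p x = [:- lam x, 1:] * q"
      using U_root[OF x] unfolding poly_eq_0_iff_dvd by blast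
    have q_E: "of_real (poly q (lam x)) = E x"
      unfolding E q pderiv_mult by (simp add: pderiv_pCons)
    have qcont: "isCont (\<lambda>y. poly q (lam y)) x"
      by (intro isCont_o2[OF lam_cont[OF x]] poly_isCont)
    have "((\<lambda>y. \<Sum>j\<le>n. (c j y - c j x) * (- (L y ^ j) * inverse (of_real (poly q (lam y))))) has_derivative
        (\<lambda>h. \<Sum>j\<le>n. frechet_derivative (c j) (at x) h * (- (L x ^ j) * inverse (of_real (poly q (lam x)))))) (at x)"
    proof (intro has_derivative_sum has_derivative_vanishing_mult)
      show "((\<lambda>y. c j y - c j x) has_derivative frechet_derivative (c j) (at x)) (at x)" for j
        using has_derivative_diff[OF c_deriv has_derivative_const] by simp
      show "isCont (\<lambda>y. - (L y ^ j) * inverse (of_real (poly q (lam y)))) x" for j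
        unfolding L_def using E_nz[OF x] q_E
        by (intro continuous_intros lam_cont x qcont) auto
    qed simp
    then have 1: "((\<lambda>y. L x + (\<Sum>j\<le>n. (c j y - c j x) * (- (L y ^ j) * inverse (of_real (poly q (lam y)))))) has_derivative
        (\<lambda>h. \<Sum>j\<le>n. frechet_derivative (c j) (at x) h * (- (L x ^ j) * inverse (E x)))) (at x)"
      unfolding q_E using has_derivative_add[OF has_derivative_const] by force
    have "\<forall>\<^sub>F y in nhds x. poly q (lam y) \<noteq> 0"
      by (rule tendsto_imp_eventually_ne[OF isCont_imp_tendsto_nhds[OF qcont]]) (use E_nz[OF x] q_E in auto)
    moreover have "\<forall>\<^sub>F y in nhds x. y \<in> U" using openU x by (rule eventually_nhds_in_open)
    ultimately have "\<forall>\<^sub>F y in nhds x. L x +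
        (\<Sum>j\<le>n. (c j y - c j x) * (- (L y ^ j) * inverse (of_real (poly q (lam y))))) = L y"
    proof eventually_elim
      case (elim y)
      have "(\<Sum>j\<le>n. (c j y - c j x) * L y ^ j) = of_real (poly (p y) (lam y) - poly (p x) (lam y))"
        unfolding poly_eq_sum_atMost[OF eq_refl[OF lam_p(3)]] c_p L_def
        by (simp add: sum_subtractf left_diff_distrib)
      also have "\<dots> = - (L y - L x) * of_real (poly q (lam y))"
        unfolding U_root[OF elim(2)] q L_def by (simp add: algebra_simps)
      finally show ?case
        using elim(1) unfolding mult_minus_left mult_minus_right sum_negf
          mult.assoc[symmetric] sum_distrib_right[symmetric] by (simp add: field_simps)
    qed
    then show ?thesis
      by (intro has_derivative_transform_eventually[OF 1])
        (auto simp: eventually_at_filter dest: eventually_nhds_x_imp_x elim: eventually_mono)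
  qed
  \<comment> \<open>Bootstrapping: the formula for the derivative of \<open>L\<close> involves only
    \<open>L\<close>, \<open>1 / E\<close> and derivatives of the coefficients, so order
    \<open>k\<close> of \<open>L\<close> gives order \<open>k + 1\<close>.\<close>
  have "times_differentiable_on k U L" for k
  proof (induction k)
    case (Suc k)
    show ?case
    proof (rule times_differentiable_on_SucI[OF openU L_deriv])
      have "times_differentiable_on k U E"
        unfolding E_def
        by (intro times_differentiable_on_sum times_differentiable_on_mult times_differentiable_on_power
            times_differentiable_on_const c_diff openU Suc)
      then have inv: "times_differentiable_on k U (\<lambda>x. inverse (E x))"
        by (intro times_differentiable_on_inverse openU E_nz)
      have "times_differentiable_on k U (\<lambda>x. frechet_derivative (c j) (at x) (axis i 1))" for i j
        using c_diff[OF openU, of "Suc k" j] by simp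
      then have "times_differentiable_on k U (\<lambda>x. \<Sum>j\<le>n. frechet_derivative (c j) (at x) (axis i 1) *
          ((- 1) * L x ^ j * inverse (E x)))" for i
        by (intro times_differentiable_on_sum times_differentiable_on_mult times_differentiable_on_power
            times_differentiable_on_const openU Suc inv)
      then show "times_differentiable_on k U (\<lambda>x. \<Sum>j\<le>n. frechet_derivative (c j) (at x) (axis i 1) *
          (- (L x ^ j) * inverse (E x)))" for i
        by simp
    qed
  qed simp
  then show "times_differentiable_on k U (\<lambda>x. complex_of_real (lam x))" by (simp add: L_def)
qed

section \<open>Spectral theorem and dominance\<close>

text \<open>For small \<open>t\<close> the linear term dominates. This is the first-order condition
  used both for the Rayleigh quotient and for the kernel of a semidefinite form.\<close>

lemma linear_le_quadratic_imp_zero: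
  fixes p q :: real
  assumes "\<And>t. 2 * t * p \<le> t\<^sup>2 * q"
  shows "p = 0"
proof (rule ccontr)
  assume p: "p \<noteq> 0"
  define C where "C = \<bar>q\<bar> + 1"
  define t where "t = p / C"
  have C: "C > 0" by (simp add: C_def)
  have "0 < p * p" using p by (auto simp: zero_less_mult_iff linorder_neq_iff)
  then have tp: "0 < t * p" using C by (simp add: t_def)
  have "t\<^sup>2 * q \<le> t\<^sup>2 * C"
    by (intro mult_left_mono) (auto simp: C_def)
  also have "\<dots> = t * p" using C by (simp add: t_def power2_eq_square)
  also have "\<dots> < 2 * t * p"
    using tp by (simp add: mult.commute)
  finally show False using assms[of t] by simp
qed

text \<open>A maximizer of the Rayleigh quotient on the unit sphere of \<open>W\<close> is an
  eigenvector: perturbing it along its own residual \<open>g\<close> gains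
  \<open>2 * t * (g \<bullet> g)\<close> to first order, so \<open>g = 0\<close>.\<close>

lemma maximal_eigenvector_exists:
  fixes f :: "'a::euclidean_space \<Rightarrow> 'a"
  assumes W: "subspace W" "W \<noteq> {0}" and f: "linear f" "\<And>x. x \<in> W \<Longrightarrow> f x \<in> W"
    and sym: "\<And>x y. x \<in> W \<Longrightarrow> y \<in> W \<Longrightarrow> f x \<bullet> y = x \<bullet> f y"
  obtains v \<mu> where "v \<in> W" "norm v = 1" "f v = \<mu> *\<^sub>R v"
    "\<And>x. x \<in> W \<Longrightarrow> x \<bullet> f x \<le> \<mu> * (norm x)\<^sup>2"
proof -
  interpret linear f by fact
  define K where "K = W \<inter> sphere 0 1"
  have compact: "compact K"
    unfolding K_def by (intro closed_Int_compact closed_subspace W compact_sphere)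
  obtain w where w: "w \<in> W" "w \<noteq> 0" using W subspace_0 by blast
  then have "w /\<^sub>R norm w \<in> K" using W by (simp add: K_def subspace_scale)
  then have "K \<noteq> {}" by blast
  moreover have "continuous_on K (\<lambda>x. x \<bullet> f x)"
    by (intro continuous_intros linear_continuous_on linear_conv_bounded_linear[THEN iffD1] f)
  ultimately obtain v where v: "v \<in> K" "\<And>x. x \<in> K \<Longrightarrow> x \<bullet> f x \<le> v \<bullet> f v"
    using continuous_attains_sup[OF compact] by blast
  define \<mu> where "\<mu> = v \<bullet> f v"
  have vW: "v \<in> W" and norm_v: "norm v = 1" using v by (auto simp: K_def)
  have max: "x \<bullet> f x \<le> \<mu> * (norm x)\<^sup>2" if "x \<in> W" for x
  proof (cases "x = 0")
    case False
    then have "x /\<^sub>R norm x \<in> K" using that W by (simp add: K_def subspace_scale)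
    from v(2)[OF this] have "x \<bullet> f x / (norm x)\<^sup>2 \<le> \<mu>"
      by (simp add: \<mu>_def scale power2_eq_square field_simps)
    then show ?thesis using False by (simp add: field_simps)
  qed simp
  define g where "g = f v - \<mu> *\<^sub>R v"
  have gW: "g \<in> W" unfolding g_def using W vW f by (simp add: subspace_diff subspace_scale)
  have g_v: "g \<bullet> f v = g \<bullet> g + \<mu> * (v \<bullet> g)"
    by (simp add: g_def algebra_simps inner_commute)
  have first_order: "2 * t * (g \<bullet> g) \<le> t\<^sup>2 * (\<mu> * (norm g)\<^sup>2 - g \<bullet> f g)" for t
  proof -
    have "(v + t *\<^sub>R g) \<bullet> f (v + t *\<^sub>R g) \<le> \<mu> * (norm (v + t *\<^sub>R g))\<^sup>2"
      using W vW gW by (intro max) (simp add: subspace_add subspace_scale)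
    moreover have "(v + t *\<^sub>R g) \<bullet> f (v + t *\<^sub>R g) = \<mu> + 2 * t * (g \<bullet> f v) + t\<^sup>2 * (g \<bullet> f g)"
      using sym[OF vW gW]
      by (simp add: add scale inner_add algebra_simps \<mu>_def power2_eq_square inner_commute)
    moreover have "(norm (v + t *\<^sub>R g))\<^sup>2 = 1 + 2 * t * (v \<bullet> g) + t\<^sup>2 * (norm g)\<^sup>2"
      unfolding power2_norm_eq_inner using norm_v
      by (simp add: norm_eq_1 inner_add_left inner_add_right algebra_simps power2_eq_square inner_commute)
    ultimately show ?thesis using g_v by (simp add: algebra_simps)
  qed
  have "g \<bullet> g = 0"
    using first_order by (rule linear_le_quadratic_imp_zero)
  then have "f v = \<mu> *\<^sub>R v" by (simp add: g_def)
  then show ?thesis using that vW norm_v max by blast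
qed

text \<open>Induction on the dimension: by symmetry, the complement of an eigenvector in
  \<open>W\<close> is invariant. The subspace form is needed because the map to which it is applied
  is symmetric on a hyperplane only.\<close>

lemma spectral_theorem:
  fixes f :: "'a::euclidean_space \<Rightarrow> 'a"
  assumes "subspace W" "linear f" "\<And>x. x \<in> W \<Longrightarrow> f x \<in> W"
    and "\<And>x y. x \<in> W \<Longrightarrow> y \<in> W \<Longrightarrow> f x \<bullet> y = x \<bullet> f y"
  shows "\<exists>B \<mu>. B \<subseteq> W \<and> finite B \<and> span B = W \<and> pairwise orthogonal B \<and>
           (\<forall>v\<in>B. norm v = 1 \<and> f v = \<mu> v *\<^sub>R v)"
  using assms(1,3,4)
proof (induction "dim W" arbitrary: W rule: less_induct)
  case less
  show ?case
  proof (cases "W = {0}")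
    case True
    then show ?thesis by (intro exI[of _ "{}"]) auto
  next
    case False
    interpret linear f by fact
    obtain v m where v: "v \<in> W" "norm v = 1" "f v = m *\<^sub>R v"
      using maximal_eigenvector_exists[OF less.prems(1) False assms(2) less.prems(2,3)] by metis
    define W' where "W' = {x \<in> W. v \<bullet> x = 0}"
    have W': "subspace W'"
      using less.prems(1) unfolding W'_def subspace_def by (auto simp: inner_add)
    have "v \<notin> W'" using v by (auto simp: W'_def)
    then have "W' \<subset> W" using v(1) unfolding W'_def by blast
    then have "dim W' < dim W"
      using W' less.prems(1) by (metis dim_psubset span_eq_iff)
    moreover have "f x \<in> W'" if "x \<in> W'" for x
      using less.prems(2)[of x] less.prems(3)[OF v(1), of x] that v(3) by (auto simp: W'_def)
    moreover have "f x \<bullet> y = x \<bullet> f y" if "x \<in> W'" "y \<in> W'" for x y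
      using less.prems(3) that by (auto simp: W'_def)
    ultimately obtain B \<mu> where B: "B \<subseteq> W'" "finite B" "span B = W'" "pairwise orthogonal B"
        "\<And>u. u \<in> B \<Longrightarrow> norm u = 1 \<and> f u = \<mu> u *\<^sub>R u"
      using less.hyps[of W'] W' by blast
    have vB: "v \<notin> B" using B(1) \<open>v \<notin> W'\<close> by blast
    have "span (insert v B) = W"
    proof
      show "span (insert v B) \<subseteq> W"
        using B(1) v(1) less.prems(1) by (intro span_minimal) (auto simp: W'_def)
      show "W \<subseteq> span (insert v B)"
      proof
        fix x assume x: "x \<in> W"
        have "x - (v \<bullet> x) *\<^sub>R v \<in> W'"
          using x v less.prems(1)
          by (auto simp: W'_def inner_diff_right norm_eq_1 intro!: subspace_diff subspace_scale)
        then have "x - (v \<bullet> x) *\<^sub>R v \<in> span B" using B(3) by simp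
        then show "x \<in> span (insert v B)" unfolding span_insert by blast
      qed
    qed
    moreover have "pairwise orthogonal (insert v B)"
      using B(1,4) by (auto simp: pairwise_insert W'_def orthogonal_def inner_commute)
    moreover have "\<forall>u\<in>insert v B. norm u = 1 \<and> f u = (\<mu>(v := m)) u *\<^sub>R u"
      using B(5) v(2,3) vB by auto
    ultimately show ?thesis
      using B(1,2) v(1) unfolding W'_def
      by (intro exI[of _ "insert v B"] exI[of _ "\<mu>(v := m)"]) auto
  qed
qed

text \<open>
  If \<open>b \<le> c a\<close> holds once late enough, it persists, and then \<open>b / a\<close> contracts; if this never
  happens for any \<open>c\<close>, then \<open>a\<close> is negligible.
\<close>

lemma dominance_dichotomy:
  fixes a b \<epsilon> :: "nat \<Rightarrow> real"
  assumes nonneg: "\<And>k. a k \<ge> 0" "\<And>k. b k \<ge> 0" and pos: "\<And>k. a k + b k > 0"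
    and rates: "0 \<le> \<alpha>" "\<alpha> < \<beta>" and \<epsilon>: "\<epsilon> \<longlonglongrightarrow> 0" "\<And>k. \<epsilon> k \<ge> 0"
    and up: "\<And>k. a (Suc k) \<ge> \<beta> * a k - \<epsilon> k * (a k + b k)"
    and low: "\<And>k. b (Suc k) \<le> \<alpha> * b k + \<epsilon> k * (a k + b k)"
  shows "(\<lambda>k. b k / (a k + b k)) \<longlonglongrightarrow> 0 \<or> (\<lambda>k. a k / (a k + b k)) \<longlonglongrightarrow> 0"
proof -
  have small: "\<forall>\<^sub>F k in sequentially. \<epsilon> k * C \<le> \<delta>" if "\<delta> > 0" for C \<delta> :: real
  proof -
    have "(\<lambda>k. \<epsilon> k * C) \<longlonglongrightarrow> 0 * C" by (intro tendsto_intros \<epsilon>)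
    then have "(\<lambda>k. \<epsilon> k * C) \<longlonglongrightarrow> 0" by simp
    from order_tendstoD(2)[OF this that] show ?thesis by eventually_elim simp
  qed
  define D where "D = (\<lambda>c. \<forall>\<^sub>F k in sequentially. b k \<le> c * a k)"
  have a_pos: "a k > 0" if "b k \<le> c * a k" for c k
    using that pos[of k] nonneg(1)[of k] by (cases "a k = 0") auto
  have invariant: "\<forall>\<^sub>F k in sequentially. b k \<le> c * a k \<longrightarrow> D c" if c: "c > 0" for c
  proof -
    \<comment> \<open>On the cone \<open>b k \<le> c * a k\<close> the two perturbations cost at
      most \<open>(1 + c) * \<epsilon> k * (1 + c) * a k\<close>, and the spectral gap leaves room
      for \<open>c * (\<beta> - \<alpha>) * a k\<close>.\<close>
    have "\<forall>\<^sub>F k in sequentially. \<epsilon> k * (1 + c)\<^sup>2 \<le> c * (\<beta> - \<alpha>)"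
      by (rule small) (use c rates in auto)
    then obtain K where K: "\<And>k. k \<ge> K \<Longrightarrow> \<epsilon> k * (1 + c)\<^sup>2 \<le> c * (\<beta> - \<alpha>)"
      unfolding eventually_sequentially by blast
    have step: "b (Suc k) \<le> c * a (Suc k)" if k: "k \<ge> K" "b k \<le> c * a k" for k
    proof -
      have "\<epsilon> k * (a k + b k) \<le> \<epsilon> k * ((1 + c) * a k)"
        using k \<epsilon>(2) by (intro mult_left_mono) (auto simp: algebra_simps)
      then have e: "(1 + c) * (\<epsilon> k * (a k + b k)) \<le> (1 + c) * (\<epsilon> k * ((1 + c) * a k))"
        by (rule mult_left_mono) (use c in simp)
      also have "\<dots> = \<epsilon> k * (1 + c)\<^sup>2 * a k" by (simp add: power2_eq_square)
      also have "\<dots> \<le> c * (\<beta> - \<alpha>) * a k" using K[OF k(1)] nonneg by (intro mult_right_mono) auto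
      finally have e: "\<epsilon> k * (a k + b k) + c * (\<epsilon> k * (a k + b k)) \<le> c * \<beta> * a k - c * \<alpha> * a k"
        by (simp add: algebra_simps)
      have "b (Suc k) \<le> \<alpha> * (c * a k) + \<epsilon> k * (a k + b k)"
        using low[of k] mult_left_mono[OF k(2) rates(1)] by linarith
      moreover have "c * (\<beta> * a k - \<epsilon> k * (a k + b k)) \<le> c * a (Suc k)"
        using up[of k] c by (intro mult_left_mono) auto
      ultimately show ?thesis using e by (simp add: algebra_simps)
    qed
    have "D c" if k: "k \<ge> K" "b k \<le> c * a k" for k
    proof -
      have "b j \<le> c * a j" if "j \<ge> k" for j
        using that by (induction j rule: dec_induct) (use k step in auto)
      then show ?thesis unfolding D_def eventually_sequentially by blast
    qed
    then show ?thesis unfolding eventually_sequentially by blast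
  qed
  show ?thesis
  proof (cases "\<exists>c>0. D c")
    case True
    then obtain c where c: "c > 0" "D c" by blast
    have all: "D c'" if c': "c' > 0" for c'
    \<comment> \<open>If \<open>b\<close> never entered the narrower cone, then \<open>a\<close> and
      \<open>b\<close> would remain comparable and every error small relative to both; then
      \<open>b / a\<close> would decay geometrically and could not stay above
      \<open>c'\<close>.\<close>
    proof (rule ccontr)
      assume nD: "\<not> D c'"
      \<comment> \<open>A quarter of the gap, so that
        \<open>\<alpha> + \<delta> < \<beta> - \<delta>\<close>.\<close>
      define \<delta> where "\<delta> = (\<beta> - \<alpha>) / 4"
      have \<delta>: "\<delta> > 0" using rates by (simp add: \<delta>_def)
      have "\<forall>\<^sub>F k in sequentially. c' * a k < b k"
        using invariant[OF c'] by eventually_elim (use nD in auto)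
      moreover have "\<forall>\<^sub>F k in sequentially. b k \<le> c * a k" using c(2) by (simp add: D_def)
      ultimately have "\<forall>\<^sub>F k in sequentially. c' * a k < b k \<and> b k \<le> c * a k \<and>
          \<epsilon> k * (1 / c' + 1) \<le> \<delta> \<and> \<epsilon> k * (1 + c) \<le> \<delta>"
        using small[OF \<delta>, of "1 / c' + 1"] small[OF \<delta>, of "1 + c"] by eventually_elim auto
      then obtain K where K: "\<And>k. k \<ge> K \<Longrightarrow> c' * a k < b k" "\<And>k. k \<ge> K \<Longrightarrow> b k \<le> c * a k"
          "\<And>k. k \<ge> K \<Longrightarrow> \<epsilon> k * (1 / c' + 1) \<le> \<delta>" "\<And>k. k \<ge> K \<Longrightarrow> \<epsilon> k * (1 + c) \<le> \<delta>"
        unfolding eventually_sequentially by blast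
      have b_step: "b (Suc k) \<le> (\<alpha> + \<delta>) * b k" if k: "k \<ge> K" for k
      proof -
        have "a k + b k \<le> (1 / c' + 1) * b k" using K(1)[OF k] c' by (simp add: field_simps)
        then have "\<epsilon> k * (a k + b k) \<le> \<epsilon> k * ((1 / c' + 1) * b k)"
          using \<epsilon>(2) by (intro mult_left_mono) auto
        also have "\<dots> \<le> \<delta> * b k"
          unfolding mult.assoc[symmetric] using K(3)[OF k] nonneg by (intro mult_right_mono) auto
        finally show ?thesis using low[of k] by (simp add: algebra_simps)
      qed
      have a_step: "a (Suc k) \<ge> (\<beta> - \<delta>) * a k" if k: "k \<ge> K" for k
      proof -
        have "\<epsilon> k * (a k + b k) \<le> \<epsilon> k * ((1 + c) * a k)"
          using \<epsilon>(2) K(2)[OF k] by (intro mult_left_mono) (auto simp: algebra_simps)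
        also have "\<dots> \<le> \<delta> * a k"
          unfolding mult.assoc[symmetric] using K(4)[OF k] nonneg by (intro mult_right_mono) auto
        finally show ?thesis using up[of k] by (simp add: algebra_simps)
      qed
      have rates': "\<alpha> + \<delta> > 0" "\<beta> - \<delta> > 0" "(\<alpha> + \<delta>) / (\<beta> - \<delta>) < 1"
        using rates by (auto simp: \<delta>_def field_simps)
      have b_pow: "b (K + m) \<le> (\<alpha> + \<delta>) ^ m * b K" for m
      proof (induction m)
        case (Suc m)
        have "b (K + Suc m) \<le> (\<alpha> + \<delta>) * b (K + m)" using b_step[of "K + m"] by simp
        also have "\<dots> \<le> (\<alpha> + \<delta>) * ((\<alpha> + \<delta>) ^ m * b K)" using Suc rates' by (intro mult_left_mono) auto
        finally show ?case by (simp add: mult_ac)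
      qed simp
      have a_pow: "a (K + m) \<ge> (\<beta> - \<delta>) ^ m * a K" for m
      proof (induction m)
        case (Suc m)
        have "(\<beta> - \<delta>) * ((\<beta> - \<delta>) ^ m * a K) \<le> (\<beta> - \<delta>) * a (K + m)" using Suc rates' by (intro mult_left_mono) auto
        also have "\<dots> \<le> a (K + Suc m)" using a_step[of "K + m"] by simp
        finally show ?case by (simp add: mult_ac)
      qed simp
      have "c' * a K \<le> ((\<alpha> + \<delta>) / (\<beta> - \<delta>)) ^ m * b K" for m
      proof -
        have "c' * ((\<beta> - \<delta>) ^ m * a K) \<le> c' * a (K + m)"
          using a_pow c' by (intro mult_left_mono) auto
        also have "\<dots> \<le> b (K + m)" using K(1)[of "K + m"] by simp
        also have "\<dots> \<le> (\<alpha> + \<delta>) ^ m * b K" by (rule b_pow)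
        finally show ?thesis using rates'(2) by (simp add: power_divide field_simps)
      qed
      moreover have "(\<lambda>m. ((\<alpha> + \<delta>) / (\<beta> - \<delta>)) ^ m * b K) \<longlonglongrightarrow> 0 * b K"
        using rates' by (intro tendsto_intros LIMSEQ_realpow_zero) auto
      ultimately have "c' * a K \<le> 0 * b K" by (intro LIMSEQ_le_const) auto
      then show False using a_pos[OF K(2)[of K]] c' by (simp add: zero_less_mult_iff mult_le_0_iff)
    qed
    have "(\<lambda>k. b k / (a k + b k)) \<longlonglongrightarrow> 0"
    proof (rule tendstoI)
      fix e :: real assume e: "e > 0"
      from all[of "e / 2"] e have "\<forall>\<^sub>F k in sequentially. b k \<le> e / 2 * a k" by (simp add: D_def)
      then show "\<forall>\<^sub>F k in sequentially. dist (b k / (a k + b k)) 0 < e"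
      proof eventually_elim
        case (elim k)
        have "b k < e * a k" using elim e a_pos[OF elim] by (simp add: field_simps) (smt (verit) mult_pos_pos)
        also have "\<dots> \<le> e * (a k + b k)" using e nonneg by (intro mult_left_mono) auto
        finally show ?case using pos[of k] nonneg[of k] by (simp add: divide_less_eq)
      qed
    qed
    then show ?thesis ..
  next
    case False
    have "(\<lambda>k. a k / (a k + b k)) \<longlonglongrightarrow> 0"
    proof (rule tendstoI)
      fix e :: real assume e: "e > 0"
      have "\<forall>\<^sub>F k in sequentially. b k \<le> 1 / e * a k \<longrightarrow> D (1 / e)" using e by (intro invariant) auto
      then show "\<forall>\<^sub>F k in sequentially. dist (a k / (a k + b k)) 0 < e"
      proof eventually_elim
        case (elim k)
        then have "1 / e * a k < b k" using False e by (auto simp: not_le)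
        then have "a k < e * b k" using e by (simp add: field_simps)
        also have "\<dots> \<le> e * (a k + b k)" using e nonneg by (intro mult_left_mono) auto
        finally show ?case using pos[of k] nonneg[of k] by (simp add: divide_less_eq)
      qed
    qed
    then show ?thesis ..
  qed
qed

section \<open>Perturbed power iteration\<close>

locale psd_compression =
  fixes M :: "'a::euclidean_space \<Rightarrow> 'a" and u :: 'a
  assumes linear_M: "linear M"
    and sym: "M x \<bullet> y = x \<bullet> M y"
    and psd: "0 \<le> x \<bullet> M x"
    and norm_u: "norm u = 1"
begin

text \<open>The map \<open>P M\<close> of the overview. It is symmetric on \<open>W\<close>, but in
  general not on the whole space.\<close>

definition B :: "'a \<Rightarrow> 'a" where "B x = M x - (u \<bullet> M x) *\<^sub>R u"

definition W :: "'a set" where "W = {x. x \<bullet> u = 0}"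

lemma linear_B: "linear B"
proof -
  interpret linear M by (rule linear_M)
  show ?thesis
    unfolding B_def by (rule linearI) (simp_all add: add scale inner_add algebra_simps)
qed

sublocale B: linear B by (rule linear_B)

lemma subspace_W: "subspace W"
  by (auto simp: W_def subspace_def inner_add)

lemma B_in_W: "B x \<in> W"
  using norm_u by (simp add: W_def B_def inner_diff norm_eq_1 inner_commute)

lemma inner_B: "v \<in> W \<Longrightarrow> v \<bullet> B x = v \<bullet> M x"
  by (simp add: W_def B_def inner_diff_right)

text \<open>The nonnegative form attains its minimum 0 at \<open>v\<close>, so its gradient there
  vanishes; the test direction is \<open>M v\<close> itself.\<close>

lemma kernel_M:
  assumes "v \<bullet> M v = 0"
  shows "M v = 0"
proof -
  interpret linear M by (rule linear_M)
  have "M v \<bullet> M v = 0"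
  proof (rule linear_le_quadratic_imp_zero)
    fix t :: real
    have "0 \<le> (v - t *\<^sub>R M v) \<bullet> M (v - t *\<^sub>R M v)" by (rule psd)
    also have "\<dots> = - 2 * t * (M v \<bullet> M v) + t\<^sup>2 * (M v \<bullet> M (M v))"
      using assms sym[of v "M v"]
      by (simp add: diff scale inner_diff algebra_simps power2_eq_square)
    finally show "2 * t * (M v \<bullet> M v) \<le> t\<^sup>2 * (M v \<bullet> M (M v))" by simp
  qed
  then show ?thesis by simp
qed

text \<open>The limit is the smallest threshold above which the spectral part of \<open>e k\<close>
  is negligible; then \<open>B (e k) - \<rho> *\<^sub>R e k\<close> is negligible too, without any
  convergence of directions. For \<open>\<rho> = 0\<close> no eigenvector in \<open>W\<close> is
  claimed, since the kernel of \<open>B\<close> may meet \<open>W\<close> only in 0.\<close>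

lemma power_iteration_ratio:
  assumes nz: "\<And>k. e k \<noteq> 0"
    and step: "(\<lambda>k. norm (e (Suc k) - B (e k)) / norm (e k)) \<longlonglongrightarrow> 0"
  obtains \<rho> where "(\<lambda>k. norm (e (Suc k)) / norm (e k)) \<longlonglongrightarrow> \<rho>"
    "\<rho> = 0 \<or> (\<rho> > 0 \<and> (\<exists>v\<in>W. v \<noteq> 0 \<and> B v = \<rho> *\<^sub>R v))"
proof -
  have "B x \<bullet> y = x \<bullet> B y" if "x \<in> W" "y \<in> W" for x y
    using inner_B[of x y] inner_B[of y x] that sym[of x y] by (simp add: inner_commute)
  then obtain V \<mu> where V: "V \<subseteq> W" "finite V" "span V = W" "pairwise orthogonal V"
    and eig: "\<And>v. v \<in> V \<Longrightarrow> norm v = 1 \<and> B v = \<mu> v *\<^sub>R v"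
    using spectral_theorem[OF subspace_W linear_B B_in_W] by blast
  have ortho: "v \<bullet> w = (if v = w then 1 else 0)" if "v \<in> V" "w \<in> V" for v w
    using V(4) eig that by (auto simp: pairwise_def orthogonal_def norm_eq_1)
  have norm_sum: "(norm (\<Sum>v\<in>V'. c v *\<^sub>R v))\<^sup>2 = (\<Sum>v\<in>V'. (c v)\<^sup>2)" if "V' \<subseteq> V" for V' c
  proof -
    have "(norm (\<Sum>v\<in>V'. c v *\<^sub>R v))\<^sup>2 = (\<Sum>v\<in>V'. (norm (c v *\<^sub>R v))\<^sup>2)"
      using V(2,4) that finite_subset
      by (intro norm_sum_Pythagorean) (auto simp: pairwise_def orthogonal_def)
    then show ?thesis using eig that by (auto intro!: sum.cong simp: subset_iff power_mult_distrib)
  qed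
  have \<mu>_eq: "\<mu> v = v \<bullet> M v" if "v \<in> V" for v
    using eig[OF that] inner_B[of v v] V(1) that by (auto simp: norm_eq_1)
  have \<mu>_nonneg: "\<mu> v \<ge> 0" if "v \<in> V" for v using \<mu>_eq[OF that] psd by simp
  \<comment> \<open>\<open>M v\<close> is a left eigenvector of \<open>B\<close>: the projection
    along \<open>u\<close> can be moved from one factor of the inner product to the other.\<close>
  have coeff_B: "v \<bullet> M (B x) = \<mu> v * (v \<bullet> M x)" if v: "v \<in> V" for v x
  proof -
    have "v \<bullet> M (B x) = M v \<bullet> B x" by (simp add: sym)
    also have "\<dots> = B v \<bullet> M x"
      by (simp add: B_def inner_diff algebra_simps inner_commute)
    finally show ?thesis using eig[OF v] by simp
  qed
  have B_expand: "B x = (\<Sum>v\<in>V. (v \<bullet> M x) *\<^sub>R v)" for x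
  proof -
    define y where "y = B x - (\<Sum>v\<in>V. (v \<bullet> M x) *\<^sub>R v)"
    have "y \<in> span V"
      unfolding y_def V(3) using V(1) subspace_W
      by (intro subspace_diff B_in_W subspace_sum subspace_scale) auto
    moreover have "orthogonal y v" if v: "v \<in> V" for v
    proof -
      have "(\<Sum>w\<in>V. (w \<bullet> M x) *\<^sub>R w) \<bullet> v = (\<Sum>w\<in>V. if w = v then v \<bullet> M x else 0)"
        unfolding inner_sum_left using ortho v by (intro sum.cong) auto
      also have "\<dots> = v \<bullet> M x" using V(2) v by simp
      finally show ?thesis
        using inner_B[of v x] V(1) v by (auto simp: orthogonal_def y_def inner_diff inner_commute)
    qed
    ultimately have "orthogonal y y" by (meson orthogonal_to_span)
    then show ?thesis by (simp add: orthogonal_def y_def)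
  qed
  \<comment> \<open>\<open>Q t\<close> is the spectral projection of \<open>B\<close> to the eigenvalues above \<open>t\<close>, for \<open>t \<ge> 0\<close>: the left
    eigenvector belonging to \<open>v\<close> is \<open>M v / \<mu> v\<close>.\<close>
  define Q where "Q = (\<lambda>t x. \<Sum>v\<in>{v \<in> V. t < \<mu> v}. ((v \<bullet> M x) / \<mu> v) *\<^sub>R v)"
  have linear_Q: "linear (Q t)" for t
  proof -
    interpret linear M by (rule linear_M)
    show ?thesis unfolding Q_def
      by (rule linearI)
        (simp_all add: add scale inner_add add_divide_distrib scaleR_add_left sum.distrib scaleR_sum_right)
  qed
  have BQ: "B (Q t x) = (\<Sum>v\<in>{v \<in> V. t < \<mu> v}. (v \<bullet> M x) *\<^sub>R v)" if "t \<ge> 0" for t x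
    unfolding Q_def B.sum B.scale using eig that by (intro sum.cong) auto
  have QB: "Q t (B x) = B (Q t x)" if "t \<ge> 0" for t x
    unfolding BQ[OF that] unfolding Q_def using coeff_B that by (intro sum.cong) auto
  define L where "L = (\<lambda>t x. x - Q t x)"
  have linear_L: "linear (L t)" for t
    unfolding L_def by (intro linear_compose_sub linear_Q linear_ident)
  have BL: "B (L t x) = (\<Sum>v\<in>{v \<in> V. \<mu> v \<le> t}. (v \<bullet> M x) *\<^sub>R v)" if "t \<ge> 0" for t x
  proof -
    have "B x = (\<Sum>v\<in>{v \<in> V. t < \<mu> v}. (v \<bullet> M x) *\<^sub>R v) + (\<Sum>v\<in>{v \<in> V. \<mu> v \<le> t}. (v \<bullet> M x) *\<^sub>R v)"
      unfolding B_expand[of x] using V(2)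
      by (subst sum.union_disjoint[symmetric]) (auto intro!: sum.cong)
    then show ?thesis unfolding L_def B.diff BQ[OF that] by simp
  qed
  have LB: "L t (B x) = B (L t x)" if "t \<ge> 0" for t x
    unfolding L_def B.diff QB[OF that] ..
  \<comment> \<open>\<open>B (L t x)\<close> lies in the span of the orthonormal eigenvectors with
    \<open>\<mu> v \<le> t\<close>. The vector \<open>L t x\<close> itself may have a part outside
    \<open>W\<close>, for which this argument gives no bound.\<close>
  have BBL: "norm (B (B (L t x))) \<le> t * norm (B (L t x))" if t: "t \<ge> 0" for t x
  proof -
    have "B (B (L t x)) = (\<Sum>v\<in>{v \<in> V. \<mu> v \<le> t}. ((v \<bullet> M x) * \<mu> v) *\<^sub>R v)"
      unfolding BL[OF t] B.sum B.scale using eig by (intro sum.cong) auto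
    then have "(norm (B (B (L t x))))\<^sup>2 = (\<Sum>v\<in>{v \<in> V. \<mu> v \<le> t}. ((v \<bullet> M x) * \<mu> v)\<^sup>2)"
      by (simp add: norm_sum)
    also have "\<dots> \<le> (\<Sum>v\<in>{v \<in> V. \<mu> v \<le> t}. t\<^sup>2 * (v \<bullet> M x)\<^sup>2)"
      unfolding power_mult_distrib using \<mu>_nonneg
      by (intro sum_mono) (auto simp: mult.commute intro!: mult_right_mono power_mono)
    also have "\<dots> = (t * norm (B (L t x)))\<^sup>2"
      unfolding BL[OF t] power_mult_distrib by (subst norm_sum) (auto simp: sum_distrib_left)
    finally show ?thesis by (rule power2_le_imp_le) (use t in simp)
  qed
  have bounded: "\<exists>K>0. \<forall>x. norm (f x) \<le> norm x * K" if "linear f" for f :: "'a \<Rightarrow> 'a"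
    using bounded_linear.pos_bounded[OF that[unfolded linear_conv_bounded_linear]] .
  define \<epsilon> where "\<epsilon> = (\<lambda>k. norm (e (Suc k) - B (e k)) / norm (e k))"
  have \<epsilon>: "\<epsilon> \<longlonglongrightarrow> 0" "\<And>k. \<epsilon> k \<ge> 0" using step by (auto simp: \<epsilon>_def)
  have dichotomy: "(\<lambda>k. norm (Q t (e k)) / norm (e k)) \<longlonglongrightarrow> 0 \<or> (\<lambda>k. norm (L t (e k)) / norm (e k)) \<longlonglongrightarrow> 0"
    if t: "t \<ge> 0" for t
  proof -
    \<comment> \<open>The smallest eigenvalue above \<open>t\<close>; inserting \<open>t + 1\<close>
      keeps the minimum meaningful when there is none.\<close>
    define \<beta> where "\<beta> = Min (insert (t + 1) (\<mu> ` {v \<in> V. t < \<mu> v}))"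
    have \<beta>: "t < \<beta>" and \<beta>_le: "\<And>v. v \<in> V \<Longrightarrow> t < \<mu> v \<Longrightarrow> \<beta> \<le> \<mu> v"
      unfolding \<beta>_def using V(2) by auto
    have BQ_lower: "\<beta> * norm (Q t x) \<le> norm (B (Q t x))" for x
    proof -
      have "(\<beta> * norm (Q t x))\<^sup>2 = (\<Sum>v\<in>{v \<in> V. t < \<mu> v}. \<beta>\<^sup>2 * ((v \<bullet> M x) / \<mu> v)\<^sup>2)"
        unfolding Q_def power_mult_distrib by (subst norm_sum) (auto simp: sum_distrib_left)
      also have "\<dots> \<le> (\<Sum>v\<in>{v \<in> V. t < \<mu> v}. (v \<bullet> M x)\<^sup>2)"
      proof (rule sum_mono)
        fix v assume v: "v \<in> {v \<in> V. t < \<mu> v}"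
        have "\<beta>\<^sup>2 * ((v \<bullet> M x) / \<mu> v)\<^sup>2 \<le> (\<mu> v)\<^sup>2 * ((v \<bullet> M x) / \<mu> v)\<^sup>2"
          using \<beta>_le[of v] v \<beta> t by (intro mult_right_mono power_mono) auto
        then show "\<beta>\<^sup>2 * ((v \<bullet> M x) / \<mu> v)\<^sup>2 \<le> (v \<bullet> M x)\<^sup>2"
          using v t by (simp add: power_divide)
      qed
      also have "\<dots> = (norm (B (Q t x)))\<^sup>2"
        unfolding BQ[OF t] by (subst norm_sum) auto
      finally show ?thesis by (rule power2_le_imp_le) simp
    qed
    \<comment> \<open>Half of the gap: with this weight the seminorm \<open>q\<close> contracts by
      \<open>t + \<eta>\<close>, still below \<open>\<beta>\<close>.\<close>
    define \<eta> where "\<eta> = (\<beta> - t) / 2"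
    have \<eta>: "\<eta> > 0" "t + \<eta> < \<beta>" using \<beta> by (auto simp: \<eta>_def field_simps)
    obtain K1 where K1: "K1 > 0" "\<And>x. norm (Q t x) \<le> norm x * K1"
      using bounded[OF linear_Q[of t]] by blast
    obtain K2 where K2: "K2 > 0" "\<And>x. norm (L t x) \<le> norm x * K2"
      using bounded[OF linear_L[of t]] by blast
    obtain K3 where K3: "K3 > 0" "\<And>x. norm (B x) \<le> norm x * K3"
      using bounded[OF linear_B] by blast
    \<comment> \<open>\<open>B\<close> contracts by \<open>t\<close> on its own image only; the second summand makes \<open>q\<close> see the kernel.\<close>
    define q where "q = (\<lambda>x. norm (B (L t x)) + \<eta> * norm (L t x))"
    have q_nonneg: "q x \<ge> 0" for x using \<eta> by (simp add: q_def)
    define K4 where "K4 = K2 * K3 + \<eta> * K2"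
    have q_le: "q x \<le> norm x * K4" for x
    proof -
      have "norm (B (L t x)) \<le> norm (L t x) * K3" by (rule K3)
      also have "\<dots> \<le> norm x * K2 * K3" using K2(2)[of x] K3(1) by (intro mult_right_mono) auto
      finally have 1: "norm (B (L t x)) \<le> norm x * K2 * K3" .
      have 2: "\<eta> * norm (L t x) \<le> \<eta> * (norm x * K2)" using \<eta>(1) by (intro mult_left_mono K2(2)) simp
      have "norm x * K4 = norm x * K2 * K3 + \<eta> * (norm x * K2)" by (simp add: K4_def algebra_simps)
      then show ?thesis unfolding q_def using 1 2 by linarith
    qed
    have K4: "K4 > 0" using K2(1) K3(1) \<eta>(1) by (simp add: K4_def add_pos_pos)
    have q_triangle: "q (x + y) \<le> q x + q y" for x y
    proof -
      have 1: "norm (B (L t (x + y))) \<le> norm (B (L t x)) + norm (B (L t y))"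
        unfolding linear_add[OF linear_L] B.add by (rule norm_triangle_ineq)
      have "\<eta> * norm (L t (x + y)) \<le> \<eta> * (norm (L t x) + norm (L t y))"
        unfolding linear_add[OF linear_L] using \<eta> by (intro mult_left_mono norm_triangle_ineq) auto
      also have "\<dots> = \<eta> * norm (L t x) + \<eta> * norm (L t y)" by (rule distrib_left)
      finally show ?thesis unfolding q_def using 1 by linarith
    qed
    have q_B: "q (B x) \<le> (t + \<eta>) * q x" for x
    proof -
      have "q (B x) \<le> (t + \<eta>) * norm (B (L t x))"
        unfolding q_def LB[OF t] distrib_right using BBL[OF t, of x] by linarith
      also have "\<dots> \<le> (t + \<eta>) * q x"
        unfolding q_def using t \<eta> by (intro mult_left_mono) auto
      finally show ?thesis .
    qed
    have norm_le: "norm x \<le> norm (Q t x) + q x / \<eta>" for x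
    proof -
      have "norm x \<le> norm (Q t x) + norm (L t x)"
        using norm_triangle_ineq[of "Q t x" "L t x"] by (simp add: L_def)
      moreover have "norm (L t x) \<le> q x / \<eta>" using \<eta> by (simp add: q_def field_simps)
      ultimately show ?thesis by simp
    qed
    define a where "a = (\<lambda>k. norm (Q t (e k)))"
    define b where "b = (\<lambda>k. q (e k))"
    \<comment> \<open>\<open>K1 + K4\<close> dominates the bounds of both \<open>Q t\<close> and
      \<open>q\<close>, and the second factor converts \<open>norm (e k)\<close> into
      \<open>a k + b k\<close>.\<close>
    define C where "C = (K1 + K4) * (1 + 1 / \<eta>)"
    have C: "C \<ge> 0" using K1 K4 \<eta> by (simp add: C_def)
    have norm_e: "norm (e k) \<le> (1 + 1 / \<eta>) * (a k + b k)" for k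
    proof -
      have "norm (e k) \<le> a k + b k / \<eta>" using norm_le[of "e k"] by (simp add: a_def b_def)
      moreover have "0 \<le> b k" "0 \<le> a k / \<eta>" using q_nonneg \<eta> by (auto simp: a_def b_def)
      ultimately show ?thesis by (simp add: algebra_simps)
    qed
    have ab_pos: "a k + b k > 0" for k
    proof -
      have "0 < (1 + 1 / \<eta>) * (a k + b k)" by (rule order.strict_trans2[OF _ norm_e]) (simp add: nz)
      then show ?thesis by (rule zero_less_mult_pos) (use \<eta>(1) in \<open>auto intro: add_pos_pos\<close>)
    qed
    have \<delta>: "norm (e (Suc k) - B (e k)) = \<epsilon> k * norm (e k)" for k using nz[of k] by (simp add: \<epsilon>_def)
    have err: "K * norm (e (Suc k) - B (e k)) \<le> \<epsilon> k * C * (a k + b k)" if "0 \<le> K" "K \<le> K1 + K4" for K k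
    proof -
      have "K * norm (e (Suc k) - B (e k)) \<le> (K1 + K4) * norm (e (Suc k) - B (e k))"
        using that by (intro mult_right_mono) auto
      also have "\<dots> \<le> (K1 + K4) * (\<epsilon> k * ((1 + 1 / \<eta>) * (a k + b k)))"
        unfolding \<delta> using K1(1) K4 \<epsilon>(2) by (intro mult_left_mono norm_e) auto
      finally show ?thesis by (simp add: C_def mult_ac)
    qed
    have split: "e (Suc k) = B (e k) + (e (Suc k) - B (e k))" for k by simp
    have "(\<lambda>k. b k / (a k + b k)) \<longlonglongrightarrow> 0 \<or> (\<lambda>k. a k / (a k + b k)) \<longlonglongrightarrow> 0"
    proof (rule dominance_dichotomy)
      show "a k \<ge> 0" "b k \<ge> 0" for k using q_nonneg by (auto simp: a_def b_def)
      show "a k + b k > 0" for k by (rule ab_pos)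
      show "0 \<le> t + \<eta>" "t + \<eta> < \<beta>" using t \<eta> by auto
      have "(\<lambda>k. \<epsilon> k * C) \<longlonglongrightarrow> 0 * C" by (intro tendsto_intros \<epsilon>)
      then show "(\<lambda>k. \<epsilon> k * C) \<longlonglongrightarrow> 0" by simp
      show "0 \<le> \<epsilon> k * C" for k using \<epsilon> C by simp
      show "\<beta> * a k - \<epsilon> k * C * (a k + b k) \<le> a (Suc k)" for k
      proof -
        have "\<beta> * a k \<le> norm (Q t (B (e k)))" unfolding QB[OF t] a_def by (rule BQ_lower)
        also have "\<dots> = norm (Q t (e (Suc k)) - Q t (e (Suc k) - B (e k)))"
          by (simp add: linear_diff[OF linear_Q])
        also have "\<dots> \<le> a (Suc k) + K1 * norm (e (Suc k) - B (e k))"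
          unfolding a_def
          using norm_triangle_ineq4[of "Q t (e (Suc k))" "Q t (e (Suc k) - B (e k))"]
            K1(2)[of "e (Suc k) - B (e k)"] by (simp add: mult.commute)
        finally show ?thesis using err[of K1 k] K1(1) K4 by simp
      qed
      show "b (Suc k) \<le> (t + \<eta>) * b k + \<epsilon> k * C * (a k + b k)" for k
      proof -
        have "b (Suc k) \<le> q (B (e k)) + q (e (Suc k) - B (e k))"
          unfolding b_def by (subst split) (rule q_triangle)
        also have "\<dots> \<le> (t + \<eta>) * b k + K4 * norm (e (Suc k) - B (e k))"
          using q_B[of "e k"] q_le[of "e (Suc k) - B (e k)"] by (simp add: b_def mult.commute)
        finally show ?thesis using err[of K4 k] K1(1) K4 by simp
      qed
    qed
    moreover have transfer: "(\<lambda>k. f k / norm (e k)) \<longlonglongrightarrow> 0"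
      if lim: "(\<lambda>k. g k / (a k + b k)) \<longlonglongrightarrow> 0" and f: "\<And>k. 0 \<le> f k" "\<And>k. f k \<le> K * g k" and K: "K \<ge> 0"
      for f g K
    proof (rule Lim_null_comparison)
      have "(\<lambda>k. K * (K1 + K4) * (g k / (a k + b k))) \<longlonglongrightarrow> K * (K1 + K4) * 0" by (intro tendsto_intros lim)
      then show "(\<lambda>k. K * (K1 + K4) * (g k / (a k + b k))) \<longlonglongrightarrow> 0" by simp
      have "norm (f k / norm (e k)) \<le> K * (K1 + K4) * (g k / (a k + b k))" for k
      proof -
        have ab: "a k + b k \<le> (K1 + K4) * norm (e k)"
          using K1(2)[of "e k"] q_le[of "e k"] by (simp add: a_def b_def algebra_simps)
        have ek: "norm (e k) > 0" using nz by simp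
        have pos: "a k + b k > 0" by (rule ab_pos)
        have g: "0 \<le> K * g k" using f order_trans by blast
        have "f k * (a k + b k) \<le> (K * g k) * ((K1 + K4) * norm (e k))"
          using f pos ab g by (intro mult_mono) auto
        then show ?thesis using ek pos f(1)[of k] by (simp add: field_simps)
      qed
      then show "\<forall>\<^sub>F k in sequentially. norm (f k / norm (e k)) \<le> K * (K1 + K4) * (g k / (a k + b k))"
        by simp
    qed
    ultimately show ?thesis
    proof (elim disjE)
      assume *: "(\<lambda>k. b k / (a k + b k)) \<longlonglongrightarrow> 0"
      have "(\<lambda>k. norm (L t (e k)) / norm (e k)) \<longlonglongrightarrow> 0"
        by (rule transfer[OF *, of _ "1 / \<eta>"]) (use \<eta> in \<open>auto simp: b_def q_def field_simps\<close>)
      then show ?thesis ..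
    next
      assume *: "(\<lambda>k. a k / (a k + b k)) \<longlonglongrightarrow> 0"
      have "(\<lambda>k. norm (Q t (e k)) / norm (e k)) \<longlonglongrightarrow> 0"
        by (rule transfer[OF *, of _ 1]) (auto simp: a_def)
      then show ?thesis ..
    qed
  qed
  \<comment> \<open>0 is always an eigenvalue of \<open>B\<close>, whose range lies in the
    hyperplane \<open>W\<close>; it need not occur among the \<open>\<mu> v\<close>, and
    \<open>V\<close> is empty when \<open>W = {0}\<close>.\<close>
  define \<Lambda> where "\<Lambda> = insert 0 (\<mu> ` V)"
  have fin\<Lambda>: "finite \<Lambda>" and \<Lambda>_nonneg: "\<And>t. t \<in> \<Lambda> \<Longrightarrow> t \<ge> 0"
    using V(2) \<mu>_nonneg by (auto simp: \<Lambda>_def)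
  define S where "S = {t \<in> \<Lambda>. (\<lambda>k. norm (Q t (e k)) / norm (e k)) \<longlonglongrightarrow> 0}"
  have "Max \<Lambda> \<in> S"
  proof -
    have "{v \<in> V. Max \<Lambda> < \<mu> v} = {}"
      using Max_ge[OF fin\<Lambda>] by (auto simp: \<Lambda>_def not_less)
    then have "Q (Max \<Lambda>) x = 0" for x unfolding Q_def by (simp only: sum.empty)
    moreover have "Max \<Lambda> \<in> \<Lambda>" using fin\<Lambda> by (intro Max_in) (auto simp: \<Lambda>_def)
    ultimately show ?thesis by (simp add: S_def)
  qed
  moreover have finS: "finite S" using fin\<Lambda> by (simp add: S_def)
  ultimately have \<rho>_S: "Min S \<in> S" by (intro Min_in) auto
  define \<rho> where "\<rho> = Min S"
  have \<rho>: "\<rho> \<in> \<Lambda>" "(\<lambda>k. norm (Q \<rho> (e k)) / norm (e k)) \<longlonglongrightarrow> 0" "\<rho> \<ge> 0"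
    using \<rho>_S \<Lambda>_nonneg by (auto simp: S_def \<rho>_def)
  have "\<exists>C y. (\<forall>k. norm (B (e k) - \<rho> *\<^sub>R e k) \<le> C * y k) \<and> (\<lambda>k. y k / norm (e k)) \<longlonglongrightarrow> 0"
  proof (cases "\<rho> = 0")
    case True
    obtain K where K: "K > 0" "\<And>x. norm (B x) \<le> norm x * K" using bounded[OF linear_B] by blast
    \<comment> \<open>Semidefiniteness enters here: \<open>\<mu> v = 0\<close> forces
      \<open>M v = 0\<close>, so such \<open>v\<close> contribute nothing to \<open>B x\<close>,
      even for \<open>x\<close> outside \<open>W\<close>.\<close>
    have "B x = B (Q 0 x)" for x
    proof -
      have "v \<bullet> M x = 0" if "v \<in> V" "\<mu> v = 0" for v
        using kernel_M[of v] \<mu>_eq that sym[of v x] by simp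
      then have "B x = (\<Sum>v\<in>{v \<in> V. 0 < \<mu> v}. (v \<bullet> M x) *\<^sub>R v)"
        unfolding B_expand[of x] using V(2) \<mu>_nonneg
        by (intro sum.mono_neutral_right) (auto simp: order.order_iff_strict)
      then show ?thesis by (simp add: BQ)
    qed
    then have "norm (B (e k) - \<rho> *\<^sub>R e k) \<le> K * norm (Q 0 (e k))" for k
      using K(2)[of "Q 0 (e k)"] by (simp add: True mult.commute)
    then show ?thesis
      using \<rho>(2) True by (intro exI[of _ K] exI[of _ "\<lambda>k. norm (Q 0 (e k))"]) simp
  next
    case False
    \<comment> \<open>\<open>\<tau>\<close>, the predecessor of \<open>\<rho>\<close> in
      \<open>\<Lambda>\<close>, is not in \<open>S\<close> by minimality, so the dichotomy makes the
      part \<open>L \<tau>\<close> negligible. Between \<open>\<tau>\<close> and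
      \<open>\<rho>\<close> only the eigenspace of \<open>\<rho>\<close> is left.\<close>
    define T where "T = {t \<in> \<Lambda>. t < \<rho>}"
    have T: "finite T" "0 \<in> T" using fin\<Lambda> False \<rho>(3) by (auto simp: T_def \<Lambda>_def)
    define \<tau> where "\<tau> = Max T"
    have \<tau>T: "\<tau> \<in> T" unfolding \<tau>_def using T by (intro Max_in) auto
    then have \<tau>: "\<tau> \<in> \<Lambda>" "\<tau> < \<rho>" "\<tau> \<ge> 0" using \<Lambda>_nonneg by (auto simp: T_def)
    have "\<tau> \<notin> S" using Min_le[OF finS, of \<tau>] \<tau>(2) by (auto simp: \<rho>_def)
    then have limL: "(\<lambda>k. norm (L \<tau> (e k)) / norm (e k)) \<longlonglongrightarrow> 0"
      using dichotomy[OF \<tau>(3)] \<tau>(1) by (auto simp: S_def)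
    have gap: "\<mu> v = \<rho>" if "v \<in> V" "\<tau> < \<mu> v" "\<mu> v \<le> \<rho>" for v
    proof (rule ccontr)
      assume "\<mu> v \<noteq> \<rho>"
      then have "\<mu> v \<in> T" using that by (auto simp: T_def \<Lambda>_def)
      then show False using Max_ge[OF T(1), of "\<mu> v"] that by (simp add: \<tau>_def)
    qed
    define z where "z = (\<lambda>x. Q \<tau> x - Q \<rho> x)"
    have z: "z x = (\<Sum>v\<in>{v \<in> V. \<mu> v = \<rho>}. ((v \<bullet> M x) / \<mu> v) *\<^sub>R v)" for x
    proof -
      have "{v \<in> V. \<tau> < \<mu> v} = {v \<in> V. \<mu> v = \<rho>} \<union> {v \<in> V. \<rho> < \<mu> v}"
        using gap \<tau> by force
      then have "Q \<tau> x = (\<Sum>v\<in>{v \<in> V. \<mu> v = \<rho>}. ((v \<bullet> M x) / \<mu> v) *\<^sub>R v) + Q \<rho> x"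
        unfolding Q_def using V(2) by (subst sum.union_disjoint[symmetric]) auto
      then show ?thesis by (simp add: z_def)
    qed
    have Bz: "B (z x) = \<rho> *\<^sub>R z x" for x
      unfolding z B.sum B.scale scaleR_sum_right using eig by (intro sum.cong) auto
    obtain K where K: "K > 0" "\<And>x. norm (B x - \<rho> *\<^sub>R x) \<le> norm x * K"
      using bounded[of "\<lambda>x. B x - \<rho> *\<^sub>R x"]
      by (auto intro: linear_compose_sub linear_B linear_scaleR)
    have "norm (B (e k) - \<rho> *\<^sub>R e k) \<le> K * (norm (L \<tau> (e k)) + norm (Q \<rho> (e k)))" for k
    proof -
      have "B (e k) - \<rho> *\<^sub>R e k = B (e k - z (e k)) - \<rho> *\<^sub>R (e k - z (e k))"
        unfolding B.diff Bz by (simp add: algebra_simps)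
      then have "norm (B (e k) - \<rho> *\<^sub>R e k) \<le> norm (e k - z (e k)) * K" using K(2)[of "e k - z (e k)"] by simp
      also have "e k - z (e k) = L \<tau> (e k) + Q \<rho> (e k)" by (simp add: z_def L_def)
      also have "norm (L \<tau> (e k) + Q \<rho> (e k)) * K \<le> (norm (L \<tau> (e k)) + norm (Q \<rho> (e k))) * K"
        using K(1) by (intro mult_right_mono norm_triangle_ineq) simp
      finally show ?thesis by (simp only: mult.commute)
    qed
    moreover have "(\<lambda>k. (norm (L \<tau> (e k)) + norm (Q \<rho> (e k))) / norm (e k)) \<longlonglongrightarrow> 0"
      using tendsto_add[OF limL \<rho>(2)] by (simp add: add_divide_distrib)
    ultimately show ?thesis
      by (intro exI[of _ K] exI[of _ "\<lambda>k. norm (L \<tau> (e k)) + norm (Q \<rho> (e k))"]) simp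
  qed
  then obtain C y where Cy: "\<And>k. norm (B (e k) - \<rho> *\<^sub>R e k) \<le> C * y k"
    and y: "(\<lambda>k. y k / norm (e k)) \<longlonglongrightarrow> 0" by blast
  have "(\<lambda>k. norm (e (Suc k)) / norm (e k) - \<rho>) \<longlonglongrightarrow> 0"
  proof (rule Lim_null_comparison)
    have "(\<lambda>k. \<epsilon> k + C * (y k / norm (e k))) \<longlonglongrightarrow> 0 + C * 0" by (intro tendsto_intros \<epsilon> y)
    then show "(\<lambda>k. \<epsilon> k + C * (y k / norm (e k))) \<longlonglongrightarrow> 0" by simp
    have "norm (norm (e (Suc k)) / norm (e k) - \<rho>) \<le> \<epsilon> k + C * (y k / norm (e k))" for k
    proof -
      have "\<bar>norm (e (Suc k)) - norm (\<rho> *\<^sub>R e k)\<bar> \<le> norm (e (Suc k) - \<rho> *\<^sub>R e k)"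
        by (rule norm_triangle_ineq3)
      also have "\<dots> \<le> norm (e (Suc k) - B (e k)) + norm (B (e k) - \<rho> *\<^sub>R e k)"
        using norm_triangle_ineq[of "e (Suc k) - B (e k)" "B (e k) - \<rho> *\<^sub>R e k"] by simp
      also have "\<dots> \<le> norm (e (Suc k) - B (e k)) + C * y k" using Cy by simp
      finally have "\<bar>norm (e (Suc k)) - norm (\<rho> *\<^sub>R e k)\<bar> / norm (e k)
          \<le> (norm (e (Suc k) - B (e k)) + C * y k) / norm (e k)"
        by (rule divide_right_mono) simp
      moreover have "\<bar>norm (e (Suc k)) - norm (\<rho> *\<^sub>R e k)\<bar> / norm (e k) = \<bar>norm (e (Suc k)) / norm (e k) - \<rho>\<bar>"
      proof -
        have "norm (e (Suc k)) / norm (e k) - \<rho> = (norm (e (Suc k)) - norm (\<rho> *\<^sub>R e k)) / norm (e k)"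
          using nz[of k] \<rho>(3) by (simp add: field_simps)
        then show ?thesis by simp
      qed
      ultimately show ?thesis by (simp add: \<epsilon>_def add_divide_distrib)
    qed
    then show "\<forall>\<^sub>F k in sequentially. norm (norm (e (Suc k)) / norm (e k) - \<rho>) \<le> \<epsilon> k + C * (y k / norm (e k))"
      by simp
  qed
  then have "(\<lambda>k. norm (e (Suc k)) / norm (e k)) \<longlonglongrightarrow> \<rho>" by (simp add: LIM_zero_iff)
  moreover have "\<rho> = 0 \<or> (\<rho> > 0 \<and> (\<exists>v\<in>W. v \<noteq> 0 \<and> B v = \<rho> *\<^sub>R v))"
  proof (cases "\<rho> = 0")
    case False
    then obtain v where "v \<in> V" "\<mu> v = \<rho>" using \<rho>(1) by (auto simp: \<Lambda>_def)
    then show ?thesis using eig[of v] V(1) \<rho>(3) False by force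
  qed simp
  ultimately show ?thesis using that by blast
qed

end

section \<open>Second-order Taylor estimates\<close>

text \<open>Links the iterated partial derivatives to \<open>grad\<close>, a definite description
  pinned down by uniqueness of the derivative, and to \<open>hess\<close>, the Jacobian of
  \<open>grad\<close>.\<close>

lemma grad_hess_of_times_differentiable:
  fixes f :: "real ^ 'd \<Rightarrow> real"
  assumes f: "times_differentiable_on 2 U (\<lambda>x. complex_of_real (f x))" and x: "x \<in> U" and U: "open U"
  shows "(f has_derivative (\<lambda>h. grad f x \<bullet> h)) (at x)"
    and "(grad f has_derivative (\<lambda>h. hess f x *v h)) (at x)"
proof -
  define F where "F = (\<lambda>x. complex_of_real (f x))"
  have f2: "times_differentiable_on (Suc (Suc 0)) U F" using f by (simp add: F_def numeral_2_eq_2)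
  have F: "(F has_derivative frechet_derivative F (at y)) (at y)" if "y \<in> U" for y
    using times_differentiable_on_Suc_has_derivative[OF f2 that] .
  have f': "(f has_derivative (\<lambda>h. Re (frechet_derivative F (at y) h))) (at y)" if "y \<in> U" for y
  proof -
    have "((\<lambda>y. Re (F y)) has_derivative (\<lambda>h. Re (frechet_derivative F (at y) h))) (at y)"
      by (rule has_derivative_Re[OF F[OF that]])
    then show ?thesis by (simp add: F_def)
  qed
  define g where "g = (\<lambda>y. \<chi> i. Re (frechet_derivative F (at y) (axis i 1)))"
  have f_g: "(f has_derivative (\<lambda>h. g y \<bullet> h)) (at y)" if "y \<in> U" for y
  proof -
    have lin: "linear (\<lambda>h. Re (frechet_derivative F (at y) h))"
      using f'[OF that] has_derivative_linear by blast
    have "Re (frechet_derivative F (at y) h) = g y \<bullet> h" for h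
    proof -
      have "h = (\<Sum>i\<in>UNIV. h $ i *\<^sub>R axis i 1)"
        using basis_expansion[of h] by (simp add: scalar_mult_eq_scaleR)
      then have "Re (frechet_derivative F (at y) h) = Re (frechet_derivative F (at y) (\<Sum>i\<in>UNIV. h $ i *\<^sub>R axis i 1))"
        by simp
      also have "\<dots> = (\<Sum>i\<in>UNIV. h $ i * Re (frechet_derivative F (at y) (axis i 1)))"
        by (subst linear_sum[OF lin]) (simp add: linear_scale[OF lin])
      finally show ?thesis by (simp add: g_def inner_vec_def mult.commute)
    qed
    then show ?thesis using f'[OF that] by simp
  qed
  have grad_g: "grad f y = g y" if "y \<in> U" for y
    unfolding grad_def
  proof (rule the_equality)
    show "GDERIV f y :> g y" using f_g[OF that] by (simp add: gderiv_def inner_commute)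
    fix z assume "GDERIV f y :> z"
    then have "(\<lambda>h. h \<bullet> z) = (\<lambda>h. g y \<bullet> h)"
      using f_g[OF that] has_derivative_unique by (auto simp: gderiv_def)
    then have "(z - g y) \<bullet> (z - g y) = 0"
      by (metis inner_diff_right inner_commute right_minus_eq)
    then show "z = g y" by simp
  qed
  show "(f has_derivative (\<lambda>h. grad f x \<bullet> h)) (at x)" using f_g[OF x] by (simp add: grad_g[OF x])
  have "((\<lambda>y. g y) has_derivative (\<lambda>h. \<chi> i. Re (frechet_derivative
      (\<lambda>y. frechet_derivative F (at y) (axis i 1)) (at x) h))) (at x)"
  proof (subst has_derivative_componentwise_within, intro ballI)
    fix b :: "real ^ 'd" assume "b \<in> Basis"
    then obtain i where b: "b = axis i 1" by (auto simp: Basis_vec_def)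
    have "((\<lambda>y. frechet_derivative F (at y) (axis i 1)) has_derivative
        frechet_derivative (\<lambda>y. frechet_derivative F (at y) (axis i 1)) (at x)) (at x)"
      using f2 x by (simp add: frechet_derivative_works)
    from has_derivative_Re[OF this]
    show "((\<lambda>y. g y \<bullet> b) has_derivative (\<lambda>h. (\<chi> i. Re (frechet_derivative
      (\<lambda>y. frechet_derivative F (at y) (axis i 1)) (at x) h)) \<bullet> b)) (at x)"
      by (simp add: b g_def inner_axis)
  qed
  then have "(grad f has_derivative (\<lambda>h. \<chi> i. Re (frechet_derivative
      (\<lambda>y. frechet_derivative F (at y) (axis i 1)) (at x) h))) (at x)"
    by (rule has_derivative_transform_within_open[OF _ U x]) (simp add: grad_g)
  then have "grad f differentiable (at x)" by (auto simp: differentiable_def)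
  then show "(grad f has_derivative (\<lambda>h. hess f x *v h)) (at x)"
    unfolding hess_def jacobian_works .
qed

text \<open>The mean value theorem is applied in the direction \<open>h\<close> to a difference
  taken in the direction \<open>k\<close>. Only differentiability of \<open>g\<close> at the point
  \<open>x\<close> is used, and the quotient is symmetric in \<open>h\<close> and \<open>k\<close>,
  which gives the symmetry of the Hessian.\<close>

lemma second_difference_quotient:
  fixes f :: "'a::real_inner \<Rightarrow> real"
  assumes U: "open U" "x \<in> U" and f: "\<And>y. y \<in> U \<Longrightarrow> (f has_derivative (\<lambda>h. g y \<bullet> h)) (at y)"
    and g: "(g has_derivative D) (at x)"
  shows "((\<lambda>s. (f (x + s *\<^sub>R h + s *\<^sub>R k) - f (x + s *\<^sub>R h) - f (x + s *\<^sub>R k) + f x) / s\<^sup>2)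
    \<longlongrightarrow> D k \<bullet> h) (at_right 0)"
proof -
  define N where "N = norm h + norm k"
  obtain r where r: "r > 0" "ball x r \<subseteq> U" using U open_contains_ball by blast
  have lin: "linear D" using g has_derivative_linear by blast
  show ?thesis
  proof (rule tendstoI)
    fix e :: real assume e: "e > 0"
    \<comment> \<open>After division by \<open>s\<^sup>2\<close> the error is at most
      \<open>2 * e' * N * norm h\<close>, which this choice keeps below \<open>e\<close>; the added
      1 avoids a zero denominator.\<close>
    define e' where "e' = e / (2 * (2 * N * norm h + 1))"
    have N: "N \<ge> 0" "norm h \<le> N" "norm k \<le> N" by (auto simp: N_def)
    have e': "e' > 0" using e N by (auto simp: e'_def intro!: divide_pos_pos add_nonneg_pos)
    obtain d where d: "d > 0" "\<And>y. norm (y - x) < d \<Longrightarrow> norm (g y - g x - D (y - x)) \<le> e' * norm (y - x)"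
      using g e' unfolding has_derivative_at_alt by metis
    define s0 where "s0 = min r d / (N + 1)"
    have s0: "s0 > 0" using r d N by (auto simp: s0_def intro!: divide_pos_pos)
    have "dist ((f (x + s *\<^sub>R h + s *\<^sub>R k) - f (x + s *\<^sub>R h) - f (x + s *\<^sub>R k) + f x) / s\<^sup>2) (D k \<bullet> h) < e"
      if s: "0 < s" "s < s0" for s
    proof -
      have sN: "s * N < min r d"
      proof -
        have "s * N \<le> s * (N + 1)" using s by (intro mult_left_mono) auto
        also have "\<dots> < s0 * (N + 1)" using s N by (intro mult_strict_right_mono) auto
        finally show ?thesis using N by (simp add: s0_def)
      qed
      have near: "norm (\<tau> *\<^sub>R (s *\<^sub>R h) + \<sigma> *\<^sub>R (s *\<^sub>R k)) \<le> s * N" if "0 \<le> \<tau>" "\<tau> \<le> 1" "0 \<le> \<sigma>" "\<sigma> \<le> 1" for \<tau> \<sigma>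
      proof -
        have "norm (\<tau> *\<^sub>R (s *\<^sub>R h) + \<sigma> *\<^sub>R (s *\<^sub>R k)) \<le> \<tau> * (s * norm h) + \<sigma> * (s * norm k)"
          using that s by (intro order_trans[OF norm_triangle_ineq]) auto
        also have "\<dots> \<le> 1 * (s * norm h) + 1 * (s * norm k)"
          using that s by (intro add_mono mult_right_mono) auto
        finally show ?thesis by (simp add: N_def algebra_simps)
      qed
      have inU: "x + \<tau> *\<^sub>R (s *\<^sub>R h) + \<sigma> *\<^sub>R (s *\<^sub>R k) \<in> U" if "0 \<le> \<tau>" "\<tau> \<le> 1" "0 \<le> \<sigma>" "\<sigma> \<le> 1" for \<tau> \<sigma>
      proof -
        define v where "v = \<tau> *\<^sub>R (s *\<^sub>R h) + \<sigma> *\<^sub>R (s *\<^sub>R k)"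
        have "norm v < r" using near[OF that, folded v_def] sN by simp
        then have "x + v \<in> ball x r" by (simp add: dist_norm)
        then show ?thesis using r(2) by (auto simp: v_def add.assoc)
      qed
      define \<phi> where "\<phi> = (\<lambda>\<tau>. f (x + \<tau> *\<^sub>R (s *\<^sub>R h) + s *\<^sub>R k) - f (x + \<tau> *\<^sub>R (s *\<^sub>R h)))"
      have \<phi>': "(\<phi> has_real_derivative (g (x + \<tau> *\<^sub>R (s *\<^sub>R h) + s *\<^sub>R k) - g (x + \<tau> *\<^sub>R (s *\<^sub>R h))) \<bullet> (s *\<^sub>R h)) (at \<tau>)"
        if "0 \<le> \<tau>" "\<tau> \<le> 1" for \<tau>
      proof -
        have 1: "((\<lambda>\<tau>. f (x + \<tau> *\<^sub>R (s *\<^sub>R h) + s *\<^sub>R k)) has_derivative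
            (\<lambda>t. g (x + \<tau> *\<^sub>R (s *\<^sub>R h) + s *\<^sub>R k) \<bullet> (t *\<^sub>R (s *\<^sub>R h)))) (at \<tau>)"
          using inU[of \<tau> 1] that
          by (intro has_derivative_compose[OF _ f]) (auto intro!: derivative_eq_intros)
        have 2: "((\<lambda>\<tau>. f (x + \<tau> *\<^sub>R (s *\<^sub>R h))) has_derivative
            (\<lambda>t. g (x + \<tau> *\<^sub>R (s *\<^sub>R h)) \<bullet> (t *\<^sub>R (s *\<^sub>R h)))) (at \<tau>)"
          using inU[of \<tau> 0] that
          by (intro has_derivative_compose[OF _ f]) (auto intro!: derivative_eq_intros)
        have "(\<lambda>t. g (x + \<tau> *\<^sub>R (s *\<^sub>R h) + s *\<^sub>R k) \<bullet> (t *\<^sub>R (s *\<^sub>R h)) - g (x + \<tau> *\<^sub>R (s *\<^sub>R h)) \<bullet> (t *\<^sub>R (s *\<^sub>R h))) =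
            (*) ((g (x + \<tau> *\<^sub>R (s *\<^sub>R h) + s *\<^sub>R k) - g (x + \<tau> *\<^sub>R (s *\<^sub>R h))) \<bullet> (s *\<^sub>R h))"
          by (simp add: fun_eq_iff inner_diff_left algebra_simps)
        with has_derivative_diff[OF 1 2] show ?thesis
          unfolding has_field_derivative_def \<phi>_def by (simp only:)
      qed
      obtain \<tau> where \<tau>: "0 < \<tau>" "\<tau> < 1" and mvt:
        "\<phi> 1 - \<phi> 0 = (g (x + \<tau> *\<^sub>R (s *\<^sub>R h) + s *\<^sub>R k) - g (x + \<tau> *\<^sub>R (s *\<^sub>R h))) \<bullet> (s *\<^sub>R h)"
        using MVT2[of 0 1 \<phi>, OF _ \<phi>'] by auto
      define y z where "y = x + \<tau> *\<^sub>R (s *\<^sub>R h) + s *\<^sub>R k" and "z = x + \<tau> *\<^sub>R (s *\<^sub>R h)"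
      have mvt': "\<phi> 1 - \<phi> 0 = (g y - g z) \<bullet> (s *\<^sub>R h)" using mvt by (simp only: y_def z_def)
      have yx: "norm (y - x) \<le> s * N" using near[of \<tau> 1] \<tau> by (simp add: y_def)
      have zx: "norm (z - x) \<le> s * N" using near[of \<tau> 0] \<tau> by (simp add: z_def)
      have "norm (g y - g z - s *\<^sub>R D k) = norm ((g y - g x - D (y - x)) - (g z - g x - D (z - x)))"
        by (simp add: linear_diff[OF lin, symmetric] linear_scale[OF lin, symmetric] y_def z_def
            linear_add[OF lin] algebra_simps)
      also have "\<dots> \<le> e' * norm (y - x) + e' * norm (z - x)"
        using yx zx sN by (intro order_trans[OF norm_triangle_ineq4] add_mono d) auto
      also have "\<dots> \<le> e' * (s * N) + e' * (s * N)"
        using yx zx e' by (intro add_mono mult_left_mono) auto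
      finally have bound: "norm (g y - g z - s *\<^sub>R D k) \<le> 2 * e' * (s * N)" by (simp add: mult_ac)
      have diff: "\<phi> 1 - \<phi> 0 - s\<^sup>2 * (D k \<bullet> h) = s * ((g y - g z - s *\<^sub>R D k) \<bullet> h)"
        unfolding mvt'
        by (simp add: inner_diff_left power2_eq_square algebra_simps)
      have "\<bar>(g y - g z - s *\<^sub>R D k) \<bullet> h\<bar> \<le> 2 * e' * (s * N) * norm h"
        by (intro order_trans[OF Cauchy_Schwarz_ineq2] mult_right_mono bound) auto
      also have "\<dots> < s * e"
      proof -
        have "2 * N * norm h < 2 * (2 * N * norm h + 1)" using N by (simp add: mult_nonneg_nonneg add_nonneg_pos)
        then have "e * (2 * N * norm h) < e * (2 * (2 * N * norm h + 1))" using e by simp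
        moreover have "0 < 2 * (2 * N * norm h + 1)" using N by (simp add: mult_nonneg_nonneg add_nonneg_pos)
        ultimately have "2 * e' * N * norm h < e" by (simp add: e'_def field_simps)
        then have "s * (2 * e' * N * norm h) < s * e" using s by simp
        then show ?thesis by (simp add: mult_ac)
      qed
      finally have "\<bar>s * ((g y - g z - s *\<^sub>R D k) \<bullet> h)\<bar> < s * (s * e)"
        using s by (simp add: abs_mult)
      then have "\<bar>\<phi> 1 - \<phi> 0 - s\<^sup>2 * (D k \<bullet> h)\<bar> < s\<^sup>2 * e" unfolding diff by (simp add: power2_eq_square)
      moreover have "(\<phi> 1 - \<phi> 0) / s\<^sup>2 - D k \<bullet> h = (\<phi> 1 - \<phi> 0 - s\<^sup>2 * (D k \<bullet> h)) / s\<^sup>2"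
        using s by (simp add: field_simps)
      moreover have "\<phi> 1 - \<phi> 0 = f (x + s *\<^sub>R h + s *\<^sub>R k) - f (x + s *\<^sub>R h) - f (x + s *\<^sub>R k) + f x"
        by (simp add: \<phi>_def)
      ultimately show ?thesis
        using s by (simp add: dist_real_def abs_divide divide_less_eq mult.commute)
    qed
    then show "\<forall>\<^sub>F s in at_right 0. dist ((f (x + s *\<^sub>R h + s *\<^sub>R k) - f (x + s *\<^sub>R h) - f (x + s *\<^sub>R k) + f x) / s\<^sup>2) (D k \<bullet> h) < e"
      using s0 unfolding eventually_at_right_field by auto
  qed
qed

lemma second_derivative_symmetric:
  fixes f :: "'a::real_inner \<Rightarrow> real"
  assumes "open U" "x \<in> U" "\<And>y. y \<in> U \<Longrightarrow> (f has_derivative (\<lambda>h. g y \<bullet> h)) (at y)"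
    and "(g has_derivative D) (at x)"
  shows "D h \<bullet> k = h \<bullet> D k"
proof -
  have "(\<lambda>s. (f (x + s *\<^sub>R h + s *\<^sub>R k) - f (x + s *\<^sub>R h) - f (x + s *\<^sub>R k) + f x) / s\<^sup>2) =
      (\<lambda>s. (f (x + s *\<^sub>R k + s *\<^sub>R h) - f (x + s *\<^sub>R k) - f (x + s *\<^sub>R h) + f x) / s\<^sup>2)"
    by (simp add: algebra_simps)
  from second_difference_quotient[OF assms, of k h, folded this]
  have "D h \<bullet> k = D k \<bullet> h"
    by (rule tendsto_unique[OF trivial_limit_at_right_real _ second_difference_quotient[OF assms]])
  then show ?thesis by (simp add: inner_commute)
qed

text \<open>Two monotonicity arguments replace a Taylor formula: the derivative of
  \<open>\<psi>\<close> is nonpositive by the Hessian bound, and the derivative of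
  \<open>\<theta>\<close> at \<open>t\<close> is \<open>\<psi> t - \<psi> 0\<close>.\<close>

lemma quadratic_upper_bound:
  fixes f :: "'a::real_inner \<Rightarrow> real"
  assumes S: "convex S" "x \<in> S" "y \<in> S"
    and f: "\<And>z. z \<in> S \<Longrightarrow> (f has_derivative (\<lambda>h. g z \<bullet> h)) (at z)"
    and g: "\<And>z. z \<in> S \<Longrightarrow> (g has_derivative D z) (at z)"
    and D: "\<And>z h. z \<in> S \<Longrightarrow> h \<bullet> D z h \<le> \<gamma> * (norm h)\<^sup>2"
  shows "f y \<le> f x + g x \<bullet> (y - x) + \<gamma> / 2 * (norm (y - x))\<^sup>2"
proof -
  define d where "d = y - x"
  have inS: "x + t *\<^sub>R d \<in> S" if "0 \<le> t" "t \<le> 1" for t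
    using convexD_alt[OF S that] by (simp add: d_def algebra_simps)
  define \<psi> where "\<psi> = (\<lambda>t. g (x + t *\<^sub>R d) \<bullet> d - \<gamma> * t * (norm d)\<^sup>2)"
  have \<psi>': "(\<psi> has_real_derivative D (x + t *\<^sub>R d) d \<bullet> d - \<gamma> * (norm d)\<^sup>2) (at t)" if "0 \<le> t" "t \<le> 1" for t
  proof -
    have "((\<lambda>t. g (x + t *\<^sub>R d)) has_derivative (\<lambda>s. D (x + t *\<^sub>R d) (s *\<^sub>R d))) (at t)"
      by (rule has_derivative_compose[of "\<lambda>t. x + t *\<^sub>R d" "\<lambda>s. s *\<^sub>R d" t UNIV g, OF _ g[OF inS[OF that]]]) (auto intro!: derivative_eq_intros)
    then have "((\<lambda>t. g (x + t *\<^sub>R d) \<bullet> d) has_derivative (\<lambda>s. D (x + t *\<^sub>R d) (s *\<^sub>R d) \<bullet> d)) (at t)"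
      by (rule has_derivative_inner_left)
    moreover have "D (x + t *\<^sub>R d) (s *\<^sub>R d) = s *\<^sub>R D (x + t *\<^sub>R d) d" for s
      using linear_scale[OF has_derivative_linear[OF g[OF inS[OF that]]]] .
    ultimately have "((\<lambda>t. g (x + t *\<^sub>R d) \<bullet> d) has_real_derivative D (x + t *\<^sub>R d) d \<bullet> d) (at t)"
      by (simp add: has_field_derivative_def mult_commute_abs)
    then show ?thesis
      unfolding \<psi>_def by (auto intro!: derivative_eq_intros)
  qed
  have \<psi>_le: "\<psi> t \<le> \<psi> 0" if "0 \<le> t" "t \<le> 1" for t
  proof (rule DERIV_nonpos_imp_nonincreasing[OF that(1)])
    fix s assume s: "0 \<le> s" "s \<le> t"
    have "D (x + s *\<^sub>R d) d \<bullet> d - \<gamma> * (norm d)\<^sup>2 \<le> 0"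
      using D[OF inS, of s d] s that by (simp add: inner_commute)
    then show "\<exists>y. DERIV \<psi> s :> y \<and> y \<le> 0" using \<psi>'[of s] s that by auto
  qed
  define \<theta> where "\<theta> = (\<lambda>t. f (x + t *\<^sub>R d) - t * (g x \<bullet> d) - \<gamma> / 2 * t\<^sup>2 * (norm d)\<^sup>2)"
  have "\<theta> 1 \<le> \<theta> 0"
  proof (rule DERIV_nonpos_imp_nonincreasing[where f = \<theta> and a = 0 and b = 1])
    fix t :: real assume t: "0 \<le> t" "t \<le> 1"
    have "((\<lambda>t. f (x + t *\<^sub>R d)) has_derivative (\<lambda>s. g (x + t *\<^sub>R d) \<bullet> (s *\<^sub>R d))) (at t)"
      by (rule has_derivative_compose[of "\<lambda>t. x + t *\<^sub>R d" "\<lambda>s. s *\<^sub>R d" t UNIV f, OF _ f[OF inS[OF t]]]) (auto intro!: derivative_eq_intros)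
    then have "((\<lambda>t. f (x + t *\<^sub>R d)) has_real_derivative g (x + t *\<^sub>R d) \<bullet> d) (at t)"
      by (simp add: has_field_derivative_def mult_commute_abs)
    then have "(\<theta> has_real_derivative g (x + t *\<^sub>R d) \<bullet> d - g x \<bullet> d - \<gamma> * t * (norm d)\<^sup>2) (at t)"
      unfolding \<theta>_def by (auto intro!: derivative_eq_intros)
    moreover have "g (x + t *\<^sub>R d) \<bullet> d - g x \<bullet> d - \<gamma> * t * (norm d)\<^sup>2 \<le> 0"
      using \<psi>_le[OF t] by (simp add: \<psi>_def)
    ultimately show "\<exists>y. DERIV \<theta> t :> y \<and> y \<le> 0" by blast
  qed simp
  then show ?thesis by (simp add: \<theta>_def d_def)
qed

text \<open>The maximum of the Rayleigh quotient is an eigenvalue. The maximum in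
  \<open>lambda_max_sym\<close> is meaningful because eigenvectors for distinct eigenvalues are
  orthogonal, so there are finitely many eigenvalues.\<close>

lemma quadratic_form_le_lambda_max_sym:
  fixes H :: "real ^ 'd ^ 'd"
  assumes sym: "\<And>x y. (H *v x) \<bullet> y = x \<bullet> (H *v y)"
  shows "x \<bullet> (H *v x) \<le> lambda_max_sym H * (norm x)\<^sup>2"
proof -
  define E where "E = {\<mu>. \<exists>v. v \<noteq> 0 \<and> H *v v = \<mu> *\<^sub>R v}"
  define ev where "ev = (\<lambda>\<mu>. SOME v. v \<noteq> 0 \<and> H *v v = \<mu> *\<^sub>R v)"
  have ev: "ev \<mu> \<noteq> 0" "H *v ev \<mu> = \<mu> *\<^sub>R ev \<mu>" if "\<mu> \<in> E" for \<mu>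
    using someI_ex[of "\<lambda>v. v \<noteq> 0 \<and> H *v v = \<mu> *\<^sub>R v"] that unfolding E_def ev_def by auto
  have ortho: "ev \<mu> \<bullet> ev \<nu> = 0" if "\<mu> \<in> E" "\<nu> \<in> E" "\<mu> \<noteq> \<nu>" for \<mu> \<nu>
    using sym[of "ev \<mu>" "ev \<nu>"] ev that by simp
  have "inj_on ev E"
    using ev ortho by (intro inj_onI) (metis inner_eq_zero_iff)
  moreover have "finite (ev ` E)"
  proof (rule independent_imp_finite, rule pairwise_orthogonal_independent)
    show "pairwise orthogonal (ev ` E)" using ortho by (auto simp: pairwise_def orthogonal_def) 
    show "0 \<notin> ev ` E" using ev by auto
  qed
  ultimately have fin: "finite E" using finite_imageD by blast
  show ?thesis
  proof (cases "x = 0")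
    case False
    then have "(UNIV :: (real ^ 'd) set) \<noteq> {0}" by blast
    then obtain v \<mu> where v: "norm v = 1" "H *v v = \<mu> *\<^sub>R v"
      and max: "\<And>x. x \<bullet> (H *v x) \<le> \<mu> * (norm x)\<^sup>2"
      using maximal_eigenvector_exists[of UNIV "(*v) H"] sym by (auto simp: matrix_vector_mul_linear)
    have "\<mu> \<in> E" using v unfolding E_def by (auto intro!: exI[of _ v])
    then have "\<mu> \<le> lambda_max_sym H"
      unfolding lambda_max_sym_def E_def[symmetric] using fin by simp
    then have "\<mu> * (norm x)\<^sup>2 \<le> lambda_max_sym H * (norm x)\<^sup>2" by (intro mult_right_mono) auto
    then show ?thesis using max[of x] by simp
  qed simp
qed

text \<open>Completing the square turns the constraint into a ball with centre \<open>ctr\<close>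
  and radius \<open>R\<close>; by Cauchy-Schwarz, its boundary point in the direction
  \<open>c\<close> is a maximizer, hence the unique one. The radicand is nonnegative since
  \<open>y\<close> is feasible.\<close>

lemma argmax_on_ball:
  fixes c g w y :: "'a::real_inner"
  assumes \<gamma>: "\<gamma> > 0" and c: "c \<noteq> 0"
    and uniq: "{x. is_arg_max (\<lambda>y. c \<bullet> y) (\<lambda>y. l + g \<bullet> (y - w) + \<gamma> / 2 * (norm (y - w))\<^sup>2 \<le> 0) x} = {y}"
  shows "y = w + (1 / \<gamma>) *\<^sub>R ((sqrt ((norm g)\<^sup>2 - 2 * \<gamma> * l) / norm c) *\<^sub>R c - g)"
proof -
  define R2 where "R2 = (norm g)\<^sup>2 - 2 * \<gamma> * l"
  define ctr where "ctr = w - (1 / \<gamma>) *\<^sub>R g"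
  define feas where "feas = (\<lambda>y. l + g \<bullet> (y - w) + \<gamma> / 2 * (norm (y - w))\<^sup>2 \<le> 0)"
  have square: "(norm (y - ctr))\<^sup>2 * \<gamma>\<^sup>2 - R2 = 2 * \<gamma> * (l + g \<bullet> (y - w) + \<gamma> / 2 * (norm (y - w))\<^sup>2)" for y
  proof -
    have "(norm (z + (1 / \<gamma>) *\<^sub>R g))\<^sup>2 = (norm z)\<^sup>2 + 2 / \<gamma> * (g \<bullet> z) + (norm g)\<^sup>2 / \<gamma>\<^sup>2" for z
      unfolding power2_norm_eq_inner using \<gamma>
      by (simp add: inner_add_left inner_add_right inner_commute power2_eq_square field_simps)
    from this[of "y - w"]
    moreover have "y - ctr = (y - w) + (1 / \<gamma>) *\<^sub>R g" by (simp add: ctr_def)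
    ultimately have "(norm (y - ctr))\<^sup>2 = (norm (y - w))\<^sup>2 + 2 / \<gamma> * (g \<bullet> (y - w)) + (norm g)\<^sup>2 / \<gamma>\<^sup>2"
      by (simp only:)
    then show ?thesis using \<gamma> by (simp add: R2_def power2_eq_square field_simps)
  qed
  have feas_iff: "feas y \<longleftrightarrow> (norm (y - ctr))\<^sup>2 * \<gamma>\<^sup>2 \<le> R2" for y
    unfolding feas_def using square[of y] \<gamma>
    by (smt (verit, ccfv_SIG) mult_less_cancel_left_pos mult_zero_right zero_less_mult_iff)
  have "feas y" using uniq unfolding feas_def is_arg_max_def by blast
  then have R2: "R2 \<ge> 0" using feas_iff[of y] by (smt (verit) zero_le_mult_iff zero_le_power2)
  define R where "R = sqrt R2 / \<gamma>"
  have R: "R \<ge> 0" using R2 \<gamma> by (simp add: R_def)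
  have feas_R: "feas y \<longleftrightarrow> norm (y - ctr) \<le> R" for y
  proof -
    have "(norm (y - ctr))\<^sup>2 * \<gamma>\<^sup>2 \<le> R2 \<longleftrightarrow> (norm (y - ctr))\<^sup>2 \<le> R\<^sup>2"
      using \<gamma> R2 by (simp add: R_def power_divide field_simps)
    also have "\<dots> \<longleftrightarrow> norm (y - ctr) \<le> R" using R by (simp add: power2_le_iff_abs_le)
    finally show ?thesis by (simp add: feas_iff)
  qed
  define x where "x = ctr + (R / norm c) *\<^sub>R c"
  have "is_arg_max (\<lambda>y. c \<bullet> y) feas x"
    unfolding is_arg_max_linorder
  proof (intro conjI allI impI)
    show "feas x" unfolding feas_R using R c by (simp add: x_def)
    fix z assume "feas z"
    have "c \<bullet> (z - ctr) \<le> norm c * norm (z - ctr)" by (rule norm_cauchy_schwarz)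
    also have "\<dots> \<le> norm c * R" using \<open>feas z\<close> by (intro mult_left_mono) (auto simp: feas_R)
    also have "\<dots> = c \<bullet> (x - ctr)"
      using c by (simp add: x_def power2_norm_eq_inner[symmetric] power2_eq_square)
    finally show "c \<bullet> z \<le> c \<bullet> x" by (simp add: inner_diff_right)
  qed
  then have "x = y" using uniq unfolding feas_def by blast
  then show ?thesis
    using \<gamma> by (simp add: x_def ctr_def R_def R2_def algebra_simps)
qed

section \<open>Linearization of the iteration\<close>

context psd_compression
begin

text \<open>Normalized iterates approach the kernel of \<open>B\<close>, a line transversal to
  \<open>W\<close>. On unit vectors this leaves two candidates, and the sign condition keeps one.
  Vanishing of \<open>B\<close> on the limit says precisely that its image under \<open>M\<close> is
  parallel to \<open>u\<close>.\<close>

lemma direction_converges: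
  assumes inj: "\<And>x. x \<in> W \<Longrightarrow> B x = 0 \<Longrightarrow> x = 0"
    and nz: "\<And>k. e k \<noteq> 0" and B_lim: "(\<lambda>k. norm (B (e k)) / norm (e k)) \<longlonglongrightarrow> 0"
    and sign: "\<forall>\<^sub>F k in sequentially. u \<bullet> e k \<le> 0"
  shows "\<exists>l\<in>span {u}. (\<lambda>k. M ((1 / norm (e k)) *\<^sub>R e k)) \<longlonglongrightarrow> l"
proof -
  interpret M: linear M by (rule linear_M)
  have "inj_on B W"
  proof (rule inj_onI)
    fix x y assume "x \<in> W" "y \<in> W" "B x = B y"
    then have "x - y = 0"
      using subspace_W by - (rule inj, auto simp: B.diff subspace_diff)
    then show "x = y" by simp
  qed
  have "dim (B ` W) = dim W"
    by (rule dim_image_eq[OF linear_B]) (use \<open>inj_on B W\<close> subspace_W in \<open>simp add: span_eq_iff[THEN iffD2]\<close>)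
  then have "B ` W = W"
    using B_in_W subspace_W linear_subspace_image[OF linear_B subspace_W]
    by (intro subspace_dim_equal) auto
  \<comment> \<open>Surjectivity of \<open>B\<close> on \<open>W\<close> corrects \<open>u\<close>
    by an element of \<open>W\<close> to a kernel vector \<open>w\<close> with
    \<open>u \<bullet> w = 1\<close>.\<close>
  then have "- B u \<in> B ` W" using B_in_W[of u] subspace_W by (simp add: subspace_neg)
  then obtain y where y: "y \<in> W" "B y = - B u" by (metis imageE)
  define w where "w = u + y"
  have Bw: "B w = 0" by (simp add: w_def B.add y)
  have uw: "u \<bullet> w = 1" using y(1) norm_u by (simp add: w_def W_def inner_add_right norm_eq_1 inner_commute)
  then have w_nz: "w \<noteq> 0" by auto
  have "bounded_linear B" using linear_B by (simp add: linear_conv_bounded_linear)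
  then have "\<exists>m>0. \<forall>x\<in>W. m * norm x \<le> norm (B x)"
    by (rule injective_imp_isometric[OF closed_subspace[OF subspace_W] subspace_W]) (use inj in blast)
  then obtain m where m: "m > 0" "\<And>x. x \<in> W \<Longrightarrow> m * norm x \<le> norm (B x)" by blast
  define d where "d = (\<lambda>k. (1 / norm (e k)) *\<^sub>R e k)"
  define s where "s = (\<lambda>k. u \<bullet> d k)"
  define x where "x = (\<lambda>k. d k - s k *\<^sub>R w)"
  have norm_d: "norm (d k) = 1" for k using nz by (simp add: d_def)
  have xW: "x k \<in> W" for k
    by (simp add: x_def W_def inner_diff s_def inner_commute uw)
  have "B (x k) = (1 / norm (e k)) *\<^sub>R B (e k)" for k by (simp add: x_def B.diff B.scale Bw d_def)
  then have norm_Bx: "norm (B (x k)) = norm (B (e k)) / norm (e k)" for k by simp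
  have x_lim: "x \<longlonglongrightarrow> 0"
  proof (rule Lim_null_comparison)
    have "(\<lambda>k. (norm (B (e k)) / norm (e k)) / m) \<longlonglongrightarrow> 0 / m" by (intro tendsto_intros B_lim) (use m in simp)
    then show "(\<lambda>k. (norm (B (e k)) / norm (e k)) / m) \<longlonglongrightarrow> 0" by simp
    show "\<forall>\<^sub>F k in sequentially. norm (x k) \<le> norm (B (e k)) / norm (e k) / m"
      using m(2)[OF xW] m(1) by (simp add: norm_Bx[symmetric] pos_le_divide_eq mult.commute)
  qed
  have "(\<lambda>k. norm (s k *\<^sub>R w) - 1) \<longlonglongrightarrow> 0"
  proof (rule Lim_null_comparison)
    show "(\<lambda>k. norm (x k)) \<longlonglongrightarrow> 0" using x_lim by (rule tendsto_norm_zero)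
    have "norm (norm (s k *\<^sub>R w) - 1) \<le> norm (x k)" for k
      using norm_triangle_ineq3[of "s k *\<^sub>R w" "d k"]
      by (simp only: norm_d real_norm_def x_def norm_minus_commute)
    then show "\<forall>\<^sub>F k in sequentially. norm (norm (s k *\<^sub>R w) - 1) \<le> norm (x k)" by simp
  qed
  then have "(\<lambda>k. \<bar>s k\<bar> * norm w) \<longlonglongrightarrow> 1" by (simp add: LIM_zero_iff)
  then have "(\<lambda>k. - (\<bar>s k\<bar> * norm w / norm w)) \<longlonglongrightarrow> - (1 / norm w)"
    by (intro tendsto_intros) (use w_nz in auto)
  moreover have "\<forall>\<^sub>F k in sequentially. - (\<bar>s k\<bar> * norm w / norm w) = s k"
    using sign
  proof eventually_elim
    case (elim k)
    then have "s k \<le> 0" by (simp add: s_def d_def divide_nonpos_nonneg)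
    then show ?case using w_nz by simp
  qed
  ultimately have s_lim: "s \<longlonglongrightarrow> - (1 / norm w)" by (rule Lim_transform_eventually)
  have "(\<lambda>k. x k + s k *\<^sub>R w) \<longlonglongrightarrow> 0 + (- (1 / norm w)) *\<^sub>R w" by (intro tendsto_intros x_lim s_lim)
  then have "d \<longlonglongrightarrow> (- (1 / norm w)) *\<^sub>R w" by (simp add: x_def)
  then have "(\<lambda>k. M (d k)) \<longlonglongrightarrow> M ((- (1 / norm w)) *\<^sub>R w)"
    using linear_M bounded_linear.tendsto linear_conv_bounded_linear by blast
  moreover have "M ((- (1 / norm w)) *\<^sub>R w) \<in> span {u}"
  proof -
    have "M w = (u \<bullet> M w) *\<^sub>R u" using Bw by (simp add: B_def)
    then have "M w \<in> span {u}" by (metis span_base span_mul singletonI)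
    then show ?thesis unfolding M.scale by (rule span_mul)
  qed
  ultimately show ?thesis unfolding d_def by blast
qed

end

section \<open>Eigenvalues of the compression, optimality condition and derivative of the
  update\<close>

lemma orthonormal_expansion:
  assumes "orthonormal_basis_of m V S" "v \<in> S"
  shows "v = (\<Sum>j<m. (V j \<bullet> v) *\<^sub>R V j)"
proof -
  define y where "y = v - (\<Sum>j<m. (V j \<bullet> v) *\<^sub>R V j)"
  have ortho: "V i \<bullet> V j = (if i = j then 1 else 0)" if "i < m" "j < m" for i j
    using assms(1) that by (simp add: orthonormal_basis_of_def)
  have span: "span (V ` {..<m}) = S" using assms(1) by (simp add: orthonormal_basis_of_def)
  have "y \<in> span (V ` {..<m})"
    unfolding y_def using assms(2) span
    by (intro span_diff span_sum span_scale) (auto intro: span_base)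
  moreover have "orthogonal y x" if "x \<in> V ` {..<m}" for x
  proof -
    from that obtain i where i: "i < m" "x = V i" by auto
    have "V i \<bullet> (\<Sum>j<m. (V j \<bullet> v) *\<^sub>R V j) = (\<Sum>j<m. if i = j then V i \<bullet> v else 0)"
      unfolding inner_sum_right using ortho i(1) by (intro sum.cong) auto
    also have "\<dots> = V i \<bullet> v" using i(1) by simp
    finally show ?thesis by (simp add: i orthogonal_def y_def inner_diff inner_commute)
  qed
  ultimately have "orthogonal y y" by (meson orthogonal_to_span)
  then show ?thesis by (simp add: orthogonal_def y_def)
qed

text \<open>The eigenvalue equation tested against \<open>S\<close> is \<open>K a = \<mu> a\<close>
  for the coordinate vector \<open>a\<close> of \<open>v\<close>. As \<open>K\<close> is symmetric
  and \<open>\<mu> \<ge> 0\<close>, \<open>\<mu>\<close> is a singular value. A nonzero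
  \<open>v\<close> in \<open>S\<close> excludes \<open>m = 0\<close>, where the bounds would be
  unspecified.\<close>

lemma compress_eigenvalue_bounds:
  fixes H :: "real ^ 'd ^ 'd"
  assumes basis: "orthonormal_basis_of m V S"
    and sym: "\<And>x y. (H *v x) \<bullet> y = x \<bullet> (H *v y)"
    and v: "v \<in> S" "v \<noteq> 0" and eig: "\<And>w. w \<in> S \<Longrightarrow> w \<bullet> (\<gamma> *\<^sub>R v - H *v v) = \<mu> * (w \<bullet> v)"
    and \<mu>: "\<mu> \<ge> 0"
  defines "K \<equiv> \<gamma> \<cdot>\<^sub>m 1\<^sub>m m - compress m V H"
  shows "sigma_min K \<le> \<mu>" and "\<mu> \<le> spectral_norm K"
proof -
  have K: "K \<in> carrier_mat m m" unfolding K_def compress_def by (intro minus_carrier_mat mat_carrier)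
  have K_ij: "K $$ (i, j) = (if i = j then \<gamma> else 0) - V i \<bullet> (H *v V j)" if "i < m" "j < m" for i j
    using that by (simp add: K_def compress_def)
  have K_sym: "transpose_mat K = K"
  proof (rule eq_matI)
    fix i j assume "i < dim_row K" "j < dim_col K"
    then have ij: "i < m" "j < m" using K by auto
    show "transpose_mat K $$ (i, j) = K $$ (i, j)"
      using ij K K_ij sym[of "V i" "V j"] by (simp add: inner_commute)
  qed (use K in auto)
  define a where "a = Matrix.vec m (\<lambda>i. V i \<bullet> v)"
  have a: "a \<in> carrier_vec m" by (simp add: a_def)
  have V_S: "V i \<in> S" if "i < m" for i
    using basis that unfolding orthonormal_basis_of_def by (auto intro: span_base)
  have Ka: "K *\<^sub>v a = \<mu> \<cdot>\<^sub>v a"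
  proof (rule eq_vecI)
    fix i assume "i < dim_vec (\<mu> \<cdot>\<^sub>v a)"
    then have i: "i < m" by (simp add: a_def)
    have "vec_index (K *\<^sub>v a) i = (\<Sum>j<m. K $$ (i, j) * (V j \<bullet> v))"
      using i K by (simp add: a_def scalar_prod_def lessThan_atLeast0)
    also have "\<dots> = (\<Sum>j<m. (if i = j then \<gamma> * (V i \<bullet> v) else 0) - V i \<bullet> (H *v ((V j \<bullet> v) *\<^sub>R V j)))"
      using i by (intro sum.cong) (auto simp: K_ij matrix_vector_mult_scaleR algebra_simps)
    also have "\<dots> = \<gamma> * (V i \<bullet> v) - V i \<bullet> (H *v (\<Sum>j<m. (V j \<bullet> v) *\<^sub>R V j))"
      using i by (simp add: sum_subtractf linear_sum[OF matrix_vector_mul_linear] inner_sum_right)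
    also have "\<dots> = V i \<bullet> (\<gamma> *\<^sub>R v - H *v v)"
      unfolding orthonormal_expansion[OF basis v(1), symmetric] by (simp add: inner_diff_right)
    also have "\<dots> = \<mu> * (V i \<bullet> v)" by (rule eig[OF V_S[OF i]])
    finally show "vec_index (K *\<^sub>v a) i = vec_index (\<mu> \<cdot>\<^sub>v a) i" using i by (simp add: a_def)
  qed (use K a in auto)
  have "a \<noteq> 0\<^sub>v m"
  proof
    assume "a = 0\<^sub>v m"
    then have "V i \<bullet> v = 0" if "i < m" for i
      using that unfolding a_def by (metis index_vec index_zero_vec(1))
    then have "v = 0" using orthonormal_expansion[OF basis v(1)] by simp
    then show False using v(2) by simp
  qed
  moreover have "(transpose_mat K * K) *\<^sub>v a = \<mu>\<^sup>2 \<cdot>\<^sub>v a"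
    unfolding K_sym using K a Ka
    by (simp add: assoc_mult_mat_vec[OF K K a] mult_mat_vec[OF K a] smult_smult_assoc power2_eq_square)
  ultimately have "eigenvalue (transpose_mat K * K) (\<mu>\<^sup>2)"
    using K a unfolding eigenvalue_def eigenvector_def by auto
  then have "\<mu> \<in> singular_values K"
    unfolding singular_values_def using \<mu> by (auto intro!: image_eqI[of _ _ "\<mu>\<^sup>2"])
  moreover have "finite (singular_values K)"
  proof -
    have KK: "transpose_mat K * K \<in> carrier_mat m m" using K by simp
    have "char_poly (transpose_mat K * K) \<noteq> 0" using degree_monic_char_poly[OF KK] by force
    then show ?thesis
      unfolding singular_values_def eigenvalue_root_char_poly[OF KK]
      by (intro finite_imageI poly_roots_finite)
  qed
  ultimately show "sigma_min K \<le> \<mu>" "\<mu> \<le> spectral_norm K"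
    unfolding sigma_min_def spectral_norm_def by auto
qed

text \<open>The Karush-Kuhn-Tucker condition: no direction along which \<open>f\<close> stays
  nonpositive can increase \<open>c\<close>. If \<open>f w < 0\<close>, then \<open>c\<close> itself
  would be such a direction.\<close>

lemma local_max_gradient_direction:
  fixes f :: "'a::real_inner \<Rightarrow> real"
  assumes f: "(f has_derivative (\<lambda>h. G \<bullet> h)) (at w)" "f w \<le> 0" and nz: "G \<noteq> 0" "c \<noteq> 0"
    and max: "\<delta> > 0" "\<And>y. f y \<le> 0 \<Longrightarrow> norm (y - w) \<le> \<delta> \<Longrightarrow> c \<bullet> y \<le> c \<bullet> w"
  shows "f w = 0" and "(1 / norm c) *\<^sub>R c = (1 / norm G) *\<^sub>R G"
proof -
  have dir: "c \<bullet> v \<le> 0" if neg: "\<exists>d>0. \<forall>h>0. h < d \<longrightarrow> f (w + h *\<^sub>R v) \<le> 0" for v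
  proof -
    obtain d where d: "d > 0" "\<And>h. 0 < h \<Longrightarrow> h < d \<Longrightarrow> f (w + h *\<^sub>R v) \<le> 0" using neg by blast
    define h where "h = min (d / 2) (\<delta> / (norm v + 1))"
    have n: "norm v + 1 > 0" by (simp add: add_nonneg_pos)
    have h: "0 < h" "h < d" "h \<le> \<delta> / (norm v + 1)" using d(1) max(1) n by (auto simp: h_def)
    have "h * norm v \<le> h * (norm v + 1)" using h(1) by simp
    also have "\<dots> \<le> \<delta>" using h(3) n by (simp add: pos_le_divide_eq)
    finally have "c \<bullet> (w + h *\<^sub>R v) \<le> c \<bullet> w"
      using h d(2)[of h] by (intro max(2)) auto
    then show ?thesis using h(1) by (simp add: inner_add_right mult_le_0_iff)
  qed
  have descent: "c \<bullet> v \<le> 0" if "G \<bullet> v < 0" for v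
  proof (rule dir)
    have "((\<lambda>t. f (w + t *\<^sub>R v)) has_derivative (\<lambda>t. G \<bullet> (t *\<^sub>R v))) (at 0)"
      by (rule has_derivative_compose[of "\<lambda>t. w + t *\<^sub>R v" "\<lambda>t. t *\<^sub>R v" 0 UNIV f])
        (use f(1) in \<open>auto intro!: derivative_eq_intros\<close>)
    then have "((\<lambda>t. f (w + t *\<^sub>R v)) has_real_derivative G \<bullet> v) (at 0)"
      by (simp add: has_field_derivative_def mult_commute_abs)
    from DERIV_neg_dec_right[OF this that]
    show "\<exists>d>0. \<forall>h>0. h < d \<longrightarrow> f (w + h *\<^sub>R v) \<le> 0" using f(2) by fastforce
  qed
  have "f w = 0"
  proof (rule ccontr)
    assume "f w \<noteq> 0"
    then have "f w < 0" using f(2) by simp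
    have "isCont f w" using f(1) has_derivative_continuous by blast
    then have cont: "isCont f (w + 0 *\<^sub>R c)" by simp
    have "((\<lambda>t. w + t *\<^sub>R c) \<longlongrightarrow> w + 0 *\<^sub>R c) (at_right 0)" by (intro tendsto_intros)
    from isCont_tendsto_compose[OF cont this]
    have "((\<lambda>t. f (w + t *\<^sub>R c)) \<longlongrightarrow> f w) (at_right 0)" by simp
    from order_tendstoD(2)[OF this \<open>f w < 0\<close>]
    have "\<exists>d>0. \<forall>h>0. h < d \<longrightarrow> f (w + h *\<^sub>R c) \<le> 0"
      unfolding eventually_at_right_field by (meson less_imp_le)
    from dir[OF this] show False using nz(2) by (metis inner_gt_zero_iff not_le)
  qed
  then show "f w = 0" .
  \<comment> \<open>\<open>d\<close> is the part of \<open>c\<close> orthogonal to \<open>G\<close>.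
    Subtracting \<open>t *\<^sub>R G\<close> makes it a strict descent direction of
    \<open>f\<close>, and letting \<open>t\<close> tend to 0 forces \<open>d = 0\<close>.\<close>
  define \<alpha> where "\<alpha> = (c \<bullet> G) / (G \<bullet> G)"
  define d where "d = c - \<alpha> *\<^sub>R G"
  have GG: "G \<bullet> G > 0" using nz by simp
  have dG: "d \<bullet> G = 0" using GG by (simp add: d_def \<alpha>_def inner_diff_left)
  have "d \<bullet> d \<le> t * \<alpha> * (G \<bullet> G)" if "t > 0" for t
  proof -
    have "c \<bullet> (d - t *\<^sub>R G) \<le> 0"
      using that GG dG by (intro descent) (simp add: inner_diff_right inner_commute)
    moreover have "c = d + \<alpha> *\<^sub>R G" by (simp add: d_def)
    ultimately show ?thesis using dG by (simp add: inner_diff inner_add inner_commute)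
  qed
  moreover have "((\<lambda>t. t * \<alpha> * (G \<bullet> G)) \<longlongrightarrow> 0 * \<alpha> * (G \<bullet> G)) (at_right 0)"
    by (intro tendsto_intros)
  ultimately have "d \<bullet> d \<le> 0 * \<alpha> * (G \<bullet> G)"
    by (intro tendsto_lowerbound) (auto simp: eventually_at_right_less intro: eventually_mono[OF eventually_at_right_less])
  then have "d \<bullet> d \<le> 0" by simp
  then have "d = 0" by (metis inner_gt_zero_iff not_le)
  then have c: "c = \<alpha> *\<^sub>R G" by (simp add: d_def)
  have "c \<bullet> (- G) \<le> 0" using GG by (intro descent) simp
  then have "\<alpha> \<ge> 0" using GG by (simp add: c zero_le_mult_iff)
  then have "\<alpha> > 0" using c nz by (cases "\<alpha> = 0") auto
  then show "(1 / norm c) *\<^sub>R c = (1 / norm G) *\<^sub>R G" by (simp add: c)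
qed

text \<open>As \<open>f w = 0\<close>, the radicand at \<open>w\<close> is the positive number
  \<open>(norm (g w))\<^sup>2\<close>, so the root is differentiable, with derivative
  \<open>u \<bullet> D h - \<gamma> * (u \<bullet> h)\<close>. This is exactly what removes the
  component of \<open>h - (1 / \<gamma>) *\<^sub>R D h\<close> along \<open>u\<close>.\<close>

lemma update_has_derivative:
  fixes g :: "'a::real_inner \<Rightarrow> 'a" and f :: "'a \<Rightarrow> real"
  assumes f: "(f has_derivative (\<lambda>h. g w \<bullet> h)) (at w)" "f w = 0"
    and g: "(g has_derivative D) (at w)" and sym: "\<And>x y. D x \<bullet> y = x \<bullet> D y"
    and u: "g w = norm (g w) *\<^sub>R u" "g w \<noteq> 0" and \<gamma>: "\<gamma> > 0"
  shows "((\<lambda>x. x + (1 / \<gamma>) *\<^sub>R (sqrt ((norm (g x))\<^sup>2 - 2 * \<gamma> * f x) *\<^sub>R u - g x)) has_derivative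
    (\<lambda>h. (h - (1 / \<gamma>) *\<^sub>R D h) - (u \<bullet> (h - (1 / \<gamma>) *\<^sub>R D h)) *\<^sub>R u)) (at w)"
proof -
  define N where "N = norm (g w)"
  have N: "N > 0" using u(2) by (simp add: N_def)
  have gw: "g w = N *\<^sub>R u" using u(1) by (simp add: N_def)
  have inner: "((\<lambda>x. g x \<bullet> g x - 2 * \<gamma> * f x) has_derivative
      (\<lambda>h. (g w \<bullet> D h + D h \<bullet> g w) - 2 * \<gamma> * (g w \<bullet> h))) (at w)"
    by (intro has_derivative_diff has_derivative_inner g has_derivative_mult_right f)
  have value_w: "g w \<bullet> g w - 2 * \<gamma> * f w = N\<^sup>2" by (simp add: f(2) N_def power2_norm_eq_inner)
  then have pos: "0 < g w \<bullet> g w - 2 * \<gamma> * f w" using N by simp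
  have "((\<lambda>x. sqrt (g x \<bullet> g x - 2 * \<gamma> * f x)) has_derivative
      (\<lambda>h. ((g w \<bullet> D h + D h \<bullet> g w) - 2 * \<gamma> * (g w \<bullet> h)) * (inverse (sqrt (N\<^sup>2)) / 2))) (at w)"
    using has_derivative_real_sqrt[OF pos inner] unfolding value_w by simp
  moreover have "(\<lambda>h. ((g w \<bullet> D h + D h \<bullet> g w) - 2 * \<gamma> * (g w \<bullet> h)) * (inverse (sqrt (N\<^sup>2)) / 2)) =
      (\<lambda>h. u \<bullet> D h - \<gamma> * (u \<bullet> h))"
    using N by (simp add: fun_eq_iff gw inner_commute[of "D _"] field_simps)
  ultimately have "((\<lambda>x. sqrt ((norm (g x))\<^sup>2 - 2 * \<gamma> * f x)) has_derivative
      (\<lambda>h. u \<bullet> D h - \<gamma> * (u \<bullet> h))) (at w)"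
    by (simp only: power2_norm_eq_inner)
  then have "((\<lambda>x. x + (1 / \<gamma>) *\<^sub>R (sqrt ((norm (g x))\<^sup>2 - 2 * \<gamma> * f x) *\<^sub>R u - g x)) has_derivative
    (\<lambda>h. h + (1 / \<gamma>) *\<^sub>R ((u \<bullet> D h - \<gamma> * (u \<bullet> h)) *\<^sub>R u - D h))) (at w)"
    by (intro has_derivative_add has_derivative_ident has_derivative_scaleR_right has_derivative_diff
        has_derivative_scaleR_left g)
  moreover have "h + (1 / \<gamma>) *\<^sub>R ((u \<bullet> D h - \<gamma> * (u \<bullet> h)) *\<^sub>R u - D h) =
      (h - (1 / \<gamma>) *\<^sub>R D h) - (u \<bullet> (h - (1 / \<gamma>) *\<^sub>R D h)) *\<^sub>R u" for h
    using \<gamma> by (simp add: inner_diff_right scaleR_diff_right scaleR_diff_left diff_divide_distrib)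
  ultimately show ?thesis by simp
qed

theorem theorem4p5:
  fixes A :: "real ^ 'd \<Rightarrow> complex mat"
    and n :: nat
    and c :: "real ^ 'd"
    and \<gamma> :: real
    and lam :: "real ^ 'd \<Rightarrow> real"
    and \<omega> :: "nat \<Rightarrow> real ^ 'd"
    and \<omega>s u :: "real ^ 'd"
    and H :: "real ^ 'd ^ 'd"
    and V :: "nat \<Rightarrow> real ^ 'd"
    and HV :: "real mat"
    and p :: "nat \<Rightarrow> real ^ 'd"
    and r :: "nat \<Rightarrow> real"
  assumes n_pos: "n \<ge> 1"
    and analytic: "real_analytic_mat n A"
    and hermitian: "\<And>x. mat_adjoint (A x) = A x"
    and c_nz: "c \<noteq> 0"
    and lam_def: "lam = (\<lambda>x. lambda_min (A x))"
    and bounded_feasible: "bounded (feasible A)"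
    and \<gamma>_pos: "\<gamma> > 0"
    and \<gamma>_bound: "\<And>x. simple_lambda_min (A x) \<Longrightarrow> lambda_max_sym (hess lam x) \<le> \<gamma>"
    and start: "\<omega> 0 \<in> feasible A"
    and iter: "\<And>k. {x. is_arg_max (\<lambda>y. c \<bullet> y) (\<lambda>y. quad_model lam \<gamma> (\<omega> k) y \<le> 0) x}
                    = {\<omega> (Suc k)}"
    and simple_iter: "\<And>k. simple_lambda_min (A (\<omega> k))"
    and grad_iter: "\<And>k. grad lam (\<omega> k) \<noteq> 0"
    and converges: "\<omega> \<longlonglongrightarrow> \<omega>s"
    and local_max: "local_maximizer c (feasible A) \<omega>s"
    and simple_lim: "simple_lambda_min (A \<omega>s)"
    and grad_lim: "grad lam \<omega>s \<noteq> 0"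
    and H_def: "H = hess lam \<omega>s"
    and u_def: "u = (1 / norm (grad lam \<omega>s)) *\<^sub>R grad lam \<omega>s"
    and V_basis: "orthonormal_basis_of (CARD('d) - 1) V {x. x \<bullet> grad lam \<omega>s = 0}"
    and HV_def: "HV = compress (CARD('d) - 1) V H"
    and p_def: "p = (\<lambda>k. (Finite_Cartesian_Product.mat 1 - (1 / \<gamma>) *\<^sub>R H)
                           *v ((1 / norm (\<omega> k - \<omega>s)) *\<^sub>R (\<omega> k - \<omega>s)))"
    and r_def: "r = (\<lambda>k. norm (\<omega> (Suc k) - \<omega>s) / norm (\<omega> k - \<omega>s))"
  shows
    "((\<exists>l \<in> span {u}. p \<longlonglongrightarrow> l) \<longrightarrow> r \<longlonglongrightarrow> 0)
     \<and>
     (\<not> (\<exists>l \<in> span {u}. p \<longlonglongrightarrow> l) \<longrightarrow>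
       (\<exists>\<rho>. r \<longlonglongrightarrow> \<rho> \<and>
         1 / \<gamma> * sigma_min (\<gamma> \<cdot>\<^sub>m 1\<^sub>m (CARD('d) - 1) - HV) \<le> \<rho> \<and>
         \<rho> \<le> 1 / \<gamma> * spectral_norm (\<gamma> \<cdot>\<^sub>m 1\<^sub>m (CARD('d) - 1) - HV)))"
proof -
  define U where "U = {x. simple_lambda_min (A x)}"
  have openU: "open U" unfolding U_def by (rule open_simple[OF analytic hermitian])
  have diff: "times_differentiable_on 2 U (\<lambda>x. complex_of_real (lam x))"
    unfolding U_def lam_def by (rule lambda_min_times_differentiable[OF analytic hermitian])
  note lam' = grad_hess_of_times_differentiable(1)[OF diff _ openU]
    and grad' = grad_hess_of_times_differentiable(2)[OF diff _ openU]
  have hess_sym: "(hess lam x *v y) \<bullet> z = y \<bullet> (hess lam x *v z)" if "x \<in> U" for x y z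
    by (rule second_derivative_symmetric[OF openU that lam' grad'[OF that]])
  have hess_le: "y \<bullet> (hess lam x *v y) \<le> \<gamma> * (norm y)\<^sup>2" if "x \<in> U" for x y
  proof -
    have "y \<bullet> (hess lam x *v y) \<le> lambda_max_sym (hess lam x) * (norm y)\<^sup>2"
      by (rule quadratic_form_le_lambda_max_sym[OF hess_sym[OF that]])
    also have "\<dots> \<le> \<gamma> * (norm y)\<^sup>2"
      using \<gamma>_bound that by (intro mult_right_mono) (auto simp: U_def)
    finally show ?thesis .
  qed
  have s_U: "\<omega>s \<in> U" using simple_lim by (simp add: U_def)
  define G where "G = grad lam \<omega>s"
  have G: "G \<noteq> 0" "u = (1 / norm G) *\<^sub>R G" using grad_lim u_def by (auto simp: G_def)
  have norm_u: "norm u = 1" using G by simp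
  obtain \<delta> where \<delta>: "\<delta> > 0" "\<And>y. lam y \<le> 0 \<Longrightarrow> norm (y - \<omega>s) \<le> \<delta> \<Longrightarrow> c \<bullet> y \<le> c \<bullet> \<omega>s"
    using local_max by (auto simp: local_maximizer_def feasible_def lam_def)
  have "lam \<omega>s \<le> 0" using local_max by (simp add: local_maximizer_def feasible_def lam_def)
  note kkt = local_max_gradient_direction[OF lam'[OF s_U] this grad_lim c_nz \<delta>]
  have c_u: "(1 / norm c) *\<^sub>R c = u" using kkt(2) G(2) by (simp add: G_def)
  define M where "M = (\<lambda>h. h - (1 / \<gamma>) *\<^sub>R (H *v h))"
  have M_linear: "linear M"
    unfolding M_def by (rule linearI)
      (simp_all add: matrix_vector_right_distrib matrix_vector_mult_scaleR algebra_simps)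
  have M_sym: "M x \<bullet> y = x \<bullet> M y" for x y
    using hess_sym[OF s_U, of x y] by (simp add: M_def H_def inner_diff)
  have M_psd: "0 \<le> x \<bullet> M x" for x
    using hess_le[OF s_U, of x] \<gamma>_pos
    by (simp add: M_def H_def inner_diff_right power2_norm_eq_inner pos_divide_le_eq mult.commute)
  interpret psd_compression M u
    by (rule psd_compression.intro[OF M_linear M_sym M_psd norm_u])
  define T where "T = (\<lambda>x. x + (1 / \<gamma>) *\<^sub>R (sqrt ((norm (grad lam x))\<^sup>2 - 2 * \<gamma> * lam x) *\<^sub>R u - grad lam x))"
  have step: "\<omega> (Suc k) = T (\<omega> k)" for k
  proof -
    have "\<omega> (Suc k) = \<omega> k + (1 / \<gamma>) *\<^sub>R ((sqrt ((norm (grad lam (\<omega> k)))\<^sup>2 - 2 * \<gamma> * lam (\<omega> k)) / norm c) *\<^sub>R c - grad lam (\<omega> k))"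
      using iter[of k] unfolding quad_model_def by (rule argmax_on_ball[OF \<gamma>_pos c_nz])
    then show ?thesis by (simp add: T_def c_u[symmetric])
  qed
  have G_u: "grad lam \<omega>s = norm (grad lam \<omega>s) *\<^sub>R u" using G by (simp add: G_def)
  have T_s: "T \<omega>s = \<omega>s" using G_u by (simp add: T_def kkt(1))
  have B_eq: "B = (\<lambda>h. (h - (1 / \<gamma>) *\<^sub>R (H *v h)) - (u \<bullet> (h - (1 / \<gamma>) *\<^sub>R (H *v h))) *\<^sub>R u)"
    by (rule ext, subst B_def) (simp only: M_def)
  have T': "(T has_derivative B) (at \<omega>s)"
    unfolding T_def B_eq H_def
    by (rule update_has_derivative[OF lam'[OF s_U] kkt(1) grad'[OF s_U] hess_sym[OF s_U] G_u grad_lim \<gamma>_pos])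
  have p_M: "p = (\<lambda>k. M ((1 / norm (\<omega> k - \<omega>s)) *\<^sub>R (\<omega> k - \<omega>s)))"
    by (simp add: p_def M_def matrix_vector_mult_diff_rdistrib scaleR_matrix_vector_assoc)
  show ?thesis
  proof (cases "\<exists>j. \<omega> j = \<omega>s")
    \<comment> \<open>The sequence is then constant from \<open>j\<close> on, and division by zero,
      which yields 0, makes both \<open>p\<close> and \<open>r\<close> eventually 0.\<close>
    case True
    then obtain j where j: "\<omega> j = \<omega>s" by blast
    have const: "\<omega> k = \<omega>s" if "k \<ge> j" for k
      using that by (induction k rule: dec_induct) (auto simp: j step T_s)
    have "\<forall>\<^sub>F k in sequentially. r k = 0" "\<forall>\<^sub>F k in sequentially. p k = 0"
      using const linear_0[OF linear_M]
      by (auto simp: r_def p_M eventually_sequentially intro!: exI[of _ j])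
    then have "r \<longlonglongrightarrow> 0" "p \<longlonglongrightarrow> 0" by (auto intro: tendsto_eventually)
    then show ?thesis using span_zero by blast
  next
    case False
    define e where "e = (\<lambda>k. \<omega> k - \<omega>s)"
    have nz: "e k \<noteq> 0" for k using False by (auto simp: e_def)
    have r_e: "r = (\<lambda>k. norm (e (Suc k)) / norm (e k))" by (simp add: r_def e_def)
    have p_e: "p = (\<lambda>k. M ((1 / norm (e k)) *\<^sub>R e k))" by (simp add: p_M e_def)
    \<comment> \<open>The filter excludes \<open>\<omega>s\<close> itself; this is where the case
      assumption is needed.\<close>
    have "filterlim \<omega> (at \<omega>s) sequentially"
      using converges False by (auto simp: filterlim_at)
    moreover have "((\<lambda>y. norm (T y - T \<omega>s - B (y - \<omega>s)) / norm (y - \<omega>s)) \<longlongrightarrow> 0) (at \<omega>s)"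
      using T' by (simp add: has_derivative_iff_norm)
    ultimately have rem: "(\<lambda>k. norm (e (Suc k) - B (e k)) / norm (e k)) \<longlonglongrightarrow> 0"
      by (drule_tac filterlim_compose) (auto simp: e_def step T_s)
    obtain \<rho> where \<rho>: "r \<longlonglongrightarrow> \<rho>" "\<rho> = 0 \<or> (\<rho> > 0 \<and> (\<exists>v\<in>W. v \<noteq> 0 \<and> B v = \<rho> *\<^sub>R v))"
      using power_iteration_ratio[of e, OF nz rem] unfolding r_e by blast
    have norm_B: "(\<lambda>k. norm (B (e k)) / norm (e k)) \<longlonglongrightarrow> \<rho>"
    proof (rule Lim_transform2[OF \<rho>(1)])
      show "(\<lambda>k. r k - norm (B (e k)) / norm (e k)) \<longlonglongrightarrow> 0"
      proof (rule Lim_null_comparison[OF _ rem], rule always_eventually, rule allI)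
        fix k
        have "\<bar>norm (e (Suc k)) - norm (B (e k))\<bar> / norm (e k) \<le> norm (e (Suc k) - B (e k)) / norm (e k)"
          by (intro divide_right_mono norm_triangle_ineq3) simp
        then show "norm (r k - norm (B (e k)) / norm (e k)) \<le> norm (e (Suc k) - B (e k)) / norm (e k)"
          by (simp add: r_e diff_divide_distrib[symmetric])
      qed
    qed
    obtain \<epsilon> where \<epsilon>: "\<epsilon> > 0" "ball \<omega>s \<epsilon> \<subseteq> U" using openU s_U open_contains_ball by blast
    have "\<forall>\<^sub>F k in sequentially. dist (\<omega> k) \<omega>s < min \<epsilon> \<delta>"
      using converges \<epsilon>(1) \<delta>(1) by (intro tendstoD) auto
    then have near: "\<forall>\<^sub>F k in sequentially. dist (\<omega> k) \<omega>s < min \<epsilon> \<delta> \<and> dist (\<omega> (Suc k)) \<omega>s < min \<epsilon> \<delta>"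
      by (auto simp: eventually_sequentially)
    have "\<forall>\<^sub>F k in sequentially. u \<bullet> e (Suc k) \<le> 0"
      using near
    proof eventually_elim
      case (elim k)
      have ball: "\<omega> k \<in> ball \<omega>s \<epsilon>" "\<omega> (Suc k) \<in> ball \<omega>s \<epsilon>"
        using elim by (auto simp: dist_commute)
      \<comment> \<open>The model majorizes \<open>lam\<close> only along a segment of simple
        points, which the convex ball inside \<open>U\<close> provides. The next iterate is
        therefore feasible, and local maximality bounds its objective value.\<close>
      have "lam (\<omega> (Suc k)) \<le> quad_model lam \<gamma> (\<omega> k) (\<omega> (Suc k))"
        unfolding quad_model_def
        by (rule quadratic_upper_bound[OF convex_ball ball, where D = "\<lambda>z. (*v) (hess lam z)"])
          (use \<epsilon>(2) in \<open>blast intro: lam' grad' hess_le\<close>)+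
      also have "\<dots> \<le> 0" using iter[of k] unfolding is_arg_max_def by blast
      finally have "c \<bullet> \<omega> (Suc k) \<le> c \<bullet> \<omega>s"
        using elim by (intro \<delta>(2)) (auto simp: dist_norm)
      then show ?case
        using c_nz by (simp add: c_u[symmetric] e_def inner_diff_right divide_right_mono)
    qed
    then have sign: "\<forall>\<^sub>F k in sequentially. u \<bullet> e k \<le> 0"
      by (rule eventually_sequentially_Suc[THEN iffD1])
    show ?thesis
    proof (intro conjI impI)
      assume "\<exists>l\<in>span {u}. p \<longlonglongrightarrow> l"
      then obtain t where t: "p \<longlonglongrightarrow> t *\<^sub>R u" by (auto simp: span_singleton)
      \<comment> \<open>Projecting along \<open>u\<close> turns \<open>p k\<close> into
        \<open>B (e k)\<close> divided by \<open>norm (e k)\<close> and annihilates the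
        limit.\<close>
      have "(\<lambda>k. norm (p k - (u \<bullet> p k) *\<^sub>R u)) \<longlonglongrightarrow> norm (t *\<^sub>R u - (u \<bullet> (t *\<^sub>R u)) *\<^sub>R u)"
        by (intro tendsto_intros t)
      moreover have "norm (p k - (u \<bullet> p k) *\<^sub>R u) = norm (B (e k)) / norm (e k)" for k
      proof -
        have "p k - (u \<bullet> p k) *\<^sub>R u = B ((1 / norm (e k)) *\<^sub>R e k)" by (simp add: p_e B_def)
        then show ?thesis by (simp add: B.scale)
      qed
      ultimately have "(\<lambda>k. norm (B (e k)) / norm (e k)) \<longlonglongrightarrow> 0"
        using norm_u by (simp add: norm_eq_1)
      then have "\<rho> = 0" using LIMSEQ_unique[OF norm_B] by simp
      then show "r \<longlonglongrightarrow> 0" using \<rho>(1) by simp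
    next
      assume no_lim: "\<not> (\<exists>l\<in>span {u}. p \<longlonglongrightarrow> l)"
      obtain v where v: "v \<in> W" "v \<noteq> 0" "B v = \<rho> *\<^sub>R v"
      proof (cases "\<rho> = 0")
        case True
        \<comment> \<open>If \<open>B\<close> were injective on \<open>W\<close>, the direction
          would converge and \<open>p\<close> would have a limit in the span of \<open>u\<close>,
          against the case assumption. So 0 has an eigenvector in \<open>W\<close>.\<close>
        have "\<not> (\<forall>x\<in>W. B x = 0 \<longrightarrow> x = 0)"
          using direction_converges[of e, OF _ nz _ sign] norm_B no_lim True unfolding p_e by blast
        then show ?thesis using that True by auto
      next
        case False
        then show ?thesis using \<rho>(2) that by blast
      qed
      have \<rho>_nonneg: "\<rho> \<ge> 0" using \<rho>(2) by auto
      have basis: "orthonormal_basis_of (CARD('d) - 1) V W"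
      proof -
        have "x \<bullet> u = 0 \<longleftrightarrow> x \<bullet> G = 0" for x using G by simp
        then have "W = {x. x \<bullet> grad lam \<omega>s = 0}" unfolding W_def G_def by simp
        then show ?thesis using V_basis by simp
      qed
      have eig: "w \<bullet> (\<gamma> *\<^sub>R v - H *v v) = (\<gamma> * \<rho>) * (w \<bullet> v)" if "w \<in> W" for w
      proof -
        have "w \<bullet> (\<gamma> *\<^sub>R v - H *v v) = \<gamma> * (w \<bullet> M v)" using \<gamma>_pos by (simp add: M_def inner_diff_right algebra_simps)
        also have "\<dots> = \<gamma> * (w \<bullet> B v)" using inner_B[OF that] by simp
        finally show ?thesis by (simp add: v(3))
      qed
      note bounds = compress_eigenvalue_bounds[OF basis hess_sym[OF s_U, folded H_def] v(1,2) eig, folded HV_def]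
      show "\<exists>\<rho>. r \<longlonglongrightarrow> \<rho> \<and>
          1 / \<gamma> * sigma_min (\<gamma> \<cdot>\<^sub>m 1\<^sub>m (CARD('d) - 1) - HV) \<le> \<rho> \<and>
          \<rho> \<le> 1 / \<gamma> * spectral_norm (\<gamma> \<cdot>\<^sub>m 1\<^sub>m (CARD('d) - 1) - HV)"
        using \<rho>(1) bounds \<rho>_nonneg \<gamma>_pos
        by (intro exI[of _ \<rho>]) (auto simp: field_simps)
    qed
  qed
qed

end
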